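(* Let $G$ be a real Lie group with complexified Lie algebra $\mathfrak g_{\mathbb C}$ and let $X$ be a $G$-manifold. The following three categories are isomorphic: (1) The category $\mathrm{Vect}_{T_{\mathbb C}G}^{\mathrm{aff},\mathbb C}(X)$ of complex affine actions of $T_{\mathbb C}G$ over $X$. (2) The category of pairs $(E,\rho_{\mathfrak g_{\mathbb C}})$: the objects are pairs $(E,\rho_{\mathfrak g_{\mathbb C}})$, where $E$ is a $G$-equivariant complex vector bundle over $X$ and $\rho_{\mathfrak g_{\mathbb C}}:\mathfrak g_{\mathbb C}\to\Gamma(E)$ is a $G$-equivariant complex linear map; the morphisms $(E,\rho_{\mathfrak g_{\mathbb C}})\to(E',\rho'_{\mathfrak g_{\mathbb C}})$ are the morphisms $\psi:E\to E'$ of $G$-equivariant complex vector bundles over $X$ such that $\Gamma(\psi)\circ\rho_{\mathfrak g_{\mathbb C}}=\rho'_{\mathfrak g_{\mathbb C}}$; composition is composition of morphisms of complex vector bundles over $X$. (3) The slice category $(\mathfrak g_{\mathbb C})_X\backslash\mathrm{Vect}_G^{\mathbb C}(X)$.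
   Context: All manifolds are smooth, finite-dimensional and real; complex vector bundles are smooth of finite rank. A $G$-manifold is a manifold $X$ with a smooth left action $t:G\times X\to X$, $t(g,x)=g\cdot x$. $\mathrm{Vect}_G^{\mathbb C}(X)$ is the category of $G$-equivariant complex vector bundles over $X$ (left $G$-action on $E$ covering $t$ and fibrewise complex linear) with $G$-equivariant complex vector bundle morphisms over $X$. $G$ acts on $\Gamma(E)$ by $(g\cdot\xi)_x=g\cdot\xi_{g^{-1}\cdot x}$ and on $\mathfrak g_{\mathbb C}=\mathfrak g\otimes\mathbb C$ by the complexified adjoint representation. $(\mathfrak g_{\mathbb C})_X$ is the trivial bundle $X\times\mathfrak g_{\mathbb C}$ with $G$-action $g\cdot(x,\alpha)=(g\cdot x,\mathrm{Ad}_g\alpha)$. The complexified tangent bundle $T_{\mathbb C}G=TG\otimes\mathbb C$ is a complex vector bundle over $G$ and a real Lie group, with multiplication $v_g\bullet w_h=(L_g)_*w_h+(R_h)_*v_g$ (with complex-linearly extended derivatives). A complex affine action of $T_{\mathbb C}G$ on a complex vector bundle $E\to X$ is a left action $T_{\mathbb C}G\times E\to E$ of the Lie group $T_{\mathbb C}G$ that is a morphism of complex vector bundles covering $t:G\times X\to X$ (with $T_{\mathbb C}G\times E$ a complex vector bundle over $G\times X$ with fibre $(T_{\mathbb C}G)_g\oplus E_x$). Morphisms are $T_{\mathbb C}G$-equivariant morphisms of complex vector bundles over $X$. These form $\mathrm{Vect}_{T_{\mathbb C}G}^{\mathrm{aff},\mathbb C}(X)$. For an object $m$ of a category $\mathscr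 C$, $m\backslash\mathscr C$ is the category whose objects are pairs $(a,f)$ with $f:m\to a$ a morphism of $\mathscr C$, whose morphisms $(a,f)\to(a',f')$ are the morphisms $\chi:a\to a'$ with $\chi\circ f=f'$, with composition as in $\mathscr C$. *)

theory Defs
  imports "HOL-Analysis.Analysis" "HOL-Algebra.Module" "HOL-Algebra.Group_Action"
begin

section \<open>Smooth maps between open subsets of Euclidean spaces\<close>

text \<open>Ranks and dimensions vary inside one category, so they cannot be types: \<open>\<real>\<^sup>n\<close> is the set of
  real sequences supported on the first \<open>n\<close> indices. The topology of \<^typ>\<open>nat \<Rightarrow> real\<close> is the
  product topology, which induces the Euclidean topology on this subset.\<close>

definition euc :: "nat \<Rightarrow> (nat \<Rightarrow> real) set" where
  "euc n = {v. \<forall>i\<ge>n. v i = 0}"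

definition euc_open :: "nat \<Rightarrow> (nat \<Rightarrow> real) set \<Rightarrow> bool" where
  "euc_open n V \<longleftrightarrow> openin (top_of_set (euc n)) V"

definition append_vec :: "nat \<Rightarrow> (nat \<Rightarrow> 'k) \<Rightarrow> (nat \<Rightarrow> 'k) \<Rightarrow> nat \<Rightarrow> 'k" where
  "append_vec n v w = (\<lambda>i. if i < n then v i else w (i - n))"

definition partial_deriv :: "nat \<Rightarrow> ((nat \<Rightarrow> real) \<Rightarrow> real) \<Rightarrow> (nat \<Rightarrow> real) \<Rightarrow> real" where
  "partial_deriv i f x = deriv (\<lambda>s. f (x(i := s))) (x i)"

primrec C_diff :: "nat \<Rightarrow> nat \<Rightarrow> (nat \<Rightarrow> real) set \<Rightarrow> ((nat \<Rightarrow> real) \<Rightarrow> real) \<Rightarrow> bool" where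
  "C_diff 0 n U f \<longleftrightarrow> continuous_on U f"
| "C_diff (Suc k) n U f \<longleftrightarrow> continuous_on U f \<and>
     (\<forall>i<n. (\<forall>x\<in>U. (\<lambda>s. f (x(i := s))) differentiable (at (x i))) \<and>
            C_diff k n U (partial_deriv i f))"

definition euc_smooth ::
    "nat \<Rightarrow> (nat \<Rightarrow> real) set \<Rightarrow> nat \<Rightarrow> ((nat \<Rightarrow> real) \<Rightarrow> nat \<Rightarrow> real) \<Rightarrow> bool" where
  "euc_smooth n U m F \<longleftrightarrow> F ` U \<subseteq> euc m \<and> (\<forall>j<m. \<forall>k. C_diff k n U (\<lambda>x. F x j))"

text \<open>The Jacobian matrix of \<open>F\<close> at \<open>x\<close> (a map germ from \<open>\<real>\<^sup>n\<close> to \<open>\<real>\<^sup>m\<close>) applied to \<open>v\<close>.\<close>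

definition jacobian ::
    "nat \<Rightarrow> nat \<Rightarrow> ((nat \<Rightarrow> real) \<Rightarrow> nat \<Rightarrow> real) \<Rightarrow> (nat \<Rightarrow> real) \<Rightarrow> (nat \<Rightarrow> real) \<Rightarrow> nat \<Rightarrow> real" where
  "jacobian n m F x v =
     (\<lambda>j. if j < m then (\<Sum>i<n. partial_deriv i (\<lambda>y. F y j) x * v i) else 0)"


section \<open>Smooth manifolds\<close>

record 'a chart =
  cdim :: nat
  cdom :: "'a set"
  cmap :: "'a \<Rightarrow> nat \<Rightarrow> real"

record 'a manifold = "'a partial_object" +
  atlas :: "'a chart set"

definition cinv :: "'a chart \<Rightarrow> (nat \<Rightarrow> real) \<Rightarrow> 'a" where
  "cinv c = the_inv_into (cdom c) (cmap c)"

text \<open>Charts, and below all data of objects and morphisms of the categories, are extensional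
  functions on their domains, so that they are equal as soon as they agree there.\<close>

definition is_chart :: "'a set \<Rightarrow> 'a chart \<Rightarrow> bool" where
  "is_chart S c \<longleftrightarrow> cdom c \<subseteq> S \<and> cmap c \<in> extensional (cdom c) \<and> inj_on (cmap c) (cdom c) \<and>
     euc_open (cdim c) (cmap c ` cdom c)"

definition smooth_transition :: "'a chart \<Rightarrow> 'a chart \<Rightarrow> bool" where
  "smooth_transition c d \<longleftrightarrow>
     euc_open (cdim c) (cmap c ` (cdom c \<inter> cdom d)) \<and>
     euc_smooth (cdim c) (cmap c ` (cdom c \<inter> cdom d)) (cdim d) (cmap d \<circ> cinv c)"

definition max_atlas :: "'a set \<Rightarrow> 'a chart set \<Rightarrow> 'a chart set" where
  "max_atlas S A =
     {c. is_chart S c \<and> (\<forall>d\<in>A. smooth_transition c d \<and> smooth_transition d c)}"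

definition mtop :: "'a manifold \<Rightarrow> 'a topology" where
  "mtop M = topology (\<lambda>W. W \<subseteq> carrier M \<and>
     (\<forall>c\<in>atlas M. euc_open (cdim c) (cmap c ` (W \<inter> cdom c))))"

text \<open>The equation for the atlas says that its charts are pairwise compatible and that it is
  maximal. The dimension of a chart may depend on the connected component.\<close>

definition smooth_manifold :: "'a manifold \<Rightarrow> bool" where
  "smooth_manifold M \<longleftrightarrow>
     \<Union>(cdom ` atlas M) = carrier M \<and> atlas M = max_atlas (carrier M) (atlas M) \<and>
     Hausdorff_space (mtop M) \<and> second_countable (mtop M)"

definition smooth_map :: "'a manifold \<Rightarrow> 'b manifold \<Rightarrow> ('a \<Rightarrow> 'b) \<Rightarrow> bool" where
  "smooth_map M N f \<longleftrightarrow> f \<in> carrier M \<rightarrow> carrier N \<and>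
     (\<forall>p\<in>carrier M. \<exists>c\<in>atlas M. \<exists>d\<in>atlas N. p \<in> cdom c \<and> f ` cdom c \<subseteq> cdom d \<and>
        euc_smooth (cdim c) (cmap c ` cdom c) (cdim d) (cmap d \<circ> f \<circ> cinv c))"

definition diffeomorphism :: "'a manifold \<Rightarrow> 'b manifold \<Rightarrow> ('a \<Rightarrow> 'b) \<Rightarrow> bool" where
  "diffeomorphism M N f \<longleftrightarrow> bij_betw f (carrier M) (carrier N) \<and>
     smooth_map M N f \<and> smooth_map N M (the_inv_into (carrier M) f)"

definition open_submanifold :: "'a manifold \<Rightarrow> 'a set \<Rightarrow> 'a manifold" where
  "open_submanifold M U = \<lparr>carrier = U, atlas = {c \<in> atlas M. cdom c \<subseteq> U}\<rparr>"

definition prod_chart :: "'a chart \<Rightarrow> 'b chart \<Rightarrow> ('a \<times> 'b) chart" where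
  "prod_chart c d = \<lparr>cdim = cdim c + cdim d, cdom = cdom c \<times> cdom d,
     cmap = (\<lambda>(p, q) \<in> cdom c \<times> cdom d. append_vec (cdim c) (cmap c p) (cmap d q))\<rparr>"

definition prod_manifold :: "'a manifold \<Rightarrow> 'b manifold \<Rightarrow> ('a \<times> 'b) manifold" where
  "prod_manifold M N = \<lparr>carrier = carrier M \<times> carrier N,
     atlas = max_atlas (carrier M \<times> carrier N)
       {prod_chart c d |c d. c \<in> atlas M \<and> d \<in> atlas N}\<rparr>"

definition image_chart :: "('a \<Rightarrow> 'b) \<Rightarrow> 'a chart \<Rightarrow> 'b chart" where
  "image_chart j c = \<lparr>cdim = cdim c, cdom = j ` cdom c,
     cmap = (\<lambda>q \<in> j ` cdom c. cmap c (the_inv_into (cdom c) j q))\<rparr>"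

definition image_manifold :: "('a \<Rightarrow> 'b) \<Rightarrow> 'a manifold \<Rightarrow> 'b manifold" where
  "image_manifold j M = \<lparr>carrier = j ` carrier M, atlas = image_chart j ` atlas M\<rparr>"


section \<open>Vector spaces\<close>

text \<open>The fields \<^const>\<open>mult\<close> and \<^const>\<open>one\<close> of the record type of modules play no role in
  \<^locale>\<open>Module.module\<close>.\<close>

definition mk_module ::
    "'v set \<Rightarrow> 'v \<Rightarrow> ('v \<Rightarrow> 'v \<Rightarrow> 'v) \<Rightarrow> ('k \<Rightarrow> 'v \<Rightarrow> 'v) \<Rightarrow> ('k, 'v) module" where
  "mk_module V z a s = \<lparr>carrier = V, mult = undefined, one = undefined, zero = z, add = a, smult = s\<rparr>"

definition complex_field :: "complex ring" where
  "complex_field = \<lparr>carrier = UNIV, mult = (*), one = 1, zero = 0, add = (+)\<rparr>"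

text \<open>Linear maps over a field of scalars which is a full type (real or complex).\<close>

definition linear_maps :: "('k, 'v) module \<Rightarrow> ('k, 'w) module \<Rightarrow> ('v \<Rightarrow> 'w) set" where
  "linear_maps V W = {f \<in> carrier V \<rightarrow> carrier W.
     (\<forall>u\<in>carrier V. \<forall>v\<in>carrier V. f (u \<oplus>\<^bsub>V\<^esub> v) = f u \<oplus>\<^bsub>W\<^esub> f v) \<and>
     (\<forall>a. \<forall>u\<in>carrier V. f (a \<odot>\<^bsub>V\<^esub> u) = a \<odot>\<^bsub>W\<^esub> f u)}"

definition Cn :: "nat \<Rightarrow> (complex, nat \<Rightarrow> complex) module" where
  "Cn r = mk_module {v. \<forall>i\<ge>r. v i = 0} (\<lambda>_. 0) (\<lambda>u v i. u i + v i) (\<lambda>a v i. a * v i)"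

definition realify :: "nat \<Rightarrow> (nat \<Rightarrow> complex) \<Rightarrow> nat \<Rightarrow> real" where
  "realify r v = append_vec r (\<lambda>i. Re (v i)) (\<lambda>i. Im (v i))"

text \<open>A finite-dimensional complex vector space as a smooth manifold.\<close>

definition vs_manifold :: "(complex, 'v) module \<Rightarrow> 'v manifold" where
  "vs_manifold V = \<lparr>carrier = carrier V, atlas = max_atlas (carrier V)
     {\<lparr>cdim = 2 * r, cdom = carrier V, cmap = (\<lambda>v\<in>carrier V. realify r (f v))\<rparr> |r f.
        f \<in> linear_maps V (Cn r) \<and> bij_betw f (carrier V) (carrier (Cn r))}\<rparr>"

text \<open>\<open>V \<otimes> \<complex>\<close>, where the pair \<open>(u, v)\<close> stands for \<open>u \<otimes> 1 + v \<otimes> i\<close>.\<close>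

definition complexification :: "(real, 'v) module \<Rightarrow> (complex, 'v \<times> 'v) module" where
  "complexification V = mk_module (carrier V \<times> carrier V) (\<zero>\<^bsub>V\<^esub>, \<zero>\<^bsub>V\<^esub>)
     (\<lambda>(u, v) (u', v'). (u \<oplus>\<^bsub>V\<^esub> u', v \<oplus>\<^bsub>V\<^esub> v'))
     (\<lambda>a (u, v). ((Re a \<odot>\<^bsub>V\<^esub> u) \<oplus>\<^bsub>V\<^esub> ((- Im a) \<odot>\<^bsub>V\<^esub> v),
                   (Im a \<odot>\<^bsub>V\<^esub> u) \<oplus>\<^bsub>V\<^esub> (Re a \<odot>\<^bsub>V\<^esub> v)))"


section \<open>Tangent vectors\<close>

text \<open>A tangent vector at \<open>p\<close> is given by its coordinate vectors in all charts around \<open>p\<close>, which are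
  related by the Jacobians of the transition maps.\<close>

type_synonym 'a tvec = "'a chart \<Rightarrow> nat \<Rightarrow> real"

definition charts_at :: "'a manifold \<Rightarrow> 'a \<Rightarrow> 'a chart set" where
  "charts_at M p = {c \<in> atlas M. p \<in> cdom c}"

definition tangent_space :: "'a manifold \<Rightarrow> 'a \<Rightarrow> (real, 'a tvec) module" where
  "tangent_space M p = mk_module
     {v \<in> extensional (charts_at M p). (\<forall>c\<in>charts_at M p. v c \<in> euc (cdim c)) \<and>
        (\<forall>c\<in>charts_at M p. \<forall>d\<in>charts_at M p.
           v d = jacobian (cdim c) (cdim d) (cmap d \<circ> cinv c) (cmap c p) (v c))}
     (\<lambda>c\<in>charts_at M p. (\<lambda>_. 0))
     (\<lambda>u v. \<lambda>c\<in>charts_at M p. (\<lambda>i. u c i + v c i))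
     (\<lambda>a v. \<lambda>c\<in>charts_at M p. (\<lambda>i. a * v c i))"

text \<open>By the chain rule the result does not depend on the chart \<open>c\<close> that is chosen around \<open>p\<close>.\<close>

definition tangent_map ::
    "'a manifold \<Rightarrow> 'b manifold \<Rightarrow> ('a \<Rightarrow> 'b) \<Rightarrow> 'a \<Rightarrow> 'a tvec \<Rightarrow> 'b tvec" where
  "tangent_map M N f p v = (let c = (SOME c. c \<in> charts_at M p) in
     (\<lambda>d\<in>charts_at N (f p).
        jacobian (cdim c) (cdim d) (cmap d \<circ> f \<circ> cinv c) (cmap c p) (v c)))"

type_synonym 'a ctvec = "'a tvec \<times> 'a tvec"

definition ctangent_space :: "'a manifold \<Rightarrow> 'a \<Rightarrow> (complex, 'a ctvec) module" where
  "ctangent_space M p = complexification (tangent_space M p)"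

definition ctangent_map ::
    "'a manifold \<Rightarrow> 'b manifold \<Rightarrow> ('a \<Rightarrow> 'b) \<Rightarrow> 'a \<Rightarrow> 'a ctvec \<Rightarrow> 'b ctvec" where
  "ctangent_map M N f p = map_prod (tangent_map M N f p) (tangent_map M N f p)"

definition ctangent_chart :: "'a manifold \<Rightarrow> 'a chart \<Rightarrow> ('a \<times> 'a ctvec) chart" where
  "ctangent_chart M c = (let D = (SIGMA p:cdom c. carrier (ctangent_space M p)) in
     \<lparr>cdim = 3 * cdim c, cdom = D,
      cmap = (\<lambda>(p, u, v) \<in> D. append_vec (cdim c) (cmap c p) (append_vec (cdim c) (u c) (v c)))\<rparr>)"


section \<open>Complex vector bundles\<close>

record ('x, 'e) cvbundle =
  tot :: "'e manifold"
  bproj :: "'e \<Rightarrow> 'x"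
  bzero :: "'x \<Rightarrow> 'e"
  badd :: "'e \<Rightarrow> 'e \<Rightarrow> 'e"
  bsmult :: "complex \<Rightarrow> 'e \<Rightarrow> 'e"

abbreviation pts :: "('x, 'e) cvbundle \<Rightarrow> 'e set" where
  "pts E \<equiv> carrier (tot E)"

definition fibre :: "('x, 'e) cvbundle \<Rightarrow> 'x \<Rightarrow> (complex, 'e) module" where
  "fibre E x = mk_module {e \<in> pts E. bproj E e = x} (bzero E x) (badd E) (bsmult E)"

definition local_trivialization ::
    "'x manifold \<Rightarrow> ('x, 'e) cvbundle \<Rightarrow> 'x set \<Rightarrow> nat \<Rightarrow> ('e \<Rightarrow> nat \<Rightarrow> complex) \<Rightarrow> bool" where
  "local_trivialization X E U r \<tau> \<longleftrightarrow>
     openin (mtop X) U \<and>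
     diffeomorphism (open_submanifold (tot E) {e \<in> pts E. bproj E e \<in> U})
       (prod_manifold (open_submanifold X U) (vs_manifold (Cn r))) (\<lambda>e. (bproj E e, \<tau> e)) \<and>
     (\<forall>x\<in>U. \<tau> \<in> linear_maps (fibre E x) (Cn r))"

text \<open>The rank is finite but may depend on the connected component of the base.\<close>

definition complex_vector_bundle :: "'x manifold \<Rightarrow> ('x, 'e) cvbundle \<Rightarrow> bool" where
  "complex_vector_bundle X E \<longleftrightarrow>
     smooth_manifold (tot E) \<and> smooth_map (tot E) X (bproj E) \<and>
     (\<forall>x\<in>carrier X. Module.module complex_field (fibre E x)) \<and>
     (\<forall>x\<in>carrier X. \<exists>U r \<tau>. x \<in> U \<and> local_trivialization X E U r \<tau>) \<and>
     bproj E \<in> extensional (pts E) \<and> bzero E \<in> extensional (carrier X) \<and>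
     (\<forall>e f. \<not> (e \<in> pts E \<and> f \<in> pts E \<and> bproj E e = bproj E f) \<longrightarrow> badd E e f = undefined) \<and>
     (\<forall>a. bsmult E a \<in> extensional (pts E))"

text \<open>Morphisms \<open>E \<rightarrow> F\<close> of complex vector bundles covering a map \<open>b\<close> from the base \<open>B\<close> of \<open>E\<close>
  to the base of \<open>F\<close>.\<close>

definition bundle_morphism ::
    "'b manifold \<Rightarrow> ('b, 'v) cvbundle \<Rightarrow> ('c, 'w) cvbundle \<Rightarrow> ('b \<Rightarrow> 'c) \<Rightarrow> ('v \<Rightarrow> 'w) \<Rightarrow> bool" where
  "bundle_morphism B E F b \<psi> \<longleftrightarrow> smooth_map (tot E) (tot F) \<psi> \<and>
     (\<forall>e\<in>pts E. bproj F (\<psi> e) = b (bproj E e)) \<and>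
     (\<forall>x\<in>carrier B. \<psi> \<in> linear_maps (fibre E x) (fibre F (b x)))"

definition vect_hom :: "'x manifold \<Rightarrow> ('x, 'e) cvbundle \<Rightarrow> ('x, 'e) cvbundle \<Rightarrow> ('e \<Rightarrow> 'e) set" where
  "vect_hom X E F = {\<psi> \<in> extensional (pts E). bundle_morphism X E F id \<psi>}"

definition sections :: "'x manifold \<Rightarrow> ('x, 'e) cvbundle \<Rightarrow> (complex, 'x \<Rightarrow> 'e) module" where
  "sections X E = mk_module
     {s \<in> extensional (carrier X). smooth_map X (tot E) s \<and> (\<forall>x\<in>carrier X. bproj E (s x) = x)}
     (\<lambda>x\<in>carrier X. bzero E x)
     (\<lambda>s s'. \<lambda>x\<in>carrier X. badd E (s x) (s' x))
     (\<lambda>a s. \<lambda>x\<in>carrier X. bsmult E a (s x))"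

definition sections_map :: "'x manifold \<Rightarrow> ('e \<Rightarrow> 'f) \<Rightarrow> ('x \<Rightarrow> 'e) \<Rightarrow> 'x \<Rightarrow> 'f" where
  "sections_map X \<psi> s = compose (carrier X) \<psi> s"

text \<open>The bundle over \<open>B \<times> C\<close> with fibre \<open>E\<^sub>b \<oplus> F\<^sub>c\<close> over \<open>(b, c)\<close>.\<close>

definition ext_sum :: "('b, 'v) cvbundle \<Rightarrow> ('c, 'w) cvbundle \<Rightarrow> ('b \<times> 'c, 'v \<times> 'w) cvbundle" where
  "ext_sum E F = \<lparr>tot = prod_manifold (tot E) (tot F), bproj = map_prod (bproj E) (bproj F),
     bzero = map_prod (bzero E) (bzero F),
     badd = (\<lambda>(e, f) (e', f'). (badd E e e', badd F f f')),
     bsmult = (\<lambda>a. map_prod (bsmult E a) (bsmult F a))\<rparr>"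

definition trivial_bundle ::
    "'x manifold \<Rightarrow> (complex, 'v) module \<Rightarrow> ('x, 'x \<times> 'v) cvbundle" where
  "trivial_bundle X V = \<lparr>tot = prod_manifold X (vs_manifold V), bproj = fst,
     bzero = (\<lambda>x. (x, \<zero>\<^bsub>V\<^esub>)),
     badd = (\<lambda>(x, u) (_, v). (x, u \<oplus>\<^bsub>V\<^esub> v)),
     bsmult = (\<lambda>a (x, u). (x, a \<odot>\<^bsub>V\<^esub> u))\<rparr>"

text \<open>The bundle structure transported along an injection \<open>j\<close> of the total space.\<close>

definition image_bundle ::
    "'x manifold \<Rightarrow> ('e \<Rightarrow> 'f) \<Rightarrow> ('x, 'e) cvbundle \<Rightarrow> ('x, 'f) cvbundle" where
  "image_bundle X j E = (let k = the_inv_into (pts E) j in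
     \<lparr>tot = image_manifold j (tot E),
      bproj = (\<lambda>q\<in>j ` pts E. bproj E (k q)),
      bzero = (\<lambda>x\<in>carrier X. j (bzero E x)),
      badd = (\<lambda>q q'. if q \<in> j ` pts E \<and> q' \<in> j ` pts E \<and> bproj E (k q) = bproj E (k q')
                then j (badd E (k q) (k q')) else undefined),
      bsmult = (\<lambda>a. \<lambda>q\<in>j ` pts E. j (bsmult E a (k q)))\<rparr>)"


section \<open>Lie groups and their complexified tangent groups\<close>

record 'g lie_group = "'g monoid" +
  lie_atlas :: "'g chart set"

definition lie_manifold :: "'g lie_group \<Rightarrow> 'g manifold" where
  "lie_manifold G = \<lparr>carrier = carrier G, atlas = lie_atlas G\<rparr>"

definition is_lie_group :: "'g lie_group \<Rightarrow> bool" where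
  "is_lie_group G \<longleftrightarrow> group G \<and> smooth_manifold (lie_manifold G) \<and>
     smooth_map (prod_manifold (lie_manifold G) (lie_manifold G)) (lie_manifold G)
       (\<lambda>(g, h). g \<otimes>\<^bsub>G\<^esub> h) \<and>
     smooth_map (lie_manifold G) (lie_manifold G) (\<lambda>g. inv\<^bsub>G\<^esub> g)"

definition smooth_action :: "'g lie_group \<Rightarrow> 'x manifold \<Rightarrow> ('g \<Rightarrow> 'x \<Rightarrow> 'x) \<Rightarrow> bool" where
  "smooth_action G X t \<longleftrightarrow> group_action G (carrier X) t \<and>
     smooth_map (prod_manifold (lie_manifold G) X) X (\<lambda>(g, x). t g x)"

text \<open>The multiplication of \<open>T\<^sub>\<complex>G\<close> is \<open>v\<^sub>g \<bullet> w\<^sub>h = (L\<^sub>g)\<^sub>* w\<^sub>h + (R\<^sub>h)\<^sub>* v\<^sub>g\<close>.\<close>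

definition ctangent_group :: "'g lie_group \<Rightarrow> ('g \<times> 'g ctvec) lie_group" where
  "ctangent_group G = (let M = lie_manifold G;
       T = (SIGMA g:carrier G. carrier (ctangent_space M g)) in
     \<lparr>carrier = T,
      mult = (\<lambda>(g, v) (h, w). (g \<otimes>\<^bsub>G\<^esub> h,
        ctangent_map M M (\<lambda>k. g \<otimes>\<^bsub>G\<^esub> k) h w \<oplus>\<^bsub>ctangent_space M (g \<otimes>\<^bsub>G\<^esub> h)\<^esub>
        ctangent_map M M (\<lambda>k. k \<otimes>\<^bsub>G\<^esub> h) g v)),
      one = (\<one>\<^bsub>G\<^esub>, \<zero>\<^bsub>ctangent_space M \<one>\<^bsub>G\<^esub>\<^esub>),
      lie_atlas = max_atlas T (ctangent_chart M ` atlas M)\<rparr>)"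

definition ctangent_bundle :: "'g lie_group \<Rightarrow> ('g, 'g \<times> 'g ctvec) cvbundle" where
  "ctangent_bundle G = (let M = lie_manifold G in
     \<lparr>tot = lie_manifold (ctangent_group G), bproj = fst,
      bzero = (\<lambda>g. (g, \<zero>\<^bsub>ctangent_space M g\<^esub>)),
      badd = (\<lambda>(g, v) (_, w). (g, v \<oplus>\<^bsub>ctangent_space M g\<^esub> w)),
      bsmult = (\<lambda>a (g, v). (g, a \<odot>\<^bsub>ctangent_space M g\<^esub> v))\<rparr>)"

definition lie_algebra_C :: "'g lie_group \<Rightarrow> (complex, 'g ctvec) module" where
  "lie_algebra_C G = ctangent_space (lie_manifold G) \<one>\<^bsub>G\<^esub>"

definition Ad_C :: "'g lie_group \<Rightarrow> 'g \<Rightarrow> 'g ctvec \<Rightarrow> 'g ctvec" where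
  "Ad_C G g = ctangent_map (lie_manifold G) (lie_manifold G)
     (\<lambda>h. g \<otimes>\<^bsub>G\<^esub> h \<otimes>\<^bsub>G\<^esub> inv\<^bsub>G\<^esub> g) \<one>\<^bsub>G\<^esub>"


section \<open>Categories\<close>

text \<open>Hom-sets need not be disjoint, so composition takes the three objects as arguments.\<close>

record ('o, 'm) category =
  Obj :: "'o set"
  Hom :: "'o \<Rightarrow> 'o \<Rightarrow> 'm set"
  Comp :: "'o \<Rightarrow> 'o \<Rightarrow> 'o \<Rightarrow> 'm \<Rightarrow> 'm \<Rightarrow> 'm"
  Idn :: "'o \<Rightarrow> 'm"

definition is_category :: "('o, 'm) category \<Rightarrow> bool" where
  "is_category C \<longleftrightarrow>
     (\<forall>a\<in>Obj C. Idn C a \<in> Hom C a a) \<and>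
     (\<forall>a\<in>Obj C. \<forall>b\<in>Obj C. \<forall>c\<in>Obj C. \<forall>f\<in>Hom C a b. \<forall>g\<in>Hom C b c. Comp C a b c g f \<in> Hom C a c) \<and>
     (\<forall>a\<in>Obj C. \<forall>b\<in>Obj C. \<forall>f\<in>Hom C a b.
        Comp C a a b f (Idn C a) = f \<and> Comp C a b b (Idn C b) f = f) \<and>
     (\<forall>a\<in>Obj C. \<forall>b\<in>Obj C. \<forall>c\<in>Obj C. \<forall>d\<in>Obj C. \<forall>f\<in>Hom C a b. \<forall>g\<in>Hom C b c. \<forall>h\<in>Hom C c d.
        Comp C a c d h (Comp C a b c g f) = Comp C a b d (Comp C b c d h g) f)"

definition is_functor :: "('o, 'm) category \<Rightarrow> ('p, 'n) category \<Rightarrow>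
    ('o \<Rightarrow> 'p) \<Rightarrow> ('o \<Rightarrow> 'o \<Rightarrow> 'm \<Rightarrow> 'n) \<Rightarrow> bool" where
  "is_functor C D F0 F1 \<longleftrightarrow>
     (\<forall>a\<in>Obj C. F0 a \<in> Obj D) \<and>
     (\<forall>a\<in>Obj C. \<forall>b\<in>Obj C. \<forall>f\<in>Hom C a b. F1 a b f \<in> Hom D (F0 a) (F0 b)) \<and>
     (\<forall>a\<in>Obj C. F1 a a (Idn C a) = Idn D (F0 a)) \<and>
     (\<forall>a\<in>Obj C. \<forall>b\<in>Obj C. \<forall>c\<in>Obj C. \<forall>f\<in>Hom C a b. \<forall>g\<in>Hom C b c.
        F1 a c (Comp C a b c g f) = Comp D (F0 a) (F0 b) (F0 c) (F1 b c g) (F1 a b f))"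

definition isomorphic_categories :: "('o, 'm) category \<Rightarrow> ('p, 'n) category \<Rightarrow> bool" where
  "isomorphic_categories C D \<longleftrightarrow> is_category C \<and> is_category D \<and>
     (\<exists>F0 F1 G0 G1. is_functor C D F0 F1 \<and> is_functor D C G0 G1 \<and>
        (\<forall>a\<in>Obj C. G0 (F0 a) = a) \<and>
        (\<forall>a\<in>Obj C. \<forall>b\<in>Obj C. \<forall>f\<in>Hom C a b. G1 (F0 a) (F0 b) (F1 a b f) = f) \<and>
        (\<forall>a\<in>Obj D. F0 (G0 a) = a) \<and>
        (\<forall>a\<in>Obj D. \<forall>b\<in>Obj D. \<forall>f\<in>Hom D a b. F1 (G0 a) (G0 b) (G1 a b f) = f))"

definition slice_category :: "'o \<Rightarrow> ('o, 'm) category \<Rightarrow> ('o \<times> 'm, 'm) category" where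
  "slice_category m C =
     \<lparr>Obj = {(a, f). a \<in> Obj C \<and> f \<in> Hom C m a},
      Hom = (\<lambda>(a, f) (a', f'). {\<theta> \<in> Hom C a a'. Comp C m a a' \<theta> f = f'}),
      Comp = (\<lambda>a b c. Comp C (fst a) (fst b) (fst c)),
      Idn = (\<lambda>a. Idn C (fst a))\<rparr>"


section \<open>The three categories\<close>

definition equivariant_bundle :: "'g lie_group \<Rightarrow> 'x manifold \<Rightarrow> ('g \<Rightarrow> 'x \<Rightarrow> 'x) \<Rightarrow>
    ('x, 'e) cvbundle \<Rightarrow> ('g \<Rightarrow> 'e \<Rightarrow> 'e) \<Rightarrow> bool" where
  "equivariant_bundle G X t E \<sigma> \<longleftrightarrow>
     complex_vector_bundle X E \<and> smooth_action G (tot E) \<sigma> \<and> \<sigma> \<in> extensional (carrier G) \<and>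
     (\<forall>g\<in>carrier G. \<forall>e\<in>pts E. bproj E (\<sigma> g e) = t g (bproj E e)) \<and>
     (\<forall>g\<in>carrier G. \<forall>x\<in>carrier X. \<sigma> g \<in> linear_maps (fibre E x) (fibre E (t g x)))"

definition Vect :: "'g lie_group \<Rightarrow> 'x manifold \<Rightarrow> ('g \<Rightarrow> 'x \<Rightarrow> 'x) \<Rightarrow>
    (('x, 'e) cvbundle \<times> ('g \<Rightarrow> 'e \<Rightarrow> 'e), 'e \<Rightarrow> 'e) category" where
  "Vect G X t =
     \<lparr>Obj = {(E, \<sigma>). equivariant_bundle G X t E \<sigma>},
      Hom = (\<lambda>(E, \<sigma>) (E', \<sigma>').
        {\<psi> \<in> vect_hom X E E'. \<forall>g\<in>carrier G. \<forall>e\<in>pts E. \<psi> (\<sigma> g e) = \<sigma>' g (\<psi> e)}),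
      Comp = (\<lambda>(E, _) _ _ \<theta> \<psi>. compose (pts E) \<theta> \<psi>),
      Idn = (\<lambda>(E, _). \<lambda>e\<in>pts E. e)\<rparr>"

definition complex_affine_action :: "'g lie_group \<Rightarrow> 'x manifold \<Rightarrow> ('g \<Rightarrow> 'x \<Rightarrow> 'x) \<Rightarrow>
    ('x, 'e) cvbundle \<Rightarrow> ('g \<times> 'g ctvec \<Rightarrow> 'e \<Rightarrow> 'e) \<Rightarrow> bool" where
  "complex_affine_action G X t E \<phi> \<longleftrightarrow>
     complex_vector_bundle X E \<and> smooth_action (ctangent_group G) (tot E) \<phi> \<and>
     \<phi> \<in> extensional (carrier (ctangent_group G)) \<and>
     bundle_morphism (prod_manifold (lie_manifold G) X) (ext_sum (ctangent_bundle G) E) E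
       (\<lambda>(g, x). t g x) (\<lambda>(v, e). \<phi> v e)"

definition Vect_aff :: "'g lie_group \<Rightarrow> 'x manifold \<Rightarrow> ('g \<Rightarrow> 'x \<Rightarrow> 'x) \<Rightarrow>
    (('x, 'e) cvbundle \<times> ('g \<times> 'g ctvec \<Rightarrow> 'e \<Rightarrow> 'e), 'e \<Rightarrow> 'e) category" where
  "Vect_aff G X t =
     \<lparr>Obj = {(E, \<phi>). complex_affine_action G X t E \<phi>},
      Hom = (\<lambda>(E, \<phi>) (E', \<phi>').
        {\<psi> \<in> vect_hom X E E'.
           \<forall>v\<in>carrier (ctangent_group G). \<forall>e\<in>pts E. \<psi> (\<phi> v e) = \<phi>' v (\<psi> e)}),
      Comp = (\<lambda>(E, _) _ _ \<theta> \<psi>. compose (pts E) \<theta> \<psi>),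
      Idn = (\<lambda>(E, _). \<lambda>e\<in>pts E. e)\<rparr>"

text \<open>\<open>(g \<cdot> \<xi>)\<^sub>x = g \<cdot> \<xi> (g\<inverse> \<cdot> x)\<close>\<close>

definition section_action :: "'g lie_group \<Rightarrow> 'x manifold \<Rightarrow> ('g \<Rightarrow> 'x \<Rightarrow> 'x) \<Rightarrow>
    ('g \<Rightarrow> 'e \<Rightarrow> 'e) \<Rightarrow> 'g \<Rightarrow> ('x \<Rightarrow> 'e) \<Rightarrow> 'x \<Rightarrow> 'e" where
  "section_action G X t \<sigma> g \<xi> = (\<lambda>x\<in>carrier X. \<sigma> g (\<xi> (t (inv\<^bsub>G\<^esub> g) x)))"

definition equivariant_linear_map :: "'g lie_group \<Rightarrow> 'x manifold \<Rightarrow> ('g \<Rightarrow> 'x \<Rightarrow> 'x) \<Rightarrow>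
    ('x, 'e) cvbundle \<Rightarrow> ('g \<Rightarrow> 'e \<Rightarrow> 'e) \<Rightarrow> ('g ctvec \<Rightarrow> 'x \<Rightarrow> 'e) \<Rightarrow> bool" where
  "equivariant_linear_map G X t E \<sigma> \<rho> \<longleftrightarrow>
     \<rho> \<in> linear_maps (lie_algebra_C G) (sections X E) \<and>
     \<rho> \<in> extensional (carrier (lie_algebra_C G)) \<and>
     (\<forall>g\<in>carrier G. \<forall>\<alpha>\<in>carrier (lie_algebra_C G).
        \<rho> (Ad_C G g \<alpha>) = section_action G X t \<sigma> g (\<rho> \<alpha>))"

definition Pairs :: "'g lie_group \<Rightarrow> 'x manifold \<Rightarrow> ('g \<Rightarrow> 'x \<Rightarrow> 'x) \<Rightarrow>
    ((('x, 'e) cvbundle \<times> ('g \<Rightarrow> 'e \<Rightarrow> 'e)) \<times> ('g ctvec \<Rightarrow> 'x \<Rightarrow> 'e), 'e \<Rightarrow> 'e) category" where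
  "Pairs G X t =
     \<lparr>Obj = {((E, \<sigma>), \<rho>). (E, \<sigma>) \<in> Obj (Vect G X t) \<and> equivariant_linear_map G X t E \<sigma> \<rho>},
      Hom = (\<lambda>(A, \<rho>) (A', \<rho>').
        {\<psi> \<in> Hom (Vect G X t) A A'.
           compose (carrier (lie_algebra_C G)) (sections_map X \<psi>) \<rho> = \<rho>'}),
      Comp = (\<lambda>A B C. Comp (Vect G X t) (fst A) (fst B) (fst C)),
      Idn = (\<lambda>A. Idn (Vect G X t) (fst A))\<rparr>"

text \<open>The equivariant bundle \<open>(\<gg>\<^sub>\<complex>)\<^sub>X\<close>, with \<open>X \<times> \<gg>\<^sub>\<complex>\<close> embedded by \<open>j\<close> into the type \<^typ>\<open>'e\<close>
  of which the total spaces of all bundles of the category are subsets.\<close>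

definition gC_bundle :: "'g lie_group \<Rightarrow> 'x manifold \<Rightarrow> ('g \<Rightarrow> 'x \<Rightarrow> 'x) \<Rightarrow>
    ('x \<times> 'g ctvec \<Rightarrow> 'e) \<Rightarrow> ('x, 'e) cvbundle \<times> ('g \<Rightarrow> 'e \<Rightarrow> 'e)" where
  "gC_bundle G X t j = (let E = trivial_bundle X (lie_algebra_C G) in
     (image_bundle X j E,
      \<lambda>g\<in>carrier G. \<lambda>q\<in>j ` pts E.
        j (map_prod (t g) (Ad_C G g) (the_inv_into (pts E) j q))))"

end

theory Submission
  imports Defs
begin

text \<open>The tangent vector \<open>v\<^sub>g\<close> factors as \<open>v\<^sub>g = \<alpha> \<bullet> 0\<^sub>g\<close> with \<open>\<alpha> = (R\<^sub>g\<inverse>)\<^sub>* v\<^sub>g \<in> \<gg>\<^sub>\<complex>\<close>, and an affine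
  action is additive in the pair \<open>(v\<^sub>g, e)\<close>, so \<open>v\<^sub>g \<cdot> e = 0\<^sub>g \<cdot> e + \<alpha> \<cdot> 0\<close>. Hence it is determined by the
  linear \<open>G\<close>-action \<open>e \<mapsto> 0\<^sub>g \<cdot> e\<close> and by the map sending \<open>\<alpha>\<close> to the section \<open>x \<mapsto> \<alpha> \<cdot> 0\<^sub>x\<close>, which is
  equivariant because \<open>Ad\<^sub>g \<alpha> = 0\<^sub>g \<bullet> \<alpha> \<bullet> 0\<^bsub>g\<inverse>\<^esub>\<close>. Conversely \<open>v\<^sub>g \<cdot> e = g \<cdot> e + \<rho> \<alpha> (g \<cdot> \<pi> e)\<close> defines an action by
  the cocycle identity \<open>(R\<^bsub>(gh)\<inverse>\<^esub>)\<^sub>* (v\<^sub>g \<bullet> w\<^sub>h) = (R\<^bsub>g\<inverse>\<^esub>)\<^sub>* v\<^sub>g + Ad\<^sub>g ((R\<^bsub>h\<inverse>\<^esub>)\<^sub>* w\<^sub>h)\<close>. A linear map \<open>\<rho>\<close> into sections is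
  the same as a bundle map out of the trivial bundle. All three categories have the same morphisms,
  namely certain bundle maps, so the functors are the identity on them.\<close>

section \<open>Differential calculus in \<open>\<real>\<^sup>n\<close>\<close>

text \<open>The algebra is short; most of the work is smoothness. Two facts carry it. The form
  sending v_g to its right translate in g_C must be smooth in g, although the map it differentiates
  itself depends on g. And \<rho> \<alpha> (x) must be jointly smooth in \<alpha> and x, although
  \<rho> is only a linear map into sections; here finite dimension of g_C makes \<rho> a finite
  combination of fixed sections. Smoothness is defined by iterated partial derivatives, a definition
  that does not contain the chain rule, so the chain rule is derived from the mean value theorem,
  and the theory of manifolds rests on composition and Jacobians. Isomorphism of categories, as
  opposed to equivalence, asks the passages between objects to be inverse up to equality; hence the
  many arguments by extensionality. Since \<open>linear_maps\<close> speaks of sums and scalar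
  multiples only, preservation of zero vectors is always derived by scaling with 0.\<close>

lemma tendsto_fun_componentwise:
  fixes g :: "'s \<Rightarrow> nat \<Rightarrow> real"
  assumes "\<And>i. ((\<lambda>s. g s i) \<longlongrightarrow> l i) F"
  shows "(g \<longlongrightarrow> l) F"
proof -
  have "limitin (product_topology (\<lambda>i::nat. euclidean) UNIV) g l F"
    using assms by (simp add: limitin_componentwise)
  then show ?thesis
    by (simp add: euclidean_product_topology)
qed

lemma continuous_on_upd: "continuous_on S (\<lambda>s::real. (x::nat \<Rightarrow> real)(i := s))"
proof (rule continuous_on_coordinatewise_then_product)
  show "continuous_on S (\<lambda>s. (x(i := s)) k)" for k
    by (cases "k = i") (auto intro: continuous_intros)
qed

lemma euc_upd: "x \<in> euc n \<Longrightarrow> i < n \<Longrightarrow> x(i := s) \<in> euc n"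
  by (auto simp: euc_def)

lemma euc_open_subset: "euc_open n U \<Longrightarrow> U \<subseteq> euc n"
  unfolding euc_open_def by (metis openin_subset topspace_euclidean_subtopology)

lemma euc_open_euc: "euc_open n (euc n)"
  unfolding euc_open_def by simp

lemma euc_open_Int: "euc_open n U \<Longrightarrow> euc_open n V \<Longrightarrow> euc_open n (U \<inter> V)"
  unfolding euc_open_def by blast

lemma euc_open_Union: "(\<And>U. U \<in> \<U> \<Longrightarrow> euc_open n U) \<Longrightarrow> euc_open n (\<Union>\<U>)"
  unfolding euc_open_def by blast

lemma euc_open_local:
  assumes "\<And>x. x \<in> U \<Longrightarrow> \<exists>V. euc_open n V \<and> x \<in> V \<and> V \<subseteq> U"
  shows "euc_open n U"
  using assms unfolding euc_open_def by (subst openin_subopen) blast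

lemma euc_open_vimage:
  assumes "euc_open n U" "continuous_on U F" "F ` U \<subseteq> euc m" "euc_open m V"
  shows "euc_open n {x \<in> U. F x \<in> V}"
proof -
  obtain S where S: "open S" "V = euc m \<inter> S"
    using assms(4) unfolding euc_open_def openin_open by auto
  have "openin (top_of_set U) (U \<inter> F -` S)"
    using assms(2) S(1) by (rule continuous_openin_preimage_gen)
  moreover have "U \<inter> F -` S = {x \<in> U. F x \<in> V}" using S assms(3) by auto
  ultimately show ?thesis
    using assms(1) unfolding euc_open_def by (metis openin_trans)
qed

text \<open>Partial derivatives see only coordinate lines, so this is the form in which openness of
  \<open>U\<close> enters the calculus. The bound \<open>i < n\<close> keeps the line inside
  \<open>euc n\<close>.\<close>

lemma euc_open_upd:
  assumes "euc_open n U" "x \<in> U" "i < n"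
  shows "\<forall>\<^sub>F s in nhds (x i). x(i := s) \<in> U"
proof -
  obtain S where S: "open S" "U = euc n \<inter> S"
    using assms(1) unfolding euc_open_def openin_open by auto
  have "open ((\<lambda>s. x(i := s)) -` S)"
    using S(1) continuous_on_upd[of UNIV x i] by (simp add: continuous_on_open_vimage)
  moreover have "x i \<in> (\<lambda>s. x(i := s)) -` S" using assms S by simp
  ultimately have "\<forall>\<^sub>F s in nhds (x i). s \<in> (\<lambda>s. x(i := s)) -` S"
    by (rule eventually_nhds_in_open)
  then show ?thesis
    by eventually_elim (use assms S euc_upd in auto)
qed

lemma partial_deriv_cong:
  assumes "euc_open n U" "x \<in> U" "i < n" "\<And>y. y \<in> U \<Longrightarrow> f y = g y"
  shows "partial_deriv i f x = partial_deriv i g x"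
  unfolding partial_deriv_def
  by (rule deriv_cong_ev) (use euc_open_upd[OF assms(1-3)] assms(4) in \<open>auto elim: eventually_mono\<close>)

section \<open>Functions of class C^k: locality, sums and products\<close>

lemma C_diff_0: "C_diff k n U f \<Longrightarrow> continuous_on U f"
  by (cases k) auto

lemma C_diff_DERIV:
  assumes "C_diff (Suc k) n U f" "x \<in> U" "i < n"
  shows "((\<lambda>s. f (x(i := s))) has_real_derivative partial_deriv i f x) (at (x i))"
  using assms unfolding partial_deriv_def by (simp add: DERIV_deriv_iff_real_differentiable)

lemma C_diff_cong:
  assumes "euc_open n U" "\<And>x. x \<in> U \<Longrightarrow> f x = g x" "C_diff k n U f"
  shows "C_diff k n U g"
  using assms(2,3)
proof (induction k arbitrary: f g)
  case 0
  then show ?case using continuous_on_cong by (metis C_diff.simps(1))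
next
  case (Suc k)
  have "continuous_on U g" using Suc.prems continuous_on_cong by (metis C_diff.simps(2))
  moreover have "(\<lambda>s. g (x(i := s))) differentiable (at (x i))" if "i < n" "x \<in> U" for i x
  proof -
    have "((\<lambda>s. f (x(i := s))) has_real_derivative partial_deriv i f x) (at (x i))"
      using C_diff_DERIV Suc.prems(2) that by blast
    moreover have "\<forall>\<^sub>F s in nhds (x i). f (x(i := s)) = g (x(i := s))"
      using euc_open_upd[OF assms(1) that(2,1)] by eventually_elim (rule Suc.prems(1))
    ultimately have "((\<lambda>s. g (x(i := s))) has_real_derivative partial_deriv i f x) (at (x i))"
      using DERIV_cong_ev[of "x i" "x i" "\<lambda>s. f (x(i := s))" "\<lambda>s. g (x(i := s))", OF refl _ refl] by simp
    then show ?thesis using real_differentiable_def by blast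
  qed
  moreover have "C_diff k n U (partial_deriv i g)" if "i < n" for i
  proof (rule Suc.IH)
    show "partial_deriv i f x = partial_deriv i g x" if "x \<in> U" for x
      by (rule partial_deriv_cong[OF assms(1) that \<open>i < n\<close> Suc.prems(1)])
    show "C_diff k n U (partial_deriv i f)" using Suc.prems(2) that by simp
  qed
  ultimately show ?case by simp
qed

text \<open>Uniqueness of derivatives identifies any candidate \<open>D\<close> with
  \<open>partial_deriv\<close>, so closure proofs can exhibit a derivative instead of computing
  \<open>deriv\<close>.\<close>

lemma C_diff_SucI:
  assumes "euc_open n U" "continuous_on U f"
    and D: "\<And>i x. i < n \<Longrightarrow> x \<in> U \<Longrightarrow> ((\<lambda>s. f (x(i := s))) has_real_derivative D i x) (at (x i))"
    and "\<And>i. i < n \<Longrightarrow> C_diff k n U (D i)"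
  shows "C_diff (Suc k) n U f"
proof -
  have "C_diff k n U (partial_deriv i f)" if "i < n" for i
  proof (rule C_diff_cong[OF assms(1) _ assms(4)[OF that]])
    show "D i x = partial_deriv i f x" if "x \<in> U" for x
      unfolding partial_deriv_def using DERIV_imp_deriv[OF D[OF \<open>i < n\<close> that]] by simp
  qed
  moreover have "(\<lambda>s. f (x(i := s))) differentiable (at (x i))" if "i < n" "x \<in> U" for i x
    using D[OF that] real_differentiable_def by blast
  ultimately show ?thesis using assms(2) by simp
qed

lemma C_diff_Suc_imp: "C_diff (Suc k) n U f \<Longrightarrow> C_diff k n U f"
  by (induction k arbitrary: f) auto

text \<open>The derivatives in \<open>C_diff\<close> are taken at \<open>at (x i)\<close> rather
  than within \<open>U\<close>, so passing to a subset, open or not, loses nothing.\<close>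

lemma C_diff_subset:
  assumes "C_diff k n U f" "V \<subseteq> U"
  shows "C_diff k n V f"
  using assms(1)
proof (induction k arbitrary: f)
  case 0
  then show ?case using assms(2) by (simp add: continuous_on_subset[of U f V])
next
  case (Suc k)
  then have "continuous_on V f" using assms(2) by (simp add: continuous_on_subset[of U f V])
  then show ?case using Suc assms(2) by (simp add: subset_iff)
qed

lemma euc_continuous_on_local:
  fixes f :: "(nat \<Rightarrow> real) \<Rightarrow> 'b::topological_space"
  assumes "\<And>x. x \<in> U \<Longrightarrow> \<exists>V. euc_open n V \<and> x \<in> V \<and> continuous_on V f" "U \<subseteq> euc n"
  shows "continuous_on U f"
  unfolding continuous_on_topological
proof (intro ballI allI impI)
  fix x B assume x: "x \<in> U" and B: "open B" "f x \<in> B"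
  obtain V where V: "euc_open n V" "x \<in> V" "continuous_on V f" using assms x by blast
  obtain A where A: "open A" "x \<in> A" "\<And>y. y \<in> V \<Longrightarrow> y \<in> A \<Longrightarrow> f y \<in> B"
    using V(3)[unfolded continuous_on_topological, rule_format, OF V(2) B] by auto
  obtain S where S: "open S" "V = euc n \<inter> S"
    using V(1) unfolding euc_open_def openin_open by auto
  show "\<exists>A. open A \<and> x \<in> A \<and> (\<forall>y\<in>U. y \<in> A \<longrightarrow> f y \<in> B)"
    using A S V(2) assms(2) by (intro exI[of _ "A \<inter> S"]) auto
qed

lemma C_diff_local:
  assumes "U \<subseteq> euc n" "\<And>x. x \<in> U \<Longrightarrow> \<exists>V. euc_open n V \<and> x \<in> V \<and> C_diff k n V f"
  shows "C_diff k n U f"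
  using assms(2)
proof (induction k arbitrary: f)
  case 0
  then show ?case using euc_continuous_on_local[OF _ assms(1)] by (metis C_diff.simps(1))
next
  case (Suc k)
  have "continuous_on U f"
    using Suc.prems euc_continuous_on_local[OF _ assms(1)] by (metis C_diff.simps(2))
  moreover have "(\<lambda>s. f (x(i := s))) differentiable (at (x i))" if "i < n" "x \<in> U" for i x
    using Suc.prems that by (metis C_diff.simps(2))
  moreover have "C_diff k n U (partial_deriv i f)" if "i < n" for i
    by (rule Suc.IH) (use Suc.prems that in \<open>metis C_diff.simps(2)\<close>)
  ultimately show ?case by simp
qed

lemma C_diff_const: "C_diff k n U (\<lambda>_. c)"
proof (induction k arbitrary: c)
  case (Suc k)
  have "partial_deriv i (\<lambda>_. c) = (\<lambda>_. 0)" for i by (simp add: partial_deriv_def fun_eq_iff)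
  then show ?case using Suc by simp
qed simp

lemma C_diff_add:
  assumes "euc_open n U" "C_diff k n U f" "C_diff k n U g"
  shows "C_diff k n U (\<lambda>x. f x + g x)"
  using assms(2,3)
proof (induction k arbitrary: f g)
  case (Suc k)
  show ?case
  proof (rule C_diff_SucI[OF assms(1), where D = "\<lambda>i x. partial_deriv i f x + partial_deriv i g x"])
    show "continuous_on U (\<lambda>x. f x + g x)" using Suc.prems by (auto intro: continuous_intros)
    show "((\<lambda>s. f (x(i := s)) + g (x(i := s))) has_real_derivative
        partial_deriv i f x + partial_deriv i g x) (at (x i))" if "i < n" "x \<in> U" for i x
      by (rule DERIV_add[OF C_diff_DERIV[OF Suc.prems(1)  that(2,1)] C_diff_DERIV[OF Suc.prems(2) that(2,1)]])
    show "C_diff k n U (\<lambda>x. partial_deriv i f x + partial_deriv i g x)" if "i < n" for i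
      by (rule Suc.IH) (use Suc.prems that in simp_all)
  qed
qed (auto intro: continuous_intros)

text \<open>The product rule multiplies a derivative of one factor by the other factor itself. The
  latter is lowered from C^(k+1) to C^k by \<open>C_diff_Suc_imp\<close>, so that the induction
  hypothesis applies to both mixed products.\<close>

lemma C_diff_mult:
  assumes "euc_open n U" "C_diff k n U f" "C_diff k n U g"
  shows "C_diff k n U (\<lambda>x. f x * g x)"
  using assms(2,3)
proof (induction k arbitrary: f g)
  case (Suc k)
  show ?case
  proof (rule C_diff_SucI[OF assms(1), where
        D = "\<lambda>i x. partial_deriv i f x * g x + partial_deriv i g x * f x"])
    show "continuous_on U (\<lambda>x. f x * g x)" using Suc.prems by (auto intro: continuous_intros)
    show "((\<lambda>s. f (x(i := s)) * g (x(i := s))) has_real_derivative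
        partial_deriv i f x * g x + partial_deriv i g x * f x) (at (x i))" if "i < n" "x \<in> U" for i x
      using DERIV_mult[OF C_diff_DERIV[OF Suc.prems(1)  that(2,1)] C_diff_DERIV[OF Suc.prems(2) that(2,1)]]
      by (simp only: fun_upd_triv)
    show "C_diff k n U (\<lambda>x. partial_deriv i f x * g x + partial_deriv i g x * f x)" if "i < n" for i
    proof (intro C_diff_add[OF assms(1)] Suc.IH)
      show "C_diff k n U (partial_deriv i f)" "C_diff k n U (partial_deriv i g)"
        using Suc.prems that by simp_all
      show "C_diff k n U f" "C_diff k n U g" using Suc.prems C_diff_Suc_imp by blast+
    qed
  qed
qed (auto intro: continuous_intros)

lemma C_diff_sum:
  assumes "euc_open n U" "finite A" "\<And>a. a \<in> A \<Longrightarrow> C_diff k n U (f a)"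
  shows "C_diff k n U (\<lambda>x. \<Sum>a\<in>A. f a x)"
  using assms(2,3)
  by (induction A rule: finite_induct) (auto intro: C_diff_const C_diff_add[OF assms(1)])

section \<open>Mean value theorem and chain rule\<close>

lemma euc_open_box:
  assumes "euc_open m V" "y0 \<in> V"
  obtains \<delta> where "\<delta> > 0" "\<And>y. y \<in> euc m \<Longrightarrow> (\<And>i. i < m \<Longrightarrow> \<bar>y i - y0 i\<bar> < \<delta>) \<Longrightarrow> y \<in> V"
proof (rule ccontr)
  assume *: "\<not> thesis"
  \<comment> \<open>If every cube fails, the cubes of half-width 1/(N+1) give points outside
    \<open>V\<close> that converge to \<open>y0\<close> in each coordinate, hence in the product
    topology; the coordinates from \<open>m\<close> on are constantly zero.\<close>
  have "\<exists>y. y \<in> euc m \<and> (\<forall>i<m. \<bar>y i - y0 i\<bar> < inverse (real (Suc N))) \<and> y \<notin> V" for N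
    using * that[of "inverse (real (Suc N))"] by force
  then obtain y where y: "\<And>N. y N \<in> euc m" "\<And>N i. i < m \<Longrightarrow> \<bar>y N i - y0 i\<bar> < inverse (real (Suc N))"
    "\<And>N. y N \<notin> V" by metis
  have y0: "y0 \<in> euc m" using assms euc_open_subset by blast
  have "(\<lambda>N. y N i) \<longlonglongrightarrow> y0 i" for i
  proof (cases "i < m")
    case True
    have "(\<lambda>N. y N i - y0 i) \<longlonglongrightarrow> 0"
    proof (rule Lim_null_comparison[OF always_eventually LIMSEQ_inverse_real_of_nat], rule allI)
      show "norm (y N i - y0 i) \<le> inverse (real (Suc N))" for N
        using y(2)[OF True, of N] by simp
    qed
    then show ?thesis by (rule LIM_zero_cancel)
  next
    case False
    then show ?thesis using y(1) y0 by (simp add: euc_def)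
  qed
  then have "y \<longlonglongrightarrow> y0" by (rule tendsto_fun_componentwise)
  moreover obtain S where S: "open S" "V = euc m \<inter> S"
    using assms(1) unfolding euc_open_def openin_open by auto
  ultimately have "\<forall>\<^sub>F N in sequentially. y N \<in> S"
    using assms(2) by (auto dest: topological_tendstoD)
  then show False using y(1,3) S by (auto simp: eventually_sequentially)
qed

text \<open>Walk from \<open>y0\<close> to \<open>y\<close> along edges of a box, changing one
  coordinate at a time, and apply the one-variable mean value theorem on each edge. The bound on
  \<open>w y k\<close> forces the intermediate points to \<open>y0\<close> as \<open>y\<close> tends
  to \<open>y0\<close>.\<close>

lemma C_diff_increment:
  assumes V: "euc_open m V" "y0 \<in> V" and f: "C_diff (Suc 0) m V f"
  obtains \<delta> w where "\<delta> > 0"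
    "\<And>y. y \<in> euc m \<Longrightarrow> (\<And>i. i < m \<Longrightarrow> \<bar>y i - y0 i\<bar> < \<delta>) \<Longrightarrow>
       f y - f y0 = (\<Sum>k<m. partial_deriv k f (w y k) * (y k - y0 k)) \<and>
       (\<forall>k<m. w y k \<in> V \<and> (\<forall>i. \<bar>w y k i - y0 i\<bar> \<le> \<bar>y i - y0 i\<bar>))"
proof -
  obtain \<delta> where \<delta>: "\<delta> > 0" "\<And>y. y \<in> euc m \<Longrightarrow> (\<And>i. i < m \<Longrightarrow> \<bar>y i - y0 i\<bar> < \<delta>) \<Longrightarrow> y \<in> V"
    using euc_open_box[OF V] by blast
  have y0: "y0 \<in> euc m" using V euc_open_subset by blast
  have "\<exists>w. f y - f y0 = (\<Sum>k<m. partial_deriv k f (w k) * (y k - y0 k)) \<and>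
       (\<forall>k<m. w k \<in> V \<and> (\<forall>i. \<bar>w k i - y0 i\<bar> \<le> \<bar>y i - y0 i\<bar>))"
    if y: "y \<in> euc m" "\<And>i. i < m \<Longrightarrow> \<bar>y i - y0 i\<bar> < \<delta>" for y
  proof -
    \<comment> \<open>The corner \<open>z k\<close> already has the first \<open>k\<close>
      coordinates of \<open>y\<close>; the edge from \<open>z k\<close> to \<open>z (Suc k)\<close>
      moves coordinate \<open>k\<close> alone.\<close>
    define z where "z k = (\<lambda>i. if i < k then y i else y0 i)" for k :: nat
    have inV: "(z k)(k := s) \<in> V" if "k < m" "\<bar>s - y0 k\<bar> \<le> \<bar>y k - y0 k\<bar>" for k s
    proof (rule \<delta>(2))
      show "(z k)(k := s) \<in> euc m" using that y(1) y0 by (auto simp: z_def euc_def)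
      show "\<bar>((z k)(k := s)) i - y0 i\<bar> < \<delta>" if "i < m" for i
        using y(2)[OF that] \<open>\<bar>s - y0 k\<bar> \<le> \<bar>y k - y0 k\<bar>\<close> \<delta>(1)
        by (cases "i = k") (auto simp: z_def)
    qed
    have zk: "z (Suc k) = (z k)(k := y k)" "z k = (z k)(k := y0 k)" for k
      by (auto simp: z_def fun_eq_iff less_Suc_eq)
    have "\<exists>\<xi>. f (z (Suc k)) - f (z k) = partial_deriv k f ((z k)(k := \<xi>)) * (y k - y0 k) \<and>
        \<bar>\<xi> - y0 k\<bar> \<le> \<bar>y k - y0 k\<bar>" if k: "k < m" for k
    proof -
      define g where "g s = f ((z k)(k := s))" for s
      have D: "(g has_real_derivative partial_deriv k f ((z k)(k := s))) (at s)"
        if "\<bar>s - y0 k\<bar> \<le> \<bar>y k - y0 k\<bar>" for s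
        using C_diff_DERIV[OF f inV[OF k that] k] unfolding g_def by simp
      have eq: "f (z (Suc k)) - f (z k) = g (y k) - g (y0 k)"
        unfolding g_def using zk by metis
      \<comment> \<open>\<open>MVT2\<close> needs an ordered interval, so both orders are treated;
        when the coordinates agree, both sides vanish.\<close>
      consider "y k = y0 k" | "y k < y0 k" | "y0 k < y k" by linarith
      then show ?thesis
      proof cases
        case 1
        then show ?thesis using eq by auto
      next
        case 2
        then obtain \<xi> where "y k < \<xi>" "\<xi> < y0 k"
          "g (y0 k) - g (y k) = (y0 k - y k) * partial_deriv k f ((z k)(k := \<xi>))"
          using MVT2[OF 2, of g "\<lambda>s. partial_deriv k f ((z k)(k := s))"] D by auto
        then show ?thesis using eq by (intro exI[of _ \<xi>]) (auto simp: algebra_simps)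
      next
        case 3
        then obtain \<xi> where "y0 k < \<xi>" "\<xi> < y k"
          "g (y k) - g (y0 k) = (y k - y0 k) * partial_deriv k f ((z k)(k := \<xi>))"
          using MVT2[OF 3, of g "\<lambda>s. partial_deriv k f ((z k)(k := s))"] D by auto
        then show ?thesis using eq by (intro exI[of _ \<xi>]) (auto simp: algebra_simps)
      qed
    qed
    then obtain \<xi> where \<xi>: "\<And>k. k < m \<Longrightarrow>
        f (z (Suc k)) - f (z k) = partial_deriv k f ((z k)(k := \<xi> k)) * (y k - y0 k)"
      "\<And>k. k < m \<Longrightarrow> \<bar>\<xi> k - y0 k\<bar> \<le> \<bar>y k - y0 k\<bar>" by metis
    have zm: "z m = y" "z 0 = y0" using y y0 by (auto simp: z_def euc_def fun_eq_iff)
    have "f y - f y0 = (\<Sum>k<m. f (z (Suc k)) - f (z k))"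
      using zm sum_lessThan_telescope[of "\<lambda>k. f (z k)" m] by simp
    also have "\<dots> = (\<Sum>k<m. partial_deriv k f ((z k)(k := \<xi> k)) * (y k - y0 k))"
      by (rule sum.cong) (use \<xi>(1) in auto)
    finally show ?thesis
      by (intro exI[of _ "\<lambda>k. (z k)(k := \<xi> k)"]) (use \<xi>(2) inV in \<open>auto simp: z_def\<close>)
  qed
  then have "\<forall>y. \<exists>w. y \<in> euc m \<and> (\<forall>i<m. \<bar>y i - y0 i\<bar> < \<delta>) \<longrightarrow>
      f y - f y0 = (\<Sum>k<m. partial_deriv k f (w k) * (y k - y0 k)) \<and>
       (\<forall>k<m. w k \<in> V \<and> (\<forall>i. \<bar>w k i - y0 i\<bar> \<le> \<bar>y i - y0 i\<bar>))"
    by blast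
  from choice[OF this] obtain w where "\<forall>y. y \<in> euc m \<and> (\<forall>i<m. \<bar>y i - y0 i\<bar> < \<delta>) \<longrightarrow>
      f y - f y0 = (\<Sum>k<m. partial_deriv k f (w y k) * (y k - y0 k)) \<and>
       (\<forall>k<m. w y k \<in> V \<and> (\<forall>i. \<bar>w y k i - y0 i\<bar> \<le> \<bar>y i - y0 i\<bar>))" ..
  then show thesis by (intro that[OF \<delta>(1), of w]) auto
qed

text \<open>Divide the increment formula by \<open>s - s0\<close>: the difference quotients of the
  coordinates converge by assumption, and the partial derivatives at the intermediate points
  converge because they are continuous on \<open>V\<close>.\<close>

lemma DERIV_chain_euc:
  assumes V: "euc_open m V" and f: "C_diff (Suc 0) m V f"
    and \<gamma>: "\<forall>\<^sub>F s in nhds s0. \<gamma> s \<in> V"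
    and D: "\<And>k. k < m \<Longrightarrow> ((\<lambda>s. \<gamma> s k) has_real_derivative d k) (at s0)"
  shows "((\<lambda>s. f (\<gamma> s)) has_real_derivative (\<Sum>k<m. partial_deriv k f (\<gamma> s0) * d k)) (at s0)"
proof -
  have y0: "\<gamma> s0 \<in> V" using \<gamma> by (rule eventually_nhds_x_imp_x)
  obtain \<delta> w where \<delta>: "\<delta> > 0" and w: 
    "\<And>y. y \<in> euc m \<Longrightarrow> (\<And>i. i < m \<Longrightarrow> \<bar>y i - \<gamma> s0 i\<bar> < \<delta>) \<Longrightarrow>
       f y - f (\<gamma> s0) = (\<Sum>k<m. partial_deriv k f (w y k) * (y k - \<gamma> s0 k)) \<and>
       (\<forall>k<m. w y k \<in> V \<and> (\<forall>i. \<bar>w y k i - \<gamma> s0 i\<bar> \<le> \<bar>y i - \<gamma> s0 i\<bar>))"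
    using C_diff_increment[OF V y0 f] by blast
  have \<gamma>': "\<forall>\<^sub>F s in at s0. \<gamma> s \<in> V" using \<gamma> eventually_nhds_conv_at by blast
  have lim: "((\<lambda>s. \<gamma> s i) \<longlongrightarrow> \<gamma> s0 i) (at s0)" for i
  proof (cases "i < m")
    case True
    then show ?thesis using D DERIV_isCont isCont_def by blast
  next
    \<comment> \<open>On \<open>V\<close> the coordinates from \<open>m\<close> on are zero;
      convergence in the product topology asks for these coordinates as well.\<close>
    case False
    have "\<forall>\<^sub>F s in at s0. \<gamma> s i = \<gamma> s0 i"
      using \<gamma>'
    proof eventually_elim
      case (elim s)
      then have "\<gamma> s \<in> euc m" "\<gamma> s0 \<in> euc m" using y0 euc_open_subset[OF V] by auto
      then show ?case using False by (simp add: euc_def)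
    qed
    then show ?thesis by (rule tendsto_eventually)
  qed
  have near: "\<forall>\<^sub>F s in at s0. \<forall>i<m. \<bar>\<gamma> s i - \<gamma> s0 i\<bar> < \<delta>"
    using eventually_ball_finite[of "{..<m}" "\<lambda>s i. \<bar>\<gamma> s i - \<gamma> s0 i\<bar> < \<delta>" "at s0"] tendstoD[OF lim \<delta>]
    by (simp add: dist_real_def Ball_def)
  have ev: "\<forall>\<^sub>F s in at s0. f (\<gamma> s) - f (\<gamma> s0) =
        (\<Sum>k<m. partial_deriv k f (w (\<gamma> s) k) * (\<gamma> s k - \<gamma> s0 k)) \<and>
       (\<forall>k<m. w (\<gamma> s) k \<in> V \<and> (\<forall>i. \<bar>w (\<gamma> s) k i - \<gamma> s0 i\<bar> \<le> \<bar>\<gamma> s i - \<gamma> s0 i\<bar>))"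
    using near \<gamma>' by eventually_elim (use w euc_open_subset[OF V] in blast)
  have wlim: "((\<lambda>s. partial_deriv k f (w (\<gamma> s) k)) \<longlongrightarrow> partial_deriv k f (\<gamma> s0)) (at s0)" if k: "k < m" for k
  proof (rule continuous_on_tendsto_compose[where s = V and f = "partial_deriv k f" and g = "\<lambda>s. w (\<gamma> s) k"])
    show "continuous_on V (partial_deriv k f)" using f k by simp
    show "\<gamma> s0 \<in> V" by fact
    show "\<forall>\<^sub>F s in at s0. w (\<gamma> s) k \<in> V" by (rule eventually_mono[OF ev]) (use k in blast)
    show "((\<lambda>s. w (\<gamma> s) k) \<longlongrightarrow> \<gamma> s0) (at s0)"
    proof (rule tendsto_fun_componentwise)
      fix i
      have "((\<lambda>s. \<bar>\<gamma> s i - \<gamma> s0 i\<bar>) \<longlongrightarrow> 0) (at s0)"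
        using lim[of i] by (simp add: LIM_zero tendsto_rabs_zero)
      then have "((\<lambda>s. w (\<gamma> s) k i - \<gamma> s0 i) \<longlongrightarrow> 0) (at s0)"
      proof (rule Lim_null_comparison[rotated])
        show "\<forall>\<^sub>F s in at s0. norm (w (\<gamma> s) k i - \<gamma> s0 i) \<le> \<bar>\<gamma> s i - \<gamma> s0 i\<bar>"
          using ev by eventually_elim (use k in simp)
      qed
      then show "((\<lambda>s. w (\<gamma> s) k i) \<longlongrightarrow> \<gamma> s0 i) (at s0)"
        by (rule LIM_zero_cancel)
    qed
  qed
  have "((\<lambda>s. \<Sum>k<m. partial_deriv k f (w (\<gamma> s) k) * ((\<gamma> s k - \<gamma> s0 k) / (s - s0))) \<longlongrightarrow>
      (\<Sum>k<m. partial_deriv k f (\<gamma> s0) * d k)) (at s0)"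
    by (intro tendsto_sum tendsto_mult wlim) (use D in \<open>auto simp: has_field_derivative_iff\<close>)
  then have "((\<lambda>s. (f (\<gamma> s) - f (\<gamma> s0)) / (s - s0)) \<longlongrightarrow> (\<Sum>k<m. partial_deriv k f (\<gamma> s0) * d k)) (at s0)"
  proof (rule Lim_transform_eventually)
    show "\<forall>\<^sub>F s in at s0. (\<Sum>k<m. partial_deriv k f (w (\<gamma> s) k) * ((\<gamma> s k - \<gamma> s0 k) / (s - s0))) =
        (f (\<gamma> s) - f (\<gamma> s0)) / (s - s0)"
      using ev by eventually_elim (simp add: sum_divide_distrib)
  qed
  then show ?thesis by (simp add: has_field_derivative_iff)
qed

section \<open>Smooth functions and their composition\<close>

definition smooth_fn :: "nat \<Rightarrow> (nat \<Rightarrow> real) set \<Rightarrow> ((nat \<Rightarrow> real) \<Rightarrow> real) \<Rightarrow> bool" where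
  "smooth_fn n U f \<longleftrightarrow> (\<forall>k. C_diff k n U f)"

lemma smooth_fn_partial_deriv: "smooth_fn n U f \<Longrightarrow> i < n \<Longrightarrow> smooth_fn n U (partial_deriv i f)"
  unfolding smooth_fn_def by (metis C_diff.simps(2))

lemma smooth_fn_continuous_on: "smooth_fn n U f \<Longrightarrow> continuous_on U f"
  unfolding smooth_fn_def using C_diff_0 by blast

lemma smooth_fn_DERIV:
  assumes "smooth_fn n U f" "x \<in> U" "i < n"
  shows "((\<lambda>s. f (x(i := s))) has_real_derivative partial_deriv i f x) (at (x i))"
  using assms C_diff_DERIV unfolding smooth_fn_def by blast

lemma smooth_fn_cong: "euc_open n U \<Longrightarrow> (\<And>x. x \<in> U \<Longrightarrow> f x = g x) \<Longrightarrow> smooth_fn n U f \<Longrightarrow> smooth_fn n U g"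
  unfolding smooth_fn_def using C_diff_cong by blast

lemma smooth_fn_subset: "smooth_fn n U f \<Longrightarrow> V \<subseteq> U \<Longrightarrow> smooth_fn n V f"
  unfolding smooth_fn_def using C_diff_subset by blast

lemma smooth_fn_local:
  assumes "U \<subseteq> euc n" "\<And>x. x \<in> U \<Longrightarrow> \<exists>V. euc_open n V \<and> x \<in> V \<and> smooth_fn n V f"
  shows "smooth_fn n U f"
  unfolding smooth_fn_def using C_diff_local[OF assms(1)] assms(2) unfolding smooth_fn_def by blast

lemma smooth_fn_const: "smooth_fn n U (\<lambda>_. c)"
  unfolding smooth_fn_def by (simp add: C_diff_const)

lemma smooth_fn_add: "euc_open n U \<Longrightarrow> smooth_fn n U f \<Longrightarrow> smooth_fn n U g \<Longrightarrow> smooth_fn n U (\<lambda>x. f x + g x)"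
  unfolding smooth_fn_def using C_diff_add by blast

lemma smooth_fn_mult: "euc_open n U \<Longrightarrow> smooth_fn n U f \<Longrightarrow> smooth_fn n U g \<Longrightarrow> smooth_fn n U (\<lambda>x. f x * g x)"
  unfolding smooth_fn_def using C_diff_mult by blast

lemma smooth_fn_sum:
  "euc_open n U \<Longrightarrow> finite A \<Longrightarrow> (\<And>a. a \<in> A \<Longrightarrow> smooth_fn n U (f a)) \<Longrightarrow> smooth_fn n U (\<lambda>x. \<Sum>a\<in>A. f a x)"
  unfolding smooth_fn_def using C_diff_sum by blast

lemma smooth_fn_coord: "i < n \<Longrightarrow> euc_open n U \<Longrightarrow> smooth_fn n U (\<lambda>x. x i)"
  unfolding smooth_fn_def
proof
  fix k assume "i < n" "euc_open n U"
  have "continuous_on U (\<lambda>x. x i)"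
    by (rule continuous_on_subset[OF continuous_on_product_coordinates]) simp
  moreover have "((\<lambda>s. (x(l := s)) i) has_real_derivative (if l = i then 1 else 0)) (at (x l))" for l x
    by (auto intro!: derivative_eq_intros)
  ultimately show "C_diff k n U (\<lambda>x. x i)"
    using C_diff_SucI[OF \<open>euc_open n U\<close>, of "\<lambda>x. x i" "\<lambda>l x. if l = i then 1 else 0"]
      C_diff_const by (cases k) auto
qed

lemma euc_smooth_iff: "euc_smooth n U m F \<longleftrightarrow> F ` U \<subseteq> euc m \<and> (\<forall>j<m. smooth_fn n U (\<lambda>x. F x j))"
  unfolding euc_smooth_def smooth_fn_def ..

lemma euc_smooth_continuous_on:
  assumes "euc_smooth n U m F"
  shows "continuous_on U F"
proof (rule continuous_on_coordinatewise_then_product)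
  fix i
  show "continuous_on U (\<lambda>x. F x i)"
  proof (cases "i < m")
    case True
    then show ?thesis using assms smooth_fn_continuous_on unfolding euc_smooth_iff by blast
  next
    case False
    have "continuous_on U (\<lambda>x. F x i) = continuous_on U (\<lambda>x. 0 :: real)"
      by (rule continuous_on_cong) (use False assms in \<open>auto simp: euc_smooth_iff euc_def image_subset_iff\<close>)
    then show ?thesis by simp
  qed
qed

lemma euc_smooth_vimage_open:
  "euc_open n U \<Longrightarrow> euc_smooth n U m F \<Longrightarrow> euc_open m V \<Longrightarrow> euc_open n {x \<in> U. F x \<in> V}"
  by (rule euc_open_vimage) (auto simp: euc_smooth_continuous_on euc_smooth_iff)

text \<open>This is the chain rule along the curve that \<open>F\<close> traces on a coordinate
  line.\<close>

lemma DERIV_compose_euc: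
  assumes U: "euc_open n U" and V: "euc_open m V" and F: "euc_smooth n U m F" "F ` U \<subseteq> V"
    and f: "C_diff (Suc 0) m V f" and x: "x \<in> U" "i < n"
  shows "((\<lambda>s. f (F (x(i := s)))) has_real_derivative
    (\<Sum>k<m. partial_deriv k f (F x) * partial_deriv i (\<lambda>y. F y k) x)) (at (x i))"
proof -
  have "\<forall>\<^sub>F s in nhds (x i). F (x(i := s)) \<in> V"
    using euc_open_upd[OF U x] by eventually_elim (use F in auto)
  moreover have "((\<lambda>s. F (x(i := s)) k) has_real_derivative partial_deriv i (\<lambda>y. F y k) x) (at (x i))"
    if "k < m" for k
    using smooth_fn_DERIV[of n U "\<lambda>y. F y k"] F(1) that x unfolding euc_smooth_iff by blast
  ultimately show ?thesis
    using DERIV_chain_euc[OF V f, where \<gamma> = "\<lambda>s. F (x(i := s))" and ?s0.0 = "x i"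
        and d = "\<lambda>k. partial_deriv i (\<lambda>y. F y k) x"] by simp
qed

lemma partial_deriv_compose:
  assumes U: "euc_open n U" and V: "euc_open m V" and F: "euc_smooth n U m F" "F ` U \<subseteq> V"
    and f: "smooth_fn m V f" and x: "x \<in> U" "i < n"
  shows "partial_deriv i (\<lambda>y. f (F y)) x = (\<Sum>k<m. partial_deriv k f (F x) * partial_deriv i (\<lambda>y. F y k) x)"
  unfolding partial_deriv_def[of i "\<lambda>y. f (F y)"]
  by (rule DERIV_imp_deriv, rule DERIV_compose_euc[OF U V F _ x]) (use f smooth_fn_def in blast)

text \<open>The chain rule writes a partial derivative of the composite with two kinds of factors:
  partial derivatives of \<open>f\<close> after \<open>F\<close>, covered by the induction
  hypothesis because \<open>f\<close> is arbitrary there, and partial derivatives of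
  \<open>F\<close>, which are smooth.\<close>

lemma smooth_fn_compose:
  assumes U: "euc_open n U" and V: "euc_open m V" and F: "euc_smooth n U m F" "F ` U \<subseteq> V"
    and f: "smooth_fn m V f"
  shows "smooth_fn n U (\<lambda>x. f (F x))"
proof -
  have "C_diff k n U (\<lambda>x. f (F x))" for k
    using f
  proof (induction k arbitrary: f)
    case 0
    then show ?case
      using continuous_on_compose2[OF smooth_fn_continuous_on[OF 0] euc_smooth_continuous_on[OF F(1)] F(2)]
      by simp
  next
    case (Suc k)
    show ?case
    proof (rule C_diff_SucI[OF U, where
          D = "\<lambda>i x. \<Sum>k<m. partial_deriv k f (F x) * partial_deriv i (\<lambda>y. F y k) x"])
      show "continuous_on U (\<lambda>x. f (F x))"
        using continuous_on_compose2[OF smooth_fn_continuous_on[OF Suc.prems] euc_smooth_continuous_on[OF F(1)] F(2)] .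
      show "((\<lambda>s. f (F (x(i := s)))) has_real_derivative
        (\<Sum>k<m. partial_deriv k f (F x) * partial_deriv i (\<lambda>y. F y k) x)) (at (x i))"
        if "i < n" "x \<in> U" for i x
        by (rule DERIV_compose_euc[OF U V F _ that(2,1)]) (use Suc.prems smooth_fn_def in blast)
      show "C_diff k n U (\<lambda>x. \<Sum>l<m. partial_deriv l f (F x) * partial_deriv i (\<lambda>y. F y l) x)"
        if "i < n" for i
      proof (intro C_diff_sum[OF U] C_diff_mult[OF U])
        fix l assume l: "l \<in> {..<m}"
        show "C_diff k n U (\<lambda>x. partial_deriv l f (F x))"
          using Suc.IH smooth_fn_partial_deriv[OF Suc.prems] l by auto
        have "smooth_fn n U (\<lambda>y. F y l)" using F l unfolding euc_smooth_iff by blast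
        then show "C_diff k n U (partial_deriv i (\<lambda>y. F y l))"
          using smooth_fn_partial_deriv that unfolding smooth_fn_def by blast
      qed simp
    qed
  qed
  then show ?thesis unfolding smooth_fn_def by blast
qed

lemma euc_smooth_compose:
  assumes "euc_open n U" "euc_open m V" "euc_smooth n U m F" "F ` U \<subseteq> V" "euc_smooth m V l H"
  shows "euc_smooth n U l (\<lambda>x. H (F x))"
  using assms smooth_fn_compose[OF assms(1-4), of "\<lambda>x. H x _"] unfolding euc_smooth_iff
  by (auto simp: image_subset_iff)

lemma euc_smooth_cong:
  "euc_open n U \<Longrightarrow> (\<And>x. x \<in> U \<Longrightarrow> F x = H x) \<Longrightarrow> euc_smooth n U m F \<Longrightarrow> euc_smooth n U m H"
  unfolding euc_smooth_iff by (auto simp: image_subset_iff intro: smooth_fn_cong[of n U "\<lambda>x. F x _"])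

lemma euc_smooth_subset: "euc_smooth n U m F \<Longrightarrow> V \<subseteq> U \<Longrightarrow> euc_smooth n V m F"
  unfolding euc_smooth_iff using smooth_fn_subset by blast

section \<open>Jacobians and linear forms\<close>

lemma jacobian_euc: "jacobian n m F x v \<in> euc m"
  unfolding jacobian_def euc_def by auto

lemma jacobian_cong:
  assumes "euc_open n U" "x \<in> U" "\<And>y. y \<in> U \<Longrightarrow> F y = H y"
  shows "jacobian n m F x v = jacobian n m H x v"
  unfolding jacobian_def
  by (auto simp: fun_eq_iff intro!: sum.cong partial_deriv_cong[OF assms(1,2)] simp: assms(3))

text \<open>\<open>jacobian\<close> cuts its result off at \<open>n\<close>, so the identity matrix
  fixes only the vectors of \<open>euc n\<close>.\<close>

lemma jacobian_id:
  assumes "v \<in> euc n"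
  shows "jacobian n n (\<lambda>y. y) x v = v"
proof -
  have p: "partial_deriv i (\<lambda>y. y j) x = (if i = j then 1 else 0)" for i j
    unfolding partial_deriv_def by (auto intro!: DERIV_imp_deriv derivative_eq_intros)
  have "(\<Sum>i<n. (if i = j then 1 else 0) * v i) = v j" if "j < n" for j
    using that by (simp add: if_distrib[of "\<lambda>a. a * _"] cong: if_cong)
  then show ?thesis using assms by (auto simp: jacobian_def euc_def fun_eq_iff p)
qed

lemma jacobian_compose:
  assumes U: "euc_open n U" and V: "euc_open m V" and F: "euc_smooth n U m F" "F ` U \<subseteq> V"
    and H: "euc_smooth m V l H" and x: "x \<in> U"
  shows "jacobian n l (\<lambda>y. H (F y)) x v = jacobian m l H (F x) (jacobian n m F x v)"
proof
  fix j
  show "jacobian n l (\<lambda>y. H (F y)) x v j = jacobian m l H (F x) (jacobian n m F x v) j"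
  proof (cases "j < l")
    case True
    then have "smooth_fn m V (\<lambda>y. H y j)" using H unfolding euc_smooth_iff by blast
    then have "partial_deriv i (\<lambda>y. H (F y) j) x =
        (\<Sum>k<m. partial_deriv k (\<lambda>y. H y j) (F x) * partial_deriv i (\<lambda>y. F y k) x)" if "i < n" for i
      using partial_deriv_compose[OF U V F, of "\<lambda>y. H y j"] x that by simp
    then have "jacobian n l (\<lambda>y. H (F y)) x v j =
        (\<Sum>i<n. \<Sum>k<m. partial_deriv k (\<lambda>y. H y j) (F x) * partial_deriv i (\<lambda>y. F y k) x * v i)"
      using True by (auto simp: jacobian_def sum_distrib_right intro!: sum.cong)
    also have "\<dots> = (\<Sum>k<m. \<Sum>i<n. partial_deriv k (\<lambda>y. H y j) (F x) * partial_deriv i (\<lambda>y. F y k) x * v i)"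
      by (rule sum.swap)
    also have "\<dots> = jacobian m l H (F x) (jacobian n m F x v) j"
      using True by (auto simp: jacobian_def sum_distrib_left mult.assoc intro!: sum.cong)
    finally show ?thesis .
  qed (simp add: jacobian_def)
qed

lemma jacobian_add: "jacobian n m F x (\<lambda>i. u i + v i) = (\<lambda>i. jacobian n m F x u i + jacobian n m F x v i)"
  by (auto simp: jacobian_def fun_eq_iff sum.distrib algebra_simps)

lemma jacobian_scale: "jacobian n m F x (\<lambda>i. a * u i) = (\<lambda>i. a * jacobian n m F x u i)"
  by (auto simp: jacobian_def fun_eq_iff sum_distrib_left algebra_simps)

lemma jacobian_zero: "jacobian n m F x (\<lambda>i. 0) = (\<lambda>i. 0)"
  by (auto simp: jacobian_def fun_eq_iff)

text \<open>Induction over the truncations of \<open>x\<close> to its first \<open>k\<close>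
  coordinates. The bound \<open>k \<le> n\<close> keeps all vectors in \<open>euc n\<close>, where
  \<open>h\<close> is known to be linear.\<close>

lemma real_linear_euc:
  fixes h :: "(nat \<Rightarrow> real) \<Rightarrow> real"
  assumes add: "\<And>x y. x \<in> euc n \<Longrightarrow> y \<in> euc n \<Longrightarrow> h (\<lambda>i. x i + y i) = h x + h y"
    and scale: "\<And>a x. x \<in> euc n \<Longrightarrow> h (\<lambda>i. a * x i) = a * h x"
    and x: "x \<in> euc n"
  shows "h x = (\<Sum>i<n. x i * h (\<lambda>j. if j = i then 1 else 0))"
proof -
  have *: "k \<le> n \<Longrightarrow> h (\<lambda>j. if j < k then x j else 0) = (\<Sum>i<k. x i * h (\<lambda>j. if j = i then 1 else 0))" for k
  proof (induction k)
    case 0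
    have "h (\<lambda>i. 0 * x i) = 0 * h x" by (rule scale[OF x])
    then show ?case by simp
  next
    case (Suc k)
    have e: "(\<lambda>j. if j = k then 1 else 0) \<in> euc n" using Suc by (auto simp: euc_def)
    have "h (\<lambda>j. if j < Suc k then x j else 0) =
        h (\<lambda>j. (if j < k then x j else 0) + x k * (if j = k then 1 else 0))"
      by (rule arg_cong[of _ _ h]) (auto simp: less_Suc_eq)
    also have "\<dots> = h (\<lambda>j. if j < k then x j else 0) + h (\<lambda>j. x k * (if j = k then 1 else 0))"
      by (rule add) (use x Suc in \<open>auto simp: euc_def\<close>)
    finally show ?case using Suc scale[OF e, of "x k"] by simp
  qed
  have "(\<lambda>j. if j < n then x j else 0) = x"
    using x by (auto simp: euc_def fun_eq_iff)
  then show ?thesis using *[of n] by simp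
qed

section \<open>Manifolds and locally defined smooth functions\<close>

text \<open>The atlas conditions of \<open>smooth_manifold\<close>. Products, open submanifolds and
  tangent manifolds are built and used at this level, where smooth maps can already be composed and
  differentiated.\<close>

definition premanifold :: "'a manifold \<Rightarrow> bool" where
  "premanifold M \<longleftrightarrow> \<Union>(cdom ` atlas M) = carrier M \<and> atlas M = max_atlas (carrier M) (atlas M)"

lemma smooth_manifold_premanifold: "smooth_manifold M \<Longrightarrow> premanifold M"
  unfolding smooth_manifold_def premanifold_def by blast

lemma smooth_transition_iff: "smooth_transition c d \<longleftrightarrow>
     euc_open (cdim c) (cmap c ` (cdom c \<inter> cdom d)) \<and>
     euc_smooth (cdim c) (cmap c ` (cdom c \<inter> cdom d)) (cdim d) (\<lambda>x. cmap d (cinv c x))"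
  unfolding smooth_transition_def o_def ..

lemma cinv_cmap: "is_chart S c \<Longrightarrow> p \<in> cdom c \<Longrightarrow> cinv c (cmap c p) = p"
  unfolding cinv_def is_chart_def by (simp add: the_inv_into_f_f)

lemma chart_subset: "is_chart S c \<Longrightarrow> cdom c \<subseteq> S"
  by (simp add: is_chart_def)

lemma chart_open: "is_chart S c \<Longrightarrow> euc_open (cdim c) (cmap c ` cdom c)"
  by (simp add: is_chart_def)

lemma chart_euc: "is_chart S c \<Longrightarrow> p \<in> cdom c \<Longrightarrow> cmap c p \<in> euc (cdim c)"
  using chart_open euc_open_subset by blast

lemma chart_image_Int:
  "is_chart S c \<Longrightarrow> A \<subseteq> cdom c \<Longrightarrow> B \<subseteq> cdom c \<Longrightarrow> cmap c ` (A \<inter> B) = cmap c ` A \<inter> cmap c ` B"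
  unfolding is_chart_def by (metis inj_on_image_Int)

lemma chart_image_iff:
  "is_chart S c \<Longrightarrow> p \<in> cdom c \<Longrightarrow> A \<subseteq> cdom c \<Longrightarrow> cmap c p \<in> cmap c ` A \<longleftrightarrow> p \<in> A"
  unfolding is_chart_def by (metis inj_on_image_mem_iff)

lemma atlas_chart: "premanifold M \<Longrightarrow> c \<in> atlas M \<Longrightarrow> is_chart (carrier M) c"
  unfolding premanifold_def max_atlas_def by blast

lemma atlas_transition: "premanifold M \<Longrightarrow> c \<in> atlas M \<Longrightarrow> d \<in> atlas M \<Longrightarrow> smooth_transition c d"
  unfolding premanifold_def max_atlas_def by blast

lemma atlasI:
  "premanifold M \<Longrightarrow> is_chart (carrier M) c \<Longrightarrow> (\<And>d. d \<in> atlas M \<Longrightarrow> smooth_transition c d) \<Longrightarrow>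
    (\<And>d. d \<in> atlas M \<Longrightarrow> smooth_transition d c) \<Longrightarrow> c \<in> atlas M"
  unfolding premanifold_def max_atlas_def by blast

lemma atlas_cover: "premanifold M \<Longrightarrow> p \<in> carrier M \<Longrightarrow> \<exists>c\<in>atlas M. p \<in> cdom c"
  unfolding premanifold_def by blast

text \<open>The predicate inside \<open>mtop\<close>. Working with it directly avoids the abstract
  type of topologies; \<open>openin_mtop\<close> makes the link for trivializations, whose
  definition speaks of \<open>openin\<close>.\<close>

definition mopen :: "'a manifold \<Rightarrow> 'a set \<Rightarrow> bool" where
  "mopen M W \<longleftrightarrow> W \<subseteq> carrier M \<and> (\<forall>c\<in>atlas M. euc_open (cdim c) (cmap c ` (W \<inter> cdom c)))"

lemma mopen_cdom:
  assumes "premanifold M" "c \<in> atlas M"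
  shows "mopen M (cdom c)"
  using assms atlas_transition[OF assms(1) _ assms(2)] chart_subset[OF atlas_chart[OF assms]]
  unfolding mopen_def smooth_transition_def by (metis Int_commute)

lemma mopen_Int:
  assumes "premanifold M" "mopen M A" "mopen M B"
  shows "mopen M (A \<inter> B)"
proof -
  have "cmap c ` (A \<inter> B \<inter> cdom c) = cmap c ` (A \<inter> cdom c) \<inter> cmap c ` (B \<inter> cdom c)"
    if "c \<in> atlas M" for c
    using chart_image_Int[OF atlas_chart[OF assms(1) that], of "A \<inter> cdom c" "B \<inter> cdom c"]
    by (simp add: Int_ac)
  then show ?thesis using assms(2,3) euc_open_Int unfolding mopen_def by auto
qed

lemma mopen_Union:
  assumes "\<And>W. W \<in> \<W> \<Longrightarrow> mopen M W"
  shows "mopen M (\<Union>\<W>)"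
proof -
  have "cmap c ` (\<Union>\<W> \<inter> cdom c) = \<Union>((\<lambda>W. cmap c ` (W \<inter> cdom c)) ` \<W>)" for c by auto
  then have "euc_open (cdim c) (cmap c ` (\<Union>\<W> \<inter> cdom c))" if "c \<in> atlas M" for c
    using assms that unfolding mopen_def by (metis (no_types, lifting) euc_open_Union imageE)
  then show ?thesis using assms unfolding mopen_def by blast
qed

lemma mopen_local:
  assumes "\<And>p. p \<in> W \<Longrightarrow> \<exists>W'. mopen M W' \<and> p \<in> W' \<and> W' \<subseteq> W"
  shows "mopen M W"
proof -
  have "W = \<Union>{W'. mopen M W' \<and> W' \<subseteq> W}" using assms by blast
  then show ?thesis using mopen_Union[of "{W'. mopen M W' \<and> W' \<subseteq> W}" M] by simp
qed

lemma mopen_carrier: "premanifold M \<Longrightarrow> mopen M (carrier M)"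
  by (rule mopen_local) (metis atlas_chart atlas_cover chart_subset mopen_cdom)

lemma mopen_subset: "mopen M W \<Longrightarrow> W \<subseteq> carrier M"
  by (simp add: mopen_def)

lemma openin_mtop:
  assumes "premanifold M"
  shows "openin (mtop M) W \<longleftrightarrow> mopen M W"
proof -
  have "istopology (mopen M)"
    unfolding istopology_def using mopen_Int[OF assms] mopen_Union by blast
  moreover have "mtop M = topology (mopen M)" unfolding mtop_def mopen_def ..
  ultimately show ?thesis by (simp add: topology_inverse')
qed

text \<open>In any other chart this set is a preimage under the smooth, hence continuous, transition
  map.\<close>

lemma mopen_chart_vimage:
  assumes "premanifold M" "c \<in> atlas M" "euc_open (cdim c) V"
  shows "mopen M {p \<in> cdom c. cmap c p \<in> V}"
  unfolding mopen_def
proof (intro conjI ballI)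
  show "{p \<in> cdom c. cmap c p \<in> V} \<subseteq> carrier M"
    using chart_subset[OF atlas_chart[OF assms(1,2)]] by blast
  fix c' assume c': "c' \<in> atlas M"
  have "cmap c' ` ({p \<in> cdom c. cmap c p \<in> V} \<inter> cdom c') =
      {x \<in> cmap c' ` (cdom c' \<inter> cdom c). cmap c (cinv c' x) \<in> V}"
    using cinv_cmap[OF atlas_chart[OF assms(1) c']] by auto
  then show "euc_open (cdim c') (cmap c' ` ({p \<in> cdom c. cmap c p \<in> V} \<inter> cdom c'))"
    using euc_smooth_vimage_open[OF _ _ assms(3)] atlas_transition[OF assms(1) c' assms(2)]
    unfolding smooth_transition_iff by simp
qed

lemma mopen_chartI:
  assumes "premanifold M"
    "\<And>p. p \<in> W \<Longrightarrow> \<exists>c\<in>atlas M. \<exists>V. p \<in> cdom c \<and> euc_open (cdim c) V \<and> cmap c p \<in> V \<and>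
       (\<forall>q\<in>cdom c. cmap c q \<in> V \<longrightarrow> q \<in> W)"
  shows "mopen M W"
proof (rule mopen_local)
  fix p assume "p \<in> W"
  then obtain c V where "c \<in> atlas M" "p \<in> cdom c" "euc_open (cdim c) V" "cmap c p \<in> V"
    "\<forall>q\<in>cdom c. cmap c q \<in> V \<longrightarrow> q \<in> W"
    using assms(2) by blast
  then show "\<exists>W'. mopen M W' \<and> p \<in> W' \<and> W' \<subseteq> W"
    using mopen_chart_vimage[OF assms(1)] by (intro exI[of _ "{p \<in> cdom c. cmap c p \<in> V}"]) auto
qed

section \<open>Smooth real functions on open sets\<close>

definition smooth_on :: "'a manifold \<Rightarrow> 'a set \<Rightarrow> ('a \<Rightarrow> real) \<Rightarrow> bool" where
  "smooth_on M W f \<longleftrightarrow> mopen M W \<and> (\<forall>c\<in>atlas M. smooth_fn (cdim c) (cmap c ` (W \<inter> cdom c)) (\<lambda>x. f (cinv c x)))"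

lemma smooth_on_mopen: "smooth_on M W f \<Longrightarrow> mopen M W"
  by (simp add: smooth_on_def)

lemma smooth_on_smooth_fn: "smooth_on M W f \<Longrightarrow> c \<in> atlas M \<Longrightarrow> smooth_fn (cdim c) (cmap c ` (W \<inter> cdom c)) (\<lambda>x. f (cinv c x))"
  by (simp add: smooth_on_def)

text \<open>\<open>smooth_on\<close> quantifies over all charts, which makes restriction, sums and
  products immediate. Testing in one chart around each point suffices, because any other chart
  differs from it by a smooth transition.\<close>

lemma smooth_on_chartI:
  assumes M: "premanifold M" and W: "mopen M W"
    and loc: "\<And>p. p \<in> W \<Longrightarrow> \<exists>c\<in>atlas M. \<exists>V. p \<in> cdom c \<and> euc_open (cdim c) V \<and> cmap c p \<in> V \<and>
       smooth_fn (cdim c) V (\<lambda>x. f (cinv c x))"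
  shows "smooth_on M W f"
  unfolding smooth_on_def
proof (intro conjI ballI W smooth_fn_local)
  fix c' assume c': "c' \<in> atlas M"
  show "cmap c' ` (W \<inter> cdom c') \<subseteq> euc (cdim c')"
    using chart_euc[OF atlas_chart[OF M c']] by auto
  fix x assume "x \<in> cmap c' ` (W \<inter> cdom c')"
  then obtain p where p: "p \<in> W" "p \<in> cdom c'" "x = cmap c' p" by blast
  obtain c V where c: "c \<in> atlas M" "p \<in> cdom c" and V: "euc_open (cdim c) V" "cmap c p \<in> V"
    "smooth_fn (cdim c) V (\<lambda>x. f (cinv c x))" using loc[OF p(1)] by blast
  note ch = cinv_cmap[OF atlas_chart[OF M c']] cinv_cmap[OF atlas_chart[OF M c(1)]]
  let ?U = "cmap c' ` (cdom c' \<inter> cdom c)"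
  define V' where "V' = {x \<in> ?U. cmap c (cinv c' x) \<in> V}"
  have tr: "euc_open (cdim c') ?U" "euc_smooth (cdim c') ?U (cdim c) (\<lambda>x. cmap c (cinv c' x))"
    using atlas_transition[OF M c' c(1)] unfolding smooth_transition_iff by auto
  have V': "euc_open (cdim c') V'" unfolding V'_def by (rule euc_smooth_vimage_open[OF tr V(1)])
  have "smooth_fn (cdim c') V' (\<lambda>x. f (cinv c (cmap c (cinv c' x))))"
    by (rule smooth_fn_compose[OF V' V(1) _ _ V(3)]) (use euc_smooth_subset[OF tr(2)] in \<open>auto simp: V'_def\<close>)
  then have "smooth_fn (cdim c') V' (\<lambda>x. f (cinv c' x))"
    by (rule smooth_fn_cong[OF V', rotated]) (auto simp: V'_def ch)
  moreover have "x \<in> V'" using p c V ch by (auto simp: V'_def)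
  ultimately show "\<exists>V. euc_open (cdim c') V \<and> x \<in> V \<and> smooth_fn (cdim c') V (\<lambda>x. f (cinv c' x))"
    using V' by blast
qed

lemma smooth_on_subset:
  assumes "smooth_on M W f" "mopen M W'" "W' \<subseteq> W"
  shows "smooth_on M W' f"
  using assms unfolding smooth_on_def by (meson Int_mono smooth_fn_subset image_mono order_refl)

lemma smooth_on_local:
  assumes M: "premanifold M" and "\<And>p. p \<in> W \<Longrightarrow> \<exists>W'. p \<in> W' \<and> W' \<subseteq> W \<and> smooth_on M W' f"
  shows "smooth_on M W f"
proof (rule smooth_on_chartI[OF M])
  show "mopen M W" using mopen_local[of W M] assms(2) smooth_on_mopen by metis
  fix p assume "p \<in> W"
  then obtain W' where W': "p \<in> W'" "W' \<subseteq> W" "smooth_on M W' f" using assms(2) by blast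
  then obtain c where c: "c \<in> atlas M" "p \<in> cdom c"
    using atlas_cover[OF M] smooth_on_mopen mopen_subset by blast
  then show "\<exists>c\<in>atlas M. \<exists>V. p \<in> cdom c \<and> euc_open (cdim c) V \<and> cmap c p \<in> V \<and>
       smooth_fn (cdim c) V (\<lambda>x. f (cinv c x))"
    using W' unfolding smooth_on_def mopen_def
    by (intro bexI[of _ c] exI[of _ "cmap c ` (W' \<inter> cdom c)"]) auto
qed

lemma smooth_on_cong:
  assumes M: "premanifold M" and "smooth_on M W f" "\<And>p. p \<in> W \<Longrightarrow> f p = g p"
  shows "smooth_on M W g"
  unfolding smooth_on_def
proof (intro conjI ballI)
  show "mopen M W" using assms(2) by (rule smooth_on_mopen)
  fix c assume c: "c \<in> atlas M"
  show "smooth_fn (cdim c) (cmap c ` (W \<inter> cdom c)) (\<lambda>x. g (cinv c x))"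
    by (rule smooth_fn_cong[OF _ _ smooth_on_smooth_fn[OF assms(2) c]])
      (use \<open>mopen M W\<close> c assms(3) cinv_cmap[OF atlas_chart[OF M c]] in \<open>auto simp: mopen_def\<close>)
qed

lemma smooth_on_const: "mopen M W \<Longrightarrow> smooth_on M W (\<lambda>_. a)"
  unfolding smooth_on_def by (simp add: smooth_fn_const)

lemma smooth_on_add: "smooth_on M W f \<Longrightarrow> smooth_on M W g \<Longrightarrow> smooth_on M W (\<lambda>p. f p + g p)"
  unfolding smooth_on_def mopen_def by (simp add: smooth_fn_add)

lemma smooth_on_mult: "smooth_on M W f \<Longrightarrow> smooth_on M W g \<Longrightarrow> smooth_on M W (\<lambda>p. f p * g p)"
  unfolding smooth_on_def mopen_def by (simp add: smooth_fn_mult)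

lemma smooth_on_sum:
  assumes "mopen M W" "finite A" "\<And>a. a \<in> A \<Longrightarrow> smooth_on M W (f a)"
  shows "smooth_on M W (\<lambda>p. \<Sum>a\<in>A. f a p)"
  using assms(2,3) by (induction A rule: finite_induct) (auto intro: smooth_on_const[OF assms(1)] smooth_on_add)

lemma smooth_on_coord:
  assumes M: "premanifold M" and "d \<in> atlas M" "i < cdim d"
  shows "smooth_on M (cdom d) (\<lambda>q. cmap d q i)"
  unfolding smooth_on_def
proof (intro conjI ballI)
  show "mopen M (cdom d)" using mopen_cdom assms by blast
  fix c assume "c \<in> atlas M"
  then show "smooth_fn (cdim c) (cmap c ` (cdom d \<inter> cdom c)) (\<lambda>x. cmap d (cinv c x) i)"
    using atlas_transition[OF M _ assms(2)] assms(3)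
    unfolding smooth_transition_iff euc_smooth_iff by (metis Int_commute)
qed

section \<open>Smooth maps between manifolds\<close>

lemma smooth_mapD:
  assumes "smooth_map M N f" "p \<in> carrier M"
  obtains c d where "c \<in> atlas M" "d \<in> atlas N" "p \<in> cdom c" "f ` cdom c \<subseteq> cdom d"
    "euc_smooth (cdim c) (cmap c ` cdom c) (cdim d) (\<lambda>x. cmap d (f (cinv c x)))"
  using assms unfolding smooth_map_def o_def by blast

lemma smooth_map_carrier: "smooth_map M N f \<Longrightarrow> p \<in> carrier M \<Longrightarrow> f p \<in> carrier N"
  unfolding smooth_map_def by blast

text \<open>\<open>smooth_map\<close> offers one pair of charts at \<open>p\<close>, of its own
  choice. Cutting the chart image down to an open \<open>V\<close> accommodates a prescribed open
  set \<open>W\<close> without changing these charts.\<close>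

lemma smooth_map_nbhd:
  assumes M: "premanifold M" and N: "premanifold N" and f: "smooth_map M N f"
    and W: "mopen N W" and p: "p \<in> carrier M" "f p \<in> W"
  obtains c d V where "c \<in> atlas M" "d \<in> atlas N" "p \<in> cdom c" "euc_open (cdim c) V" "cmap c p \<in> V"
    "V \<subseteq> cmap c ` cdom c" "euc_smooth (cdim c) V (cdim d) (\<lambda>x. cmap d (f (cinv c x)))"
    "\<And>q. q \<in> cdom c \<Longrightarrow> cmap c q \<in> V \<Longrightarrow> f q \<in> W \<inter> cdom d"
proof -
  obtain c d where c: "c \<in> atlas M" "d \<in> atlas N" "p \<in> cdom c" "f ` cdom c \<subseteq> cdom d"
    and sm: "euc_smooth (cdim c) (cmap c ` cdom c) (cdim d) (\<lambda>x. cmap d (f (cinv c x)))"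
    using smooth_mapD[OF f p(1)] by blast
  note cc = atlas_chart[OF M c(1)] and dd = atlas_chart[OF N c(2)]
  define V where "V = {x \<in> cmap c ` cdom c. cmap d (f (cinv c x)) \<in> cmap d ` (W \<inter> cdom d)}"
  have V: "euc_open (cdim c) V" unfolding V_def
    by (rule euc_smooth_vimage_open[OF chart_open[OF cc] sm]) (use W c in \<open>auto simp: mopen_def\<close>)
  have mem: "cmap c q \<in> V \<longleftrightarrow> f q \<in> W \<inter> cdom d" if q: "q \<in> cdom c" for q
  proof -
    have "cmap c q \<in> V \<longleftrightarrow> cmap d (f q) \<in> cmap d ` (W \<inter> cdom d)"
      using q by (simp add: V_def cinv_cmap[OF cc])
    also have "\<dots> \<longleftrightarrow> f q \<in> W \<inter> cdom d"
      by (rule chart_image_iff[OF dd]) (use c q in auto)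
    finally show ?thesis .
  qed
  show thesis
  proof (rule that[OF c(1-3) V])
    show "cmap c p \<in> V" using mem p c by auto
    show "V \<subseteq> cmap c ` cdom c" by (auto simp: V_def)
    then show "euc_smooth (cdim c) V (cdim d) (\<lambda>x. cmap d (f (cinv c x)))"
      using euc_smooth_subset[OF sm] by blast
    show "\<And>q. q \<in> cdom c \<Longrightarrow> cmap c q \<in> V \<Longrightarrow> f q \<in> W \<inter> cdom d" using mem by blast
  qed
qed

lemma mopen_vimage:
  assumes M: "premanifold M" and N: "premanifold N" and f: "smooth_map M N f" and W: "mopen N W"
  shows "mopen M {p \<in> carrier M. f p \<in> W}"
proof (rule mopen_chartI[OF M])
  fix p assume "p \<in> {p \<in> carrier M. f p \<in> W}"
  then have p: "p \<in> carrier M" "f p \<in> W" by auto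
  show "\<exists>c\<in>atlas M. \<exists>V. p \<in> cdom c \<and> euc_open (cdim c) V \<and> cmap c p \<in> V \<and>
      (\<forall>q\<in>cdom c. cmap c q \<in> V \<longrightarrow> q \<in> {p \<in> carrier M. f p \<in> W})"
    by (rule smooth_map_nbhd[OF M N f W p]) (use chart_subset[OF atlas_chart[OF M]] in blast)
qed

lemma smooth_on_pullback:
  assumes M: "premanifold M" and N: "premanifold N" and f: "smooth_map M N f" and h: "smooth_on N W h"
  shows "smooth_on M {p \<in> carrier M. f p \<in> W} (\<lambda>p. h (f p))"
proof (rule smooth_on_chartI[OF M mopen_vimage[OF M N f smooth_on_mopen[OF h]]])
  fix p assume "p \<in> {p \<in> carrier M. f p \<in> W}"
  then have p: "p \<in> carrier M" "f p \<in> W" by auto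
  obtain c d V where c: "c \<in> atlas M" "d \<in> atlas N" "p \<in> cdom c"
    and V: "euc_open (cdim c) V" "cmap c p \<in> V" "V \<subseteq> cmap c ` cdom c"
    and sm: "euc_smooth (cdim c) V (cdim d) (\<lambda>x. cmap d (f (cinv c x)))"
    and VW: "\<And>q. q \<in> cdom c \<Longrightarrow> cmap c q \<in> V \<Longrightarrow> f q \<in> W \<inter> cdom d"
    using smooth_map_nbhd[OF M N f smooth_on_mopen[OF h] p] by metis
  note cc = atlas_chart[OF M c(1)] and dd = atlas_chart[OF N c(2)]
  have fV: "f (cinv c x) \<in> W \<inter> cdom d" if x: "x \<in> V" for x
    using V(3) VW x cinv_cmap[OF cc] by force
  have "smooth_fn (cdim c) V (\<lambda>x. h (cinv d (cmap d (f (cinv c x)))))"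
    by (rule smooth_fn_compose[OF V(1) _ sm _ smooth_on_smooth_fn[OF h c(2)]])
      (use smooth_on_mopen[OF h] c(2) fV in \<open>auto simp: mopen_def\<close>)
  then have "smooth_fn (cdim c) V (\<lambda>x. h (f (cinv c x)))"
    by (rule smooth_fn_cong[OF V(1), rotated]) (use fV cinv_cmap[OF dd] in auto)
  then show "\<exists>c\<in>atlas M. \<exists>V. p \<in> cdom c \<and> euc_open (cdim c) V \<and> cmap c p \<in> V \<and>
      smooth_fn (cdim c) V (\<lambda>x. h (f (cinv c x)))"
    using c V by blast
qed

text \<open>\<open>smooth_map\<close> wants a chart whose entire domain is mapped into one chart of
  the target, so charts must be shrunk to open sets. The \<open>restrict\<close> keeps them
  extensional, as \<open>is_chart\<close> demands.\<close>

definition restrict_chart :: "'a chart \<Rightarrow> 'a set \<Rightarrow> 'a chart" where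
  "restrict_chart c W = \<lparr>cdim = cdim c, cdom = W \<inter> cdom c, cmap = restrict (cmap c) (W \<inter> cdom c)\<rparr>"

lemma restrict_chart_simps [simp]:
  "cdim (restrict_chart c W) = cdim c"
  "cdom (restrict_chart c W) = W \<inter> cdom c"
  "p \<in> W \<Longrightarrow> p \<in> cdom c \<Longrightarrow> cmap (restrict_chart c W) p = cmap c p"
  by (auto simp: restrict_chart_def)

lemma restrict_chart_image: "A \<subseteq> W \<inter> cdom c \<Longrightarrow> cmap (restrict_chart c W) ` A = cmap c ` A"
  by (auto simp: restrict_chart_def subset_iff image_iff)

text \<open>Maximality of the atlas admits the restricted chart, because its transitions are
  restrictions of those of \<open>c\<close>.\<close>

lemma restrict_chart_atlas:
  assumes M: "premanifold M" and c: "c \<in> atlas M" and W: "mopen M W"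
  shows "restrict_chart c W \<in> atlas M"
proof (rule atlasI[OF M])
  let ?r = "restrict_chart c W"
  note cc = atlas_chart[OF M c]
  show r: "is_chart (carrier M) ?r"
    using cc W c restrict_chart_image[of "W \<inter> cdom c" W c]
    unfolding is_chart_def mopen_def
    by (auto simp: restrict_chart_def inj_on_def)
  fix d assume d: "d \<in> atlas M"
  note dd = atlas_chart[OF M d]
  have Wd: "mopen M (W \<inter> cdom d)" "mopen M (W \<inter> cdom c)"
    using mopen_Int[OF M W] mopen_cdom[OF M] c d by blast+
  have im: "cmap ?r ` (cdom ?r \<inter> cdom d) = cmap c ` (W \<inter> cdom d \<inter> cdom c)"
    using restrict_chart_image[of "cdom ?r \<inter> cdom d" W c] by (simp add: Int_ac)
  have o: "euc_open (cdim c) (cmap c ` (W \<inter> cdom d \<inter> cdom c))"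
    using Wd(1) c unfolding mopen_def by blast
  have eq: "cinv c x = cinv ?r x" if "x \<in> cmap c ` (W \<inter> cdom d \<inter> cdom c)" for x
    using that cinv_cmap[OF cc] cinv_cmap[OF r] by force
  have "euc_smooth (cdim c) (cmap c ` (W \<inter> cdom d \<inter> cdom c)) (cdim d) (\<lambda>x. cmap d (cinv ?r x))"
  proof (rule euc_smooth_cong[OF o])
    show "euc_smooth (cdim c) (cmap c ` (W \<inter> cdom d \<inter> cdom c)) (cdim d) (\<lambda>x. cmap d (cinv c x))"
      using atlas_transition[OF M c d] unfolding smooth_transition_iff
      by (meson Int_lower2 Int_mono euc_smooth_subset image_mono inf.boundedI inf_le1 le_infI1)
  qed (simp add: eq)
  then show "smooth_transition ?r d" using o unfolding smooth_transition_iff im by simp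
  have im': "cdom d \<inter> cdom ?r = W \<inter> cdom c \<inter> cdom d" by auto
  have o': "euc_open (cdim d) (cmap d ` (W \<inter> cdom c \<inter> cdom d))"
    using Wd(2) d unfolding mopen_def by blast
  have "euc_smooth (cdim d) (cmap d ` (W \<inter> cdom c \<inter> cdom d)) (cdim c) (\<lambda>x. cmap ?r (cinv d x))"
  proof (rule euc_smooth_cong[OF o'])
    show "euc_smooth (cdim d) (cmap d ` (W \<inter> cdom c \<inter> cdom d)) (cdim c) (\<lambda>x. cmap c (cinv d x))"
      using atlas_transition[OF M d c] unfolding smooth_transition_iff
      by (elim conjE euc_smooth_subset) auto
    show "cmap c (cinv d x) = cmap ?r (cinv d x)" if "x \<in> cmap d ` (W \<inter> cdom c \<inter> cdom d)" for x
      using that cinv_cmap[OF dd] by auto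
  qed
  then show "smooth_transition d ?r" using o' unfolding smooth_transition_iff im' by simp
qed

text \<open>A chart around \<open>p\<close>, restricted to \<open>W\<close>, has its whole domain
  mapped into \<open>cdom d\<close>. Together with \<open>smooth_on_pullback\<close> this criterion
  reduces smoothness of maps to smoothness of real functions.\<close>

lemma smooth_mapI:
  assumes M: "premanifold M" and N: "premanifold N"
    and f: "\<And>p. p \<in> carrier M \<Longrightarrow> f p \<in> carrier N"
    and loc: "\<And>p. p \<in> carrier M \<Longrightarrow> \<exists>W. \<exists>d\<in>atlas N. p \<in> W \<and> mopen M W \<and> f ` W \<subseteq> cdom d \<and>
       (\<forall>i<cdim d. smooth_on M W (\<lambda>p. cmap d (f p) i))"
  shows "smooth_map M N f"
  unfolding smooth_map_def o_def
proof (intro conjI ballI)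
  show "f \<in> carrier M \<rightarrow> carrier N" using f by blast
  fix p assume p: "p \<in> carrier M"
  obtain W d where d: "d \<in> atlas N" "p \<in> W" "mopen M W" "f ` W \<subseteq> cdom d"
    "\<And>i. i < cdim d \<Longrightarrow> smooth_on M W (\<lambda>p. cmap d (f p) i)" using loc[OF p] by blast
  obtain c where c: "c \<in> atlas M" "p \<in> cdom c" using atlas_cover[OF M p] by blast
  let ?r = "restrict_chart c W"
  have r: "?r \<in> atlas M" by (rule restrict_chart_atlas[OF M c(1) d(3)])
  have "euc_smooth (cdim ?r) (cmap ?r ` cdom ?r) (cdim d) (\<lambda>x. cmap d (f (cinv ?r x)))"
    unfolding euc_smooth_iff
  proof (intro conjI allI impI)
    show "(\<lambda>x. cmap d (f (cinv ?r x))) ` cmap ?r ` cdom ?r \<subseteq> euc (cdim d)"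
      using cinv_cmap[OF atlas_chart[OF M r]] chart_euc[OF atlas_chart[OF N d(1)]] d(4)
      by (auto simp: image_subset_iff)
    fix i assume "i < cdim d"
    from smooth_on_smooth_fn[OF d(5)[OF this] r]
    show "smooth_fn (cdim ?r) (cmap ?r ` cdom ?r) (\<lambda>x. cmap d (f (cinv ?r x)) i)"
      by (simp add: Int_absorb1)
  qed
  moreover have "p \<in> cdom ?r" "f ` cdom ?r \<subseteq> cdom d" using c d by auto
  ultimately show "\<exists>c\<in>atlas M. \<exists>d\<in>atlas N. p \<in> cdom c \<and> f ` cdom c \<subseteq> cdom d \<and>
        euc_smooth (cdim c) (cmap c ` cdom c) (cdim d) (\<lambda>x. cmap d (f (cinv c x)))"
    using r d(1) by blast
qed

text \<open>The coordinates on \<open>P\<close> are pulled back twice as real functions, so charts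
  on the middle manifold never have to be matched.\<close>

lemma smooth_map_compose:
  assumes M: "premanifold M" and N: "premanifold N" and P: "premanifold P"
    and f: "smooth_map M N f" and g: "smooth_map N P g"
  shows "smooth_map M P (\<lambda>p. g (f p))"
proof (rule smooth_mapI[OF M P])
  show gf: "g (f p) \<in> carrier P" if "p \<in> carrier M" for p
    using that f g smooth_map_carrier by metis
  fix p assume p: "p \<in> carrier M"
  obtain d where d: "d \<in> atlas P" "g (f p) \<in> cdom d" using atlas_cover[OF P gf[OF p]] by blast
  let ?W = "{p \<in> carrier M. f p \<in> {q \<in> carrier N. g q \<in> cdom d}}"
  have "mopen M ?W" by (intro mopen_vimage[OF M N f] mopen_vimage[OF N P g] mopen_cdom[OF P d(1)])
  moreover have "smooth_on M ?W (\<lambda>p. cmap d (g (f p)) i)" if "i < cdim d" for i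
    using smooth_on_pullback[OF M N f smooth_on_pullback[OF N P g smooth_on_coord[OF P d(1) that]]] .
  moreover have "p \<in> ?W" using p d f smooth_map_carrier by fastforce
  ultimately show "\<exists>W. \<exists>d\<in>atlas P. p \<in> W \<and> mopen M W \<and> (\<lambda>p. g (f p)) ` W \<subseteq> cdom d \<and>
       (\<forall>i<cdim d. smooth_on M W (\<lambda>p. cmap d (g (f p)) i))"
    using d(1) by (intro exI[of _ ?W] bexI[of _ d]) auto
qed

lemma smooth_map_id:
  assumes "premanifold M"
  shows "smooth_map M M (\<lambda>p. p)"
proof (rule smooth_mapI[OF assms assms])
  fix p assume "p \<in> carrier M"
  then obtain d where "d \<in> atlas M" "p \<in> cdom d" using atlas_cover[OF assms] by blast
  then show "\<exists>W. \<exists>d\<in>atlas M. p \<in> W \<and> mopen M W \<and> (\<lambda>p. p) ` W \<subseteq> cdom d \<and>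
       (\<forall>i<cdim d. smooth_on M W (\<lambda>p. cmap d p i))"
    using mopen_cdom[OF assms] smooth_on_coord[OF assms] by (intro exI[of _ "cdom d"] bexI[of _ d]) auto
qed

lemma smooth_map_const:
  assumes M: "premanifold M" and N: "premanifold N" and "q \<in> carrier N"
  shows "smooth_map M N (\<lambda>p. q)"
proof (rule smooth_mapI[OF M N])
  obtain d where "d \<in> atlas N" "q \<in> cdom d" using atlas_cover[OF N assms(3)] by blast
  then show "\<exists>W. \<exists>d\<in>atlas N. p \<in> W \<and> mopen M W \<and> (\<lambda>p. q) ` W \<subseteq> cdom d \<and>
       (\<forall>i<cdim d. smooth_on M W (\<lambda>p. cmap d q i))" if "p \<in> carrier M" for p
    using mopen_carrier[OF M] smooth_on_const that by (intro exI[of _ "carrier M"] bexI[of _ d]) auto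
qed (rule assms)

lemma smooth_map_cong:
  assumes M: "premanifold M" and N: "premanifold N" and f: "smooth_map M N f"
    and eq: "\<And>p. p \<in> carrier M \<Longrightarrow> f p = g p"
  shows "smooth_map M N g"
proof (rule smooth_mapI[OF M N])
  show "g p \<in> carrier N" if "p \<in> carrier M" for p
    using smooth_map_carrier[OF f that] eq[OF that] by simp
  fix p assume p: "p \<in> carrier M"
  obtain d where d: "d \<in> atlas N" "f p \<in> cdom d" using atlas_cover[OF N smooth_map_carrier[OF f p]] by blast
  let ?W = "{p \<in> carrier M. f p \<in> cdom d}"
  have "smooth_on M ?W (\<lambda>p. cmap d (g p) i)" if "i < cdim d" for i
    by (rule smooth_on_cong[OF M smooth_on_pullback[OF M N f smooth_on_coord[OF N d(1) that]]]) (simp add: eq)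
  then show "\<exists>W. \<exists>d\<in>atlas N. p \<in> W \<and> mopen M W \<and> g ` W \<subseteq> cdom d \<and>
       (\<forall>i<cdim d. smooth_on M W (\<lambda>p. cmap d (g p) i))"
    using d p mopen_vimage[OF M N f mopen_cdom[OF N d(1)]] eq
    by (intro exI[of _ ?W] bexI[of _ d]) auto
qed

section \<open>Generated atlases, products and open submanifolds\<close>

lemma smooth_transition_local:
  assumes d: "is_chart S d"
    and loc: "\<And>p. p \<in> cdom c \<Longrightarrow> p \<in> cdom d \<Longrightarrow> \<exists>V. euc_open (cdim c) V \<and> cmap c p \<in> V \<and>
       V \<subseteq> cmap c ` (cdom c \<inter> cdom d) \<and> euc_smooth (cdim c) V (cdim d) (\<lambda>x. cmap d (cinv c x))"
  shows "smooth_transition c d"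
  unfolding smooth_transition_iff euc_smooth_iff
proof (intro conjI allI impI)
  let ?U = "cmap c ` (cdom c \<inter> cdom d)"
  have loc': "\<exists>V. euc_open (cdim c) V \<and> x \<in> V \<and> V \<subseteq> ?U \<and> euc_smooth (cdim c) V (cdim d) (\<lambda>x. cmap d (cinv c x))"
    if x: "x \<in> ?U" for x
    using loc x by blast
  then show o: "euc_open (cdim c) ?U" by (intro euc_open_local) blast
  show "(\<lambda>x. cmap d (cinv c x)) ` ?U \<subseteq> euc (cdim d)"
    using loc' unfolding euc_smooth_iff by blast
  fix j assume "j < cdim d"
  then show "smooth_fn (cdim c) ?U (\<lambda>x. cmap d (cinv c x) j)"
    using loc' euc_open_subset[OF o] unfolding euc_smooth_iff by (intro smooth_fn_local) blast+
qed

text \<open>Near a common point both charts are compared with a member \<open>a\<close> of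
  \<open>A\<close>, and the transition factors through \<open>a\<close>.\<close>

lemma max_atlas_transition:
  assumes A: "\<Union>(cdom ` A) = S" "\<And>a. a \<in> A \<Longrightarrow> is_chart S a"
    and c: "c \<in> max_atlas S A" and d: "d \<in> max_atlas S A"
  shows "smooth_transition c d"
proof (rule smooth_transition_local)
  show d': "is_chart S d" using d unfolding max_atlas_def by blast
  have c': "is_chart S c" using c unfolding max_atlas_def by blast
  fix p assume p: "p \<in> cdom c" "p \<in> cdom d"
  then obtain a where a: "a \<in> A" "p \<in> cdom a" using A(1) chart_subset[OF c'] by blast
  note aa = A(2)[OF a(1)]
  let ?U = "cmap c ` (cdom c \<inter> cdom a)" and ?T = "cmap a ` (cdom a \<inter> cdom d)"
  have ca: "euc_open (cdim c) ?U" "euc_smooth (cdim c) ?U (cdim a) (\<lambda>x. cmap a (cinv c x))"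
    and ad: "euc_open (cdim a) ?T" "euc_smooth (cdim a) ?T (cdim d) (\<lambda>x. cmap d (cinv a x))"
    using c d a(1) unfolding max_atlas_def smooth_transition_iff by auto
  define V where "V = {x \<in> ?U. cmap a (cinv c x) \<in> ?T}"
  have V: "euc_open (cdim c) V" unfolding V_def by (rule euc_smooth_vimage_open[OF ca ad(1)])
  have Vd: "cinv c x \<in> cdom a \<inter> cdom d \<and> x \<in> cmap c ` (cdom c \<inter> cdom d)" if x: "x \<in> V" for x
  proof -
    obtain q where q: "q \<in> cdom c" "q \<in> cdom a" "x = cmap c q" using x unfolding V_def by blast
    then have "cmap a q \<in> ?T" using x cinv_cmap[OF c'] by (simp add: V_def)
    then have "q \<in> cdom d" using chart_image_iff[OF aa q(2), of "cdom a \<inter> cdom d"] by auto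
    then show ?thesis using q cinv_cmap[OF c'] by auto
  qed
  have "euc_smooth (cdim c) V (cdim d) (\<lambda>x. cmap d (cinv a (cmap a (cinv c x))))"
    by (rule euc_smooth_compose[OF V ad(1) _ _ ad(2)])
      (use euc_smooth_subset[OF ca(2)] in \<open>auto simp: V_def\<close>)
  then have "euc_smooth (cdim c) V (cdim d) (\<lambda>x. cmap d (cinv c x))"
    by (rule euc_smooth_cong[OF V, rotated]) (use Vd cinv_cmap[OF aa] in auto)
  moreover have "cmap c p \<in> V"
    using p a cinv_cmap[OF c'] by (auto simp: V_def)
  ultimately show "\<exists>V. euc_open (cdim c) V \<and> cmap c p \<in> V \<and>
       V \<subseteq> cmap c ` (cdom c \<inter> cdom d) \<and> euc_smooth (cdim c) V (cdim d) (\<lambda>x. cmap d (cinv c x))"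
    using V Vd by blast
qed

lemma premanifold_max_atlas:
  assumes M: "carrier M = S" "atlas M = max_atlas S A"
    and A: "\<Union>(cdom ` A) = S" "\<And>a. a \<in> A \<Longrightarrow> is_chart S a"
    and tr: "\<And>a b. a \<in> A \<Longrightarrow> b \<in> A \<Longrightarrow> smooth_transition a b"
  shows "premanifold M" "A \<subseteq> atlas M"
proof -
  show sub: "A \<subseteq> atlas M" using A(2) tr unfolding M max_atlas_def by blast
  have "\<Union>(cdom ` atlas M) \<subseteq> S" unfolding M max_atlas_def using chart_subset by blast
  then have "\<Union>(cdom ` atlas M) = S" using A(1) sub by blast
  moreover have "atlas M \<subseteq> max_atlas S (atlas M)"
  proof
    fix c assume c: "c \<in> atlas M"
    then have "is_chart S c" by (simp add: M max_atlas_def)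
    moreover have "smooth_transition c d \<and> smooth_transition d c" if "d \<in> atlas M" for d
      using max_atlas_transition[OF A] c that unfolding M(2) by blast
    ultimately show "c \<in> max_atlas S (atlas M)" by (simp add: max_atlas_def)
  qed
  moreover have "max_atlas S (atlas M) \<subseteq> max_atlas S A" using sub unfolding max_atlas_def by blast
  ultimately show "premanifold M" unfolding premanifold_def using M by auto
qed

section \<open>Products of manifolds\<close>

definition take_vec :: "nat \<Rightarrow> (nat \<Rightarrow> real) \<Rightarrow> nat \<Rightarrow> real" where
  "take_vec n x = (\<lambda>i. if i < n then x i else 0)"

definition drop_vec :: "nat \<Rightarrow> (nat \<Rightarrow> real) \<Rightarrow> nat \<Rightarrow> real" where
  "drop_vec n x = (\<lambda>i. x (i + n))"

lemma append_take_drop [simp]: "append_vec n (take_vec n x) (drop_vec n x) = x"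
  by (auto simp: append_vec_def take_vec_def drop_vec_def fun_eq_iff)

lemma take_append: "x \<in> euc n \<Longrightarrow> take_vec n (append_vec n x y) = x"
  by (auto simp: append_vec_def take_vec_def euc_def fun_eq_iff)

lemma drop_append [simp]: "drop_vec n (append_vec n x y) = y"
  by (auto simp: append_vec_def drop_vec_def fun_eq_iff)

lemma append_euc: "y \<in> euc m \<Longrightarrow> append_vec n x y \<in> euc (n + m)"
  by (auto simp: append_vec_def euc_def)

lemma take_euc: "take_vec n x \<in> euc n"
  by (auto simp: take_vec_def euc_def)

lemma drop_euc: "x \<in> euc (n + m) \<Longrightarrow> drop_vec n x \<in> euc m"
  by (auto simp: drop_vec_def euc_def)

lemma euc_smooth_take:
  assumes "euc_open (n + m) U"
  shows "euc_smooth (n + m) U n (take_vec n)"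
  unfolding euc_smooth_iff using take_euc assms
  by (auto simp: take_vec_def intro: smooth_fn_coord)

lemma euc_smooth_drop:
  assumes "euc_open (n + m) U"
  shows "euc_smooth (n + m) U m (drop_vec n)"
  unfolding euc_smooth_iff using drop_euc euc_open_subset[OF assms] assms
  by (auto simp: drop_vec_def intro: smooth_fn_coord)

text \<open>Describing a product by conditions on its two blocks of coordinates turns openness into
  openness of preimages under \<open>take_vec\<close> and \<open>drop_vec\<close>.\<close>

lemma append_image:
  assumes "A \<subseteq> euc n" "B \<subseteq> euc m"
  shows "(\<lambda>(x, y). append_vec n x y) ` (A \<times> B) = {z \<in> euc (n + m). take_vec n z \<in> A \<and> drop_vec n z \<in> B}"
    (is "?L = ?R")
proof
  show "?L \<subseteq> ?R"
  proof
    fix z assume "z \<in> ?L"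
    then obtain x y where xy: "x \<in> A" "y \<in> B" "z = append_vec n x y" by auto
    then have "x \<in> euc n" "y \<in> euc m" using assms by auto
    then show "z \<in> ?R" using xy append_euc take_append by simp
  qed
  show "?R \<subseteq> ?L"
  proof
    fix z assume "z \<in> ?R"
    then have "z = (\<lambda>(x, y). append_vec n x y) (take_vec n z, drop_vec n z)"
      "(take_vec n z, drop_vec n z) \<in> A \<times> B" by auto
    then show "z \<in> ?L" by (rule image_eqI)
  qed
qed

lemma append_image_open:
  assumes "euc_open n A" "euc_open m B"
  shows "euc_open (n + m) ((\<lambda>(x, y). append_vec n x y) ` (A \<times> B))"
proof -
  have "{z \<in> euc (n + m). take_vec n z \<in> A \<and> drop_vec n z \<in> B} =
      {z \<in> euc (n + m). take_vec n z \<in> A} \<inter> {z \<in> euc (n + m). drop_vec n z \<in> B}" by auto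
  moreover have "euc_open (n + m) {z \<in> euc (n + m). take_vec n z \<in> A}"
    by (rule euc_smooth_vimage_open[OF euc_open_euc euc_smooth_take[OF euc_open_euc] assms(1)])
  moreover have "euc_open (n + m) {z \<in> euc (n + m). drop_vec n z \<in> B}"
    by (rule euc_smooth_vimage_open[OF euc_open_euc euc_smooth_drop[OF euc_open_euc] assms(2)])
  ultimately show ?thesis
    using append_image[OF assms[THEN euc_open_subset]] by (simp add: euc_open_Int)
qed

lemma euc_smooth_append:
  assumes "euc_smooth k U n F" "euc_smooth k U m H"
  shows "euc_smooth k U (n + m) (\<lambda>x. append_vec n (F x) (H x))"
proof -
  have "smooth_fn k U (\<lambda>x. append_vec n (F x) (H x) j)" if "j < n + m" for j
    using assms that by (cases "j < n") (auto simp: append_vec_def euc_smooth_iff)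
  then show ?thesis using assms append_euc unfolding euc_smooth_iff by (auto simp: image_subset_iff)
qed

lemma prod_chart_simps [simp]:
  "cdim (prod_chart c d) = cdim c + cdim d"
  "cdom (prod_chart c d) = cdom c \<times> cdom d"
  "p \<in> cdom c \<Longrightarrow> q \<in> cdom d \<Longrightarrow> cmap (prod_chart c d) (p, q) = append_vec (cdim c) (cmap c p) (cmap d q)"
  by (auto simp: prod_chart_def)

lemma prod_chart_image:
  "A \<subseteq> cdom c \<Longrightarrow> B \<subseteq> cdom d \<Longrightarrow>
   cmap (prod_chart c d) ` (A \<times> B) = (\<lambda>(x, y). append_vec (cdim c) x y) ` (cmap c ` A \<times> cmap d ` B)"
  by (force simp: image_iff)

lemma is_chart_prod:
  assumes c: "is_chart S c" and d: "is_chart T d"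
  shows "is_chart (S \<times> T) (prod_chart c d)"
proof -
  have "inj_on (cmap (prod_chart c d)) (cdom c \<times> cdom d)"
  proof (rule inj_onI)
    fix x y assume xy: "x \<in> cdom c \<times> cdom d" "y \<in> cdom c \<times> cdom d"
      and eq: "cmap (prod_chart c d) x = cmap (prod_chart c d) y"
    obtain p q p' q' where x: "x = (p, q)" and y: "y = (p', q')" by fastforce
    then have *: "append_vec (cdim c) (cmap c p) (cmap d q) = append_vec (cdim c) (cmap c p') (cmap d q')"
      and m: "p \<in> cdom c" "q \<in> cdom d" "p' \<in> cdom c" "q' \<in> cdom d"
      using xy eq by auto
    have "cmap c p = cmap c p'"
      using arg_cong[OF *, of "take_vec (cdim c)"] take_append[OF chart_euc[OF c]] m by simp
    moreover have "cmap d q = cmap d q'" using arg_cong[OF *, of "drop_vec (cdim c)"] by simp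
    ultimately have "p = p'" "q = q'" using m c d by (auto simp: is_chart_def dest: inj_onD)
    then show "x = y" using x y by simp
  qed
  moreover have "cmap (prod_chart c d) \<in> extensional (cdom c \<times> cdom d)"
    by (simp add: prod_chart_def)
  moreover have "euc_open (cdim c + cdim d) (cmap (prod_chart c d) ` (cdom c \<times> cdom d))"
    using append_image_open[OF chart_open[OF c] chart_open[OF d]] by (simp add: prod_chart_image)
  ultimately show ?thesis
    using chart_subset[OF c] chart_subset[OF d] unfolding is_chart_def by auto
qed

lemma smooth_transition_prod:
  assumes c: "is_chart S c" "is_chart S c'" and d: "is_chart T d" "is_chart T d'"
    and "smooth_transition c c'" "smooth_transition d d'"
  shows "smooth_transition (prod_chart c d) (prod_chart c' d')"
proof -
  let ?A = "cmap c ` (cdom c \<inter> cdom c')" and ?B = "cmap d ` (cdom d \<inter> cdom d')"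
  let ?U = "(\<lambda>(x, y). append_vec (cdim c) x y) ` (?A \<times> ?B)"
  have A: "euc_open (cdim c) ?A" "euc_smooth (cdim c) ?A (cdim c') (\<lambda>x. cmap c' (cinv c x))"
    and B: "euc_open (cdim d) ?B" "euc_smooth (cdim d) ?B (cdim d') (\<lambda>x. cmap d' (cinv d x))"
    using assms unfolding smooth_transition_iff by auto
  have U: "cmap (prod_chart c d) ` (cdom (prod_chart c d) \<inter> cdom (prod_chart c' d')) = ?U"
    using prod_chart_image[of "cdom c \<inter> cdom c'" c "cdom d \<inter> cdom d'" d] by (simp add: Times_Int_Times)
  have o: "euc_open (cdim c + cdim d) ?U" by (rule append_image_open[OF A(1) B(1)])
  have mem: "take_vec (cdim c) ` ?U \<subseteq> ?A" "drop_vec (cdim c) ` ?U \<subseteq> ?B"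
    using append_image[OF euc_open_subset[OF A(1)] euc_open_subset[OF B(1)]] by auto
  have "euc_smooth (cdim c + cdim d) ?U (cdim c' + cdim d')
      (\<lambda>x. append_vec (cdim c') (cmap c' (cinv c (take_vec (cdim c) x))) (cmap d' (cinv d (drop_vec (cdim c) x))))"
    by (intro euc_smooth_append euc_smooth_compose[OF o A(1) euc_smooth_take[OF o] mem(1) A(2)]
        euc_smooth_compose[OF o B(1) euc_smooth_drop[OF o] mem(2) B(2)])
  then have "euc_smooth (cdim c + cdim d) ?U (cdim c' + cdim d')
      (\<lambda>x. cmap (prod_chart c' d') (cinv (prod_chart c d) x))"
  proof (rule euc_smooth_cong[OF o, rotated])
    fix x assume "x \<in> ?U"
    then obtain p q where pq: "p \<in> cdom c" "p \<in> cdom c'" "q \<in> cdom d" "q \<in> cdom d'"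
      and x: "x = append_vec (cdim c) (cmap c p) (cmap d q)" by auto
    show "append_vec (cdim c') (cmap c' (cinv c (take_vec (cdim c) x))) (cmap d' (cinv d (drop_vec (cdim c) x))) =
        cmap (prod_chart c' d') (cinv (prod_chart c d) x)"
      unfolding x using pq cinv_cmap[OF is_chart_prod[OF c(1) d(1)], of "(p, q)"]
      by (simp add: take_append[OF chart_euc[OF c(1)]] cinv_cmap[OF c(1)] cinv_cmap[OF d(1)])
  qed
  then show ?thesis unfolding smooth_transition_iff U using o by simp
qed

lemma carrier_prod_manifold [simp]: "carrier (prod_manifold M N) = carrier M \<times> carrier N"
  by (simp add: prod_manifold_def)

lemma premanifold_prod:
  assumes M: "premanifold M" and N: "premanifold N"
  shows "premanifold (prod_manifold M N)"
    and "\<And>c d. c \<in> atlas M \<Longrightarrow> d \<in> atlas N \<Longrightarrow> prod_chart c d \<in> atlas (prod_manifold M N)"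
proof -
  let ?A = "{prod_chart c d |c d. c \<in> atlas M \<and> d \<in> atlas N}"
  have *: "carrier (prod_manifold M N) = carrier M \<times> carrier N"
    "atlas (prod_manifold M N) = max_atlas (carrier M \<times> carrier N) ?A"
    by (simp_all add: prod_manifold_def)
  have "\<Union>(cdom ` ?A) = carrier M \<times> carrier N"
  proof
    show "\<Union>(cdom ` ?A) \<subseteq> carrier M \<times> carrier N"
      using chart_subset[OF atlas_chart[OF M]] chart_subset[OF atlas_chart[OF N]] by fastforce
    show "carrier M \<times> carrier N \<subseteq> \<Union>(cdom ` ?A)"
    proof
      fix x assume "x \<in> carrier M \<times> carrier N"
      then obtain c d where "c \<in> atlas M" "d \<in> atlas N" "x \<in> cdom c \<times> cdom d"
        using atlas_cover[OF M] atlas_cover[OF N] by force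
      then show "x \<in> \<Union>(cdom ` ?A)" by (intro UN_I[of "prod_chart c d"]) auto
    qed
  qed
  moreover have "is_chart (carrier M \<times> carrier N) a" if "a \<in> ?A" for a
    using that is_chart_prod[OF atlas_chart[OF M] atlas_chart[OF N]] by auto
  moreover have "smooth_transition a b" if ab: "a \<in> ?A" "b \<in> ?A" for a b
  proof -
    obtain c d where "c \<in> atlas M" "d \<in> atlas N" "a = prod_chart c d" using ab(1) by blast
    moreover obtain c' d' where "c' \<in> atlas M" "d' \<in> atlas N" "b = prod_chart c' d'" using ab(2) by blast
    ultimately show ?thesis
      using smooth_transition_prod[OF atlas_chart[OF M] atlas_chart[OF M] atlas_chart[OF N] atlas_chart[OF N]
          atlas_transition[OF M] atlas_transition[OF N]] by simp
  qed
  ultimately have "premanifold (prod_manifold M N)" "?A \<subseteq> atlas (prod_manifold M N)"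
    using premanifold_max_atlas[OF *] by blast+
  then show "premanifold (prod_manifold M N)"
    "\<And>c d. c \<in> atlas M \<Longrightarrow> d \<in> atlas N \<Longrightarrow> prod_chart c d \<in> atlas (prod_manifold M N)" by blast+
qed

lemma smooth_map_fst:
  assumes M: "premanifold M" and N: "premanifold N"
  shows "smooth_map (prod_manifold M N) M fst"
proof (rule smooth_mapI[OF premanifold_prod(1)[OF M N] M])
  fix p assume "p \<in> carrier (prod_manifold M N)"
  then obtain c d where cd: "c \<in> atlas M" "d \<in> atlas N" "p \<in> cdom c \<times> cdom d"
    using atlas_cover[OF M] atlas_cover[OF N] by force
  let ?W = "cdom (prod_chart c d)"
  note pc = premanifold_prod(2)[OF M N cd(1,2)] and pm = premanifold_prod(1)[OF M N]
  have "smooth_on (prod_manifold M N) ?W (\<lambda>p. cmap c (fst p) i)" if "i < cdim c" for i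
    by (rule smooth_on_cong[OF pm smooth_on_coord[OF pm pc, of i]]) (use that in \<open>auto simp: append_vec_def\<close>)
  then show "\<exists>W. \<exists>d\<in>atlas M. p \<in> W \<and> mopen (prod_manifold M N) W \<and> fst ` W \<subseteq> cdom d \<and>
       (\<forall>i<cdim d. smooth_on (prod_manifold M N) W (\<lambda>p. cmap d (fst p) i))"
    using cd mopen_cdom[OF pm pc] by (intro exI[of _ ?W] bexI[of _ c]) auto
qed auto

lemma smooth_map_snd:
  assumes M: "premanifold M" and N: "premanifold N"
  shows "smooth_map (prod_manifold M N) N snd"
proof (rule smooth_mapI[OF premanifold_prod(1)[OF M N] N])
  fix p assume "p \<in> carrier (prod_manifold M N)"
  then obtain c d where cd: "c \<in> atlas M" "d \<in> atlas N" "p \<in> cdom c \<times> cdom d"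
    using atlas_cover[OF M] atlas_cover[OF N] by force
  let ?W = "cdom (prod_chart c d)"
  note pc = premanifold_prod(2)[OF M N cd(1,2)] and pm = premanifold_prod(1)[OF M N]
  have "smooth_on (prod_manifold M N) ?W (\<lambda>p. cmap d (snd p) i)" if "i < cdim d" for i
    by (rule smooth_on_cong[OF pm smooth_on_coord[OF pm pc, of "cdim c + i"]]) (use that in \<open>auto simp: append_vec_def\<close>)
  then show "\<exists>W. \<exists>d\<in>atlas N. p \<in> W \<and> mopen (prod_manifold M N) W \<and> snd ` W \<subseteq> cdom d \<and>
       (\<forall>i<cdim d. smooth_on (prod_manifold M N) W (\<lambda>p. cmap d (snd p) i))"
    using cd mopen_cdom[OF pm pc] by (intro exI[of _ ?W] bexI[of _ d]) auto
qed auto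

lemma smooth_map_Pair:
  assumes P: "premanifold P" and M: "premanifold M" and N: "premanifold N"
    and f: "smooth_map P M f" and g: "smooth_map P N g"
  shows "smooth_map P (prod_manifold M N) (\<lambda>p. (f p, g p))"
proof (rule smooth_mapI[OF P premanifold_prod(1)[OF M N]])
  show "(f p, g p) \<in> carrier (prod_manifold M N)" if "p \<in> carrier P" for p
    using smooth_map_carrier[OF f that] smooth_map_carrier[OF g that] by simp
  fix p assume p: "p \<in> carrier P"
  obtain c d where cd: "c \<in> atlas M" "d \<in> atlas N" "f p \<in> cdom c" "g p \<in> cdom d"
    using atlas_cover[OF M smooth_map_carrier[OF f p]] atlas_cover[OF N smooth_map_carrier[OF g p]] by blast
  let ?W1 = "{p \<in> carrier P. f p \<in> cdom c}" and ?W2 = "{p \<in> carrier P. g p \<in> cdom d}"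
  have W: "mopen P (?W1 \<inter> ?W2)"
    by (intro mopen_Int[OF P] mopen_vimage[OF P M f] mopen_vimage[OF P N g] mopen_cdom M N cd)
  have "smooth_on P (?W1 \<inter> ?W2) (\<lambda>p. cmap (prod_chart c d) (f p, g p) i)" if i: "i < cdim c + cdim d" for i
  proof (cases "i < cdim c")
    case True
    have "smooth_on P (?W1 \<inter> ?W2) (\<lambda>p. cmap c (f p) i)"
      by (rule smooth_on_subset[OF smooth_on_pullback[OF P M f smooth_on_coord[OF M cd(1) True]] W]) auto
    then show ?thesis by (rule smooth_on_cong[OF P]) (use True in \<open>auto simp: append_vec_def\<close>)
  next
    case False
    then have i': "i - cdim c < cdim d" using i by auto
    have "smooth_on P (?W1 \<inter> ?W2) (\<lambda>p. cmap d (g p) (i - cdim c))"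
      by (rule smooth_on_subset[OF smooth_on_pullback[OF P N g smooth_on_coord[OF N cd(2) i']] W]) auto
    then show ?thesis by (rule smooth_on_cong[OF P]) (use False in \<open>auto simp: append_vec_def\<close>)
  qed
  then show "\<exists>W. \<exists>e\<in>atlas (prod_manifold M N). p \<in> W \<and> mopen P W \<and> (\<lambda>p. (f p, g p)) ` W \<subseteq> cdom e \<and>
       (\<forall>i<cdim e. smooth_on P W (\<lambda>p. cmap e (f p, g p) i))"
    using cd W p premanifold_prod(2)[OF M N cd(1,2)]
    by (intro exI[of _ "?W1 \<inter> ?W2"] bexI[of _ "prod_chart c d"]) auto
qed

section \<open>Open submanifolds\<close>

lemma carrier_open_submanifold [simp]: "carrier (open_submanifold M U) = U"
  and atlas_open_submanifold [simp]: "atlas (open_submanifold M U) = {c \<in> atlas M. cdom c \<subseteq> U}"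
  by (simp_all add: open_submanifold_def)

lemma open_submanifold_cover:
  assumes "premanifold M" "mopen M U" "c \<in> atlas M"
  shows "restrict_chart c U \<in> atlas (open_submanifold M U)"
  using restrict_chart_atlas[OF assms(1,3,2)] by simp

lemma premanifold_open_submanifold:
  assumes M: "premanifold M" and U: "mopen M U"
  shows "premanifold (open_submanifold M U)"
  unfolding premanifold_def
proof
  let ?N = "open_submanifold M U"
  show "\<Union>(cdom ` atlas ?N) = carrier ?N"
  proof
    show "carrier ?N \<subseteq> \<Union>(cdom ` atlas ?N)"
    proof
      fix p assume "p \<in> carrier ?N"
      then obtain c where "c \<in> atlas M" "p \<in> cdom (restrict_chart c U)"
        using atlas_cover[OF M] mopen_subset[OF U] by auto
      then show "p \<in> \<Union>(cdom ` atlas ?N)" using open_submanifold_cover[OF M U] by blast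
    qed
  qed auto
  show "atlas ?N = max_atlas (carrier ?N) (atlas ?N)"
  proof
    show "atlas ?N \<subseteq> max_atlas (carrier ?N) (atlas ?N)"
      using atlas_transition[OF M] atlas_chart[OF M] by (auto simp: max_atlas_def is_chart_def)
    show "max_atlas (carrier ?N) (atlas ?N) \<subseteq> atlas ?N"
    proof
      fix c assume c: "c \<in> max_atlas (carrier ?N) (atlas ?N)"
      then have cU: "is_chart U c" by (simp add: max_atlas_def)
      \<comment> \<open>Here \<open>c\<close> is only known to be compatible with charts inside
        \<open>U\<close>. As \<open>cdom c\<close> lies in \<open>U\<close>, replacing a chart
        \<open>d\<close> of \<open>M\<close> by its restriction to \<open>U\<close> does not change
        the transitions with \<open>c\<close>.\<close>
      have "c \<in> atlas M"
      proof (rule atlasI[OF M])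
        show "is_chart (carrier M) c" using cU mopen_subset[OF U] by (auto simp: is_chart_def)
        fix d assume d: "d \<in> atlas M"
        let ?r = "restrict_chart d U"
        note dd = atlas_chart[OF M d] and rr = atlas_chart[OF M restrict_chart_atlas[OF M d U]]
        have r: "smooth_transition c ?r" "smooth_transition ?r c"
          using c open_submanifold_cover[OF M U d] unfolding max_atlas_def by blast+
        have eq: "cdom c \<inter> cdom ?r = cdom c \<inter> cdom d" "cdom ?r \<inter> cdom c = cdom d \<inter> cdom c"
          using chart_subset[OF cU] by auto
        have im: "cmap ?r ` (cdom d \<inter> cdom c) = cmap d ` (cdom d \<inter> cdom c)"
          by (rule restrict_chart_image) (use chart_subset[OF cU] in auto)
        have 1: "euc_open (cdim c) (cmap c ` (cdom c \<inter> cdom d))"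
          "euc_smooth (cdim c) (cmap c ` (cdom c \<inter> cdom d)) (cdim d) (\<lambda>x. cmap ?r (cinv c x))"
          and 2: "euc_open (cdim d) (cmap d ` (cdom d \<inter> cdom c))"
          "euc_smooth (cdim d) (cmap d ` (cdom d \<inter> cdom c)) (cdim c) (\<lambda>x. cmap c (cinv ?r x))"
          using r unfolding smooth_transition_iff eq im by auto
        have "euc_smooth (cdim c) (cmap c ` (cdom c \<inter> cdom d)) (cdim d) (\<lambda>x. cmap d (cinv c x))"
          by (rule euc_smooth_cong[OF 1(1) _ 1(2)]) (use cinv_cmap[OF cU] chart_subset[OF cU] in auto)
        then show "smooth_transition c d" using 1(1) unfolding smooth_transition_iff by blast
        have "cinv ?r x = cinv d x" if "x \<in> cmap d ` (cdom d \<inter> cdom c)" for x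
        proof -
          obtain p where p: "p \<in> cdom d" "p \<in> cdom c" "x = cmap d p" using \<open>x \<in> _\<close> by blast
          then have "x = cmap ?r p" "p \<in> cdom ?r" using chart_subset[OF cU] by auto
          then show ?thesis using cinv_cmap[OF rr] cinv_cmap[OF dd] p by metis
        qed
        then have "euc_smooth (cdim d) (cmap d ` (cdom d \<inter> cdom c)) (cdim c) (\<lambda>x. cmap c (cinv d x))"
          by (intro euc_smooth_cong[OF 2(1) _ 2(2)]) simp
        then show "smooth_transition d c" using 2(1) unfolding smooth_transition_iff by blast
      qed
      then show "c \<in> atlas ?N" using chart_subset[OF cU] by simp
    qed
  qed
qed

lemma smooth_map_inclusion:
  assumes M: "premanifold M" and U: "mopen M U"
  shows "smooth_map (open_submanifold M U) M (\<lambda>p. p)"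
  using smooth_map_id[OF premanifold_open_submanifold[OF M U]] mopen_subset[OF U]
  unfolding smooth_map_def atlas_open_submanifold carrier_open_submanifold by blast

lemma smooth_map_restrict:
  assumes M: "premanifold M" and N: "premanifold N" and U: "mopen M U" and f: "smooth_map M N f"
  shows "smooth_map (open_submanifold M U) N f"
  using smooth_map_compose[OF premanifold_open_submanifold[OF M U] M N smooth_map_inclusion[OF M U] f] .

lemma smooth_map_extend_codomain:
  assumes "smooth_map M (open_submanifold N U) f" "U \<subseteq> carrier N"
  shows "smooth_map M N f"
  using assms unfolding smooth_map_def atlas_open_submanifold carrier_open_submanifold by blast

lemma smooth_map_local:
  assumes "\<And>p. p \<in> carrier M \<Longrightarrow> \<exists>W. p \<in> W \<and> smooth_map (open_submanifold M W) N f"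
  shows "smooth_map M N f"
  using assms unfolding smooth_map_def atlas_open_submanifold carrier_open_submanifold
  by (fastforce simp: Pi_iff)

lemma smooth_map_corestrict:
  assumes M: "premanifold M" and N: "premanifold N" and U: "mopen N U" and f: "smooth_map M N f"
    and fU: "f ` carrier M \<subseteq> U"
  shows "smooth_map M (open_submanifold N U) f"
proof (rule smooth_mapI[OF M premanifold_open_submanifold[OF N U]])
  show "f p \<in> carrier (open_submanifold N U)" if "p \<in> carrier M" for p using that fU by auto
  fix p assume p: "p \<in> carrier M"
  obtain d where d: "d \<in> atlas N" "f p \<in> cdom d" using atlas_cover[OF N smooth_map_carrier[OF f p]] by blast
  let ?r = "restrict_chart d U" and ?W = "{p \<in> carrier M. f p \<in> cdom d}"
  have "smooth_on M ?W (\<lambda>p. cmap ?r (f p) i)" if "i < cdim d" for i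
    by (rule smooth_on_cong[OF M smooth_on_pullback[OF M N f smooth_on_coord[OF N d(1) that]]]) (use fU in auto)
  then show "\<exists>W. \<exists>e\<in>atlas (open_submanifold N U). p \<in> W \<and> mopen M W \<and> f ` W \<subseteq> cdom e \<and>
       (\<forall>i<cdim e. smooth_on M W (\<lambda>p. cmap e (f p) i))"
    using p d fU open_submanifold_cover[OF N U d(1)] mopen_vimage[OF M N f mopen_cdom[OF N d(1)]]
    by (intro exI[of _ ?W] bexI[of _ ?r]) auto
qed

lemma smooth_on_open_submanifold:
  assumes M: "premanifold M" and U: "mopen M U" and f: "smooth_on M W f" and "W \<subseteq> U"
  shows "smooth_on (open_submanifold M U) W f"
  using f \<open>W \<subseteq> U\<close> unfolding smooth_on_def mopen_def by simp

lemma mopen_open_submanifoldD: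
  assumes M: "premanifold M" and U: "mopen M U" and W: "mopen (open_submanifold M U) W"
  shows "mopen M W"
proof (rule mopen_chartI[OF M])
  fix p assume p: "p \<in> W"
  let ?N = "open_submanifold M U"
  obtain c where c: "c \<in> atlas ?N" "p \<in> cdom c"
    using atlas_cover[OF premanifold_open_submanifold[OF M U]] p mopen_subset[OF W] by blast
  have "is_chart (carrier M) c" using atlas_chart[OF M] c by simp
  then show "\<exists>c\<in>atlas M. \<exists>V. p \<in> cdom c \<and> euc_open (cdim c) V \<and> cmap c p \<in> V \<and>
       (\<forall>q\<in>cdom c. cmap c q \<in> V \<longrightarrow> q \<in> W)"
    using c p W chart_image_iff[of "carrier M" c _ "W \<inter> cdom c"]
    by (intro bexI[of _ c] exI[of _ "cmap c ` (W \<inter> cdom c)"]) (auto simp: mopen_def)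
qed

lemma smooth_on_open_submanifoldD:
  assumes M: "premanifold M" and U: "mopen M U" and f: "smooth_on (open_submanifold M U) W f"
  shows "smooth_on M W f"
proof (rule smooth_on_chartI[OF M mopen_open_submanifoldD[OF M U smooth_on_mopen[OF f]]])
  fix p assume p: "p \<in> W"
  let ?N = "open_submanifold M U"
  obtain c where c: "c \<in> atlas ?N" "p \<in> cdom c"
    using atlas_cover[OF premanifold_open_submanifold[OF M U]] p mopen_subset[OF smooth_on_mopen[OF f]] by blast
  show "\<exists>c\<in>atlas M. \<exists>V. p \<in> cdom c \<and> euc_open (cdim c) V \<and> cmap c p \<in> V \<and> smooth_fn (cdim c) V (\<lambda>x. f (cinv c x))"
    using c p smooth_on_mopen[OF f] smooth_on_smooth_fn[OF f c(1)]
    by (intro bexI[of _ c] exI[of _ "cmap c ` (W \<inter> cdom c)"]) (auto simp: mopen_def)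
qed

section \<open>Manifolds transported along an injection\<close>

lemma image_chart:
  assumes c: "is_chart S c" and j: "inj_on j (cdom c)"
  shows "q \<in> cdom c \<Longrightarrow> cmap (image_chart j c) (j q) = cmap c q"
    and "cmap (image_chart j c) ` cdom (image_chart j c) = cmap c ` cdom c"
    and "q \<in> cdom c \<Longrightarrow> cinv (image_chart j c) (cmap c q) = j q"
proof -
  let ?e = "image_chart j c"
  have e: "cmap ?e (j q) = cmap c q" if "q \<in> cdom c" for q
    using that the_inv_into_f_f[OF j that] by (simp add: image_chart_def)
  have dom: "cdom ?e = j ` cdom c" by (simp add: image_chart_def)
  show "cmap ?e ` cdom ?e = cmap c ` cdom c"
    unfolding dom image_image by (rule image_cong) (use e in auto)
  have "inj_on (cmap ?e) (cdom ?e)"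
    unfolding dom using e c by (auto simp: inj_on_def is_chart_def)
  then show "cinv ?e (cmap c q) = j q" if "q \<in> cdom c"
    using the_inv_into_f_f[of "cmap ?e" "cdom ?e" "j q"] e[OF that] that
    by (simp add: cinv_def dom)
  show "cmap ?e (j q) = cmap c q" if "q \<in> cdom c" by (rule e[OF that])
qed

text \<open>Charts of the image are charts of \<open>M\<close> carried along \<open>j\<close> with
  the same coordinates, so \<open>f\<close> on the image and \<open>f\<close> after \<open>j\<close>
  on \<open>M\<close> have the same local representatives.\<close>

lemma smooth_map_image_manifold:
  assumes j: "inj_on j (carrier M)" and M: "premanifold M" and f: "smooth_map M N (\<lambda>p. f (j p))"
  shows "smooth_map (image_manifold j M) N f"
  unfolding smooth_map_def o_def
proof (intro conjI ballI)
  show "f \<in> carrier (image_manifold j M) \<rightarrow> carrier N"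
    using smooth_map_carrier[OF f] by (auto simp: image_manifold_def)
  fix q assume "q \<in> carrier (image_manifold j M)"
  then obtain p where p: "p \<in> carrier M" "q = j p" by (auto simp: image_manifold_def)
  obtain c d where c: "c \<in> atlas M" "d \<in> atlas N" "p \<in> cdom c" "(\<lambda>p. f (j p)) ` cdom c \<subseteq> cdom d"
    and sm: "euc_smooth (cdim c) (cmap c ` cdom c) (cdim d) (\<lambda>x. cmap d (f (j (cinv c x))))"
    using smooth_mapD[OF f p(1)] by blast
  let ?e = "image_chart j c"
  note cc = atlas_chart[OF M c(1)]
  have jc: "inj_on j (cdom c)" using j chart_subset[OF cc] inj_on_subset by blast
  note im = image_chart(2)[OF cc jc] and inv = image_chart(3)[OF cc jc]
  have "euc_smooth (cdim ?e) (cmap ?e ` cdom ?e) (cdim d) (\<lambda>x. cmap d (f (cinv ?e x)))"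
    unfolding im
    by (rule euc_smooth_cong[where F = "\<lambda>x. cmap d (f (j (cinv c x)))"])
      (use sm chart_open[OF cc] inv cinv_cmap[OF cc] in \<open>auto simp: image_chart_def\<close>)
  moreover have "?e \<in> atlas (image_manifold j M)" "q \<in> cdom ?e" "f ` cdom ?e \<subseteq> cdom d"
    using c p by (auto simp: image_manifold_def image_chart_def)
  ultimately show "\<exists>c\<in>atlas (image_manifold j M). \<exists>d\<in>atlas N. q \<in> cdom c \<and> f ` cdom c \<subseteq> cdom d \<and>
        euc_smooth (cdim c) (cmap c ` cdom c) (cdim d) (\<lambda>x. cmap d (f (cinv c x)))"
    using c(2) by blast
qed

lemma smooth_map_from_image_manifold:
  assumes j: "inj_on j (carrier M)" and M: "premanifold M" and N: "premanifold N"
    and f: "smooth_map (image_manifold j M) N f"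
  shows "smooth_map M N (\<lambda>p. f (j p))"
  unfolding smooth_map_def o_def
proof (intro conjI ballI)
  show "(\<lambda>p. f (j p)) \<in> carrier M \<rightarrow> carrier N"
    using smooth_map_carrier[OF f] by (auto simp: image_manifold_def)
  fix p assume p: "p \<in> carrier M"
  then have "j p \<in> carrier (image_manifold j M)" by (simp add: image_manifold_def)
  then obtain e d where e: "e \<in> atlas (image_manifold j M)" "d \<in> atlas N" "j p \<in> cdom e" "f ` cdom e \<subseteq> cdom d"
    and sm: "euc_smooth (cdim e) (cmap e ` cdom e) (cdim d) (\<lambda>x. cmap d (f (cinv e x)))"
    using smooth_mapD[OF f] by blast
  obtain c where c: "c \<in> atlas M" "e = image_chart j c" using e(1) by (auto simp: image_manifold_def)
  note cc = atlas_chart[OF M c(1)]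
  have jc: "inj_on j (cdom c)" using j chart_subset[OF cc] inj_on_subset by blast
  have pc: "p \<in> cdom c" using e(3) p j chart_subset[OF cc]
    by (auto simp: c(2) image_chart_def dest: inj_onD)
  note im = image_chart(2)[OF cc jc, folded c(2)] and inv = image_chart(3)[OF cc jc, folded c(2)]
  have sm': "euc_smooth (cdim c) (cmap c ` cdom c) (cdim d) (\<lambda>x. cmap d (f (cinv e x)))"
    using sm unfolding im by (simp add: c(2) image_chart_def)
  have "euc_smooth (cdim c) (cmap c ` cdom c) (cdim d) (\<lambda>x. cmap d (f (j (cinv c x))))"
    by (rule euc_smooth_cong[OF chart_open[OF cc] _ sm']) (use inv cinv_cmap[OF cc] in auto)
  moreover have "(\<lambda>p. f (j p)) ` cdom c \<subseteq> cdom d" using e(4) by (auto simp: c(2) image_chart_def)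
  ultimately show "\<exists>c\<in>atlas M. \<exists>d\<in>atlas N. p \<in> cdom c \<and> (\<lambda>p. f (j p)) ` cdom c \<subseteq> cdom d \<and>
        euc_smooth (cdim c) (cmap c ` cdom c) (cdim d) (\<lambda>x. cmap d (f (j (cinv c x))))"
    using c(1) e(2) pc by blast
qed

section \<open>Tangent spaces and tangent maps\<close>

text \<open>The derivative of \<open>f\<close> at \<open>p\<close> as a matrix in the charts
  \<open>c\<close> and \<open>d\<close>. With \<open>f\<close> the identity it is the Jacobian of a
  transition map, so a single chain rule covers both changes of charts and composition.\<close>

definition jac :: "'a chart \<Rightarrow> 'b chart \<Rightarrow> ('a \<Rightarrow> 'b) \<Rightarrow> 'a \<Rightarrow> (nat \<Rightarrow> real) \<Rightarrow> nat \<Rightarrow> real" where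
  "jac c d f p v = jacobian (cdim c) (cdim d) (\<lambda>x. cmap d (f (cinv c x))) (cmap c p) v"

lemma charts_atD: "c \<in> charts_at M p \<Longrightarrow> c \<in> atlas M" "c \<in> charts_at M p \<Longrightarrow> p \<in> cdom c"
  by (auto simp: charts_at_def)

lemma some_chart_at:
  "premanifold M \<Longrightarrow> p \<in> carrier M \<Longrightarrow> (SOME c. c \<in> charts_at M p) \<in> charts_at M p"
  by (rule someI_ex) (use atlas_cover[of M p] in \<open>auto simp: charts_at_def\<close>)

text \<open>Tangent vectors have coordinates in all charts at a point, so representatives are needed
  for every pair of charts and not only for the pair that \<open>smooth_map\<close> provides.
  Pulling back the coordinate functions of \<open>d\<close> supplies them.\<close>

lemma jac_local_rep:
  assumes M: "premanifold M" and N: "premanifold N" and f: "smooth_map M N f"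
    and c: "c \<in> charts_at M p" and d: "d \<in> charts_at N (f p)"
  shows "\<exists>V. euc_open (cdim c) V \<and> cmap c p \<in> V \<and>
    euc_smooth (cdim c) V (cdim d) (\<lambda>x. cmap d (f (cinv c x))) \<and> (\<forall>x\<in>V. f (cinv c x) \<in> cdom d)"
proof -
  let ?W = "{q \<in> carrier M. f q \<in> cdom d}"
  define V where "V = cmap c ` (?W \<inter> cdom c)"
  note cc = atlas_chart[OF M charts_atD(1)[OF c]] and dd = atlas_chart[OF N charts_atD(1)[OF d]]
  have "mopen M ?W" using mopen_vimage[OF M N f mopen_cdom[OF N charts_atD(1)[OF d]]] .
  then have V: "euc_open (cdim c) V" using charts_atD(1)[OF c] by (simp add: V_def mopen_def)
  have "cmap c p \<in> V"
    using charts_atD[OF c] charts_atD[OF d] chart_subset[OF cc] by (auto simp: V_def)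
  have fV: "f (cinv c x) \<in> cdom d" if "x \<in> V" for x
    using that cinv_cmap[OF cc] by (auto simp: V_def)
  have "euc_smooth (cdim c) V (cdim d) (\<lambda>x. cmap d (f (cinv c x)))"
    unfolding euc_smooth_iff
  proof (intro conjI allI impI)
    show "(\<lambda>x. cmap d (f (cinv c x))) ` V \<subseteq> euc (cdim d)" using chart_euc[OF dd] fV by blast
    show "smooth_fn (cdim c) V (\<lambda>x. cmap d (f (cinv c x)) j)" if "j < cdim d" for j
      unfolding V_def
      by (rule smooth_on_smooth_fn[OF smooth_on_pullback[OF M N f smooth_on_coord[OF N charts_atD(1)[OF d] that]] charts_atD(1)[OF c]])
  qed
  then show ?thesis using V \<open>cmap c p \<in> V\<close> fV by blast
qed

lemma jac_euc: "jac c d f p v \<in> euc (cdim d)"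
  unfolding jac_def by (rule jacobian_euc)

text \<open>Jacobians depend on germs only, so it is enough that the two representatives compose on
  the neighbourhood \<open>U\<close> where the middle point stays in \<open>V'\<close>.\<close>

lemma jac_compose:
  assumes M: "premanifold M" and N: "premanifold N" and P: "premanifold P"
    and f: "smooth_map M N f" and g: "smooth_map N P g"
    and c: "c \<in> charts_at M p" and d: "d \<in> charts_at N (f p)" and e: "e \<in> charts_at P (g (f p))"
  shows "jac c e (\<lambda>q. g (f q)) p v = jac d e g (f p) (jac c d f p v)"
proof -
  obtain V where V: "euc_open (cdim c) V" "cmap c p \<in> V"
    "euc_smooth (cdim c) V (cdim d) (\<lambda>x. cmap d (f (cinv c x)))" "\<forall>x\<in>V. f (cinv c x) \<in> cdom d"
    using jac_local_rep[OF M N f c d] by blast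
  obtain V' where V': "euc_open (cdim d) V'" "cmap d (f p) \<in> V'"
    "euc_smooth (cdim d) V' (cdim e) (\<lambda>x. cmap e (g (cinv d x)))"
    using jac_local_rep[OF N P g d e] by blast
  note cc = atlas_chart[OF M charts_atD(1)[OF c]] and dd = atlas_chart[OF N charts_atD(1)[OF d]]
  define U where "U = {x \<in> V. cmap d (f (cinv c x)) \<in> V'}"
  have U: "euc_open (cdim c) U" unfolding U_def by (rule euc_smooth_vimage_open[OF V(1,3) V'(1)])
  have pU: "cmap c p \<in> U" using V V' cinv_cmap[OF cc charts_atD(2)[OF c]] by (simp add: U_def)
  have "jac c e (\<lambda>q. g (f q)) p v =
      jacobian (cdim c) (cdim e) (\<lambda>x. cmap e (g (cinv d (cmap d (f (cinv c x)))))) (cmap c p) v"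
    unfolding jac_def
    by (rule jacobian_cong[OF U pU]) (use V(4) cinv_cmap[OF dd] in \<open>auto simp: U_def\<close>)
  also have "\<dots> = jacobian (cdim d) (cdim e) (\<lambda>x. cmap e (g (cinv d x))) (cmap d (f (cinv c (cmap c p))))
      (jacobian (cdim c) (cdim d) (\<lambda>x. cmap d (f (cinv c x))) (cmap c p) v)"
    by (rule jacobian_compose[OF U V'(1) _ _ V'(3) pU])
      (use euc_smooth_subset[OF V(3)] in \<open>auto simp: U_def\<close>)
  finally show ?thesis using cinv_cmap[OF cc charts_atD(2)[OF c]] by (simp add: jac_def)
qed

lemma jac_cong:
  assumes M: "premanifold M" and c: "c \<in> charts_at M p" and eq: "\<And>q. q \<in> carrier M \<Longrightarrow> f q = g q"
  shows "jac c d f p v = jac c d g p v"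
proof -
  note cc = atlas_chart[OF M charts_atD(1)[OF c]]
  show ?thesis unfolding jac_def
    by (rule jacobian_cong[OF chart_open[OF cc]])
      (use charts_atD[OF c] chart_subset[OF cc] cinv_cmap[OF cc] eq in auto)
qed

lemma jac_id:
  assumes M: "premanifold M" and c: "c \<in> charts_at M p" and v: "v \<in> euc (cdim c)"
  shows "jac c c (\<lambda>q. q) p v = v"
proof -
  note cc = atlas_chart[OF M charts_atD(1)[OF c]]
  have "jac c c (\<lambda>q. q) p v = jacobian (cdim c) (cdim c) (\<lambda>x. x) (cmap c p) v"
    unfolding jac_def by (rule jacobian_cong[OF chart_open[OF cc]])
      (use charts_atD[OF c] cinv_cmap[OF cc] in auto)
  then show ?thesis using jacobian_id[OF v] by simp
qed

lemma jac_add: "jac c d f p (\<lambda>i. u i + v i) = (\<lambda>i. jac c d f p u i + jac c d f p v i)"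
  unfolding jac_def by (rule jacobian_add)

lemma jac_scale: "jac c d f p (\<lambda>i. a * u i) = (\<lambda>i. a * jac c d f p u i)"
  unfolding jac_def by (rule jacobian_scale)

lemma jac_zero: "jac c d f p (\<lambda>i. 0) = (\<lambda>i. 0)"
  unfolding jac_def by (rule jacobian_zero)

section \<open>Tangent vectors and tangent maps\<close>

lemma tangent_space_iff: "v \<in> carrier (tangent_space M p) \<longleftrightarrow>
   v \<in> extensional (charts_at M p) \<and> (\<forall>c\<in>charts_at M p. v c \<in> euc (cdim c)) \<and>
   (\<forall>c\<in>charts_at M p. \<forall>d\<in>charts_at M p. v d = jac c d (\<lambda>q. q) p (v c))"
  by (simp add: tangent_space_def mk_module_def jac_def o_def)

lemma tangent_space_ops:
  "c \<in> charts_at M p \<Longrightarrow> (u \<oplus>\<^bsub>tangent_space M p\<^esub> v) c = (\<lambda>i. u c i + v c i)"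
  "c \<in> charts_at M p \<Longrightarrow> (a \<odot>\<^bsub>tangent_space M p\<^esub> v) c = (\<lambda>i. a * v c i)"
  "c \<in> charts_at M p \<Longrightarrow> \<zero>\<^bsub>tangent_space M p\<^esub> c = (\<lambda>i. 0)"
  "u \<oplus>\<^bsub>tangent_space M p\<^esub> v \<in> extensional (charts_at M p)"
  "a \<odot>\<^bsub>tangent_space M p\<^esub> v \<in> extensional (charts_at M p)"
  "\<zero>\<^bsub>tangent_space M p\<^esub> \<in> extensional (charts_at M p)"
  by (simp_all add: tangent_space_def mk_module_def)

lemma tangent_space_closed:
  "u \<in> carrier (tangent_space M p) \<Longrightarrow> v \<in> carrier (tangent_space M p) \<Longrightarrow>
     u \<oplus>\<^bsub>tangent_space M p\<^esub> v \<in> carrier (tangent_space M p)"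
  "u \<in> carrier (tangent_space M p) \<Longrightarrow> a \<odot>\<^bsub>tangent_space M p\<^esub> u \<in> carrier (tangent_space M p)"
  "\<zero>\<^bsub>tangent_space M p\<^esub> \<in> carrier (tangent_space M p)"
proof -
  show "u \<oplus>\<^bsub>tangent_space M p\<^esub> v \<in> carrier (tangent_space M p)"
    if u: "u \<in> carrier (tangent_space M p)" and v: "v \<in> carrier (tangent_space M p)"
    unfolding tangent_space_iff
  proof (intro conjI ballI tangent_space_ops(4))
    fix c d assume c: "c \<in> charts_at M p" and d: "d \<in> charts_at M p"
    have "u d = jac c d (\<lambda>q. q) p (u c)" "v d = jac c d (\<lambda>q. q) p (v c)"
      using u v c d unfolding tangent_space_iff by blast+
    then show "(u \<oplus>\<^bsub>tangent_space M p\<^esub> v) d = jac c d (\<lambda>q. q) p ((u \<oplus>\<^bsub>tangent_space M p\<^esub> v) c)"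
      using c d by (simp only: tangent_space_ops jac_add)
  next
    fix c assume c: "c \<in> charts_at M p"
    then have "u c \<in> euc (cdim c)" "v c \<in> euc (cdim c)" using u v unfolding tangent_space_iff by blast+
    then show "(u \<oplus>\<^bsub>tangent_space M p\<^esub> v) c \<in> euc (cdim c)"
      by (simp add: tangent_space_ops(1)[OF c] euc_def)
  qed
  show "a \<odot>\<^bsub>tangent_space M p\<^esub> u \<in> carrier (tangent_space M p)"
    if u: "u \<in> carrier (tangent_space M p)"
    unfolding tangent_space_iff
  proof (intro conjI ballI tangent_space_ops(5))
    fix c d assume c: "c \<in> charts_at M p" and d: "d \<in> charts_at M p"
    have "u d = jac c d (\<lambda>q. q) p (u c)" using u c d unfolding tangent_space_iff by blast
    then show "(a \<odot>\<^bsub>tangent_space M p\<^esub> u) d = jac c d (\<lambda>q. q) p ((a \<odot>\<^bsub>tangent_space M p\<^esub> u) c)"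
      using c d by (simp only: tangent_space_ops jac_scale)
  next
    fix c assume c: "c \<in> charts_at M p"
    then have "u c \<in> euc (cdim c)" using u unfolding tangent_space_iff by blast
    then show "(a \<odot>\<^bsub>tangent_space M p\<^esub> u) c \<in> euc (cdim c)"
      by (simp add: tangent_space_ops(2)[OF c] euc_def)
  qed
  show "\<zero>\<^bsub>tangent_space M p\<^esub> \<in> carrier (tangent_space M p)"
    unfolding tangent_space_iff by (auto simp: tangent_space_ops jac_zero euc_def)
qed

lemma tangent_vector_eqI:
  assumes "u \<in> carrier (tangent_space M p)" "v \<in> carrier (tangent_space M p)"
    "c \<in> charts_at M p" "u c = v c"
  shows "u = v"
proof (rule extensionalityI)
  show "u \<in> extensional (charts_at M p)" "v \<in> extensional (charts_at M p)"
    using assms unfolding tangent_space_iff by blast+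
  fix d assume "d \<in> charts_at M p"
  then show "u d = v d" using assms unfolding tangent_space_iff by metis
qed

text \<open>The inverse of reading coordinates in the chart \<open>c\<close>: it shows that every
  coordinate vector comes from a tangent vector.\<close>

definition tangent_of :: "'a manifold \<Rightarrow> 'a \<Rightarrow> 'a chart \<Rightarrow> (nat \<Rightarrow> real) \<Rightarrow> 'a tvec" where
  "tangent_of M p c x = (\<lambda>d\<in>charts_at M p. jac c d (\<lambda>q. q) p x)"

lemma tangent_of:
  assumes M: "premanifold M" and c: "c \<in> charts_at M p" and x: "x \<in> euc (cdim c)"
  shows "tangent_of M p c x \<in> carrier (tangent_space M p)" "tangent_of M p c x c = x"
proof -
  show "tangent_of M p c x c = x" using jac_id[OF M c x] c by (simp add: tangent_of_def)
  show "tangent_of M p c x \<in> carrier (tangent_space M p)"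
    unfolding tangent_space_iff
  proof (intro conjI ballI)
    fix d e assume d: "d \<in> charts_at M p" and e: "e \<in> charts_at M p"
    show "tangent_of M p c x e = jac d e (\<lambda>q. q) p (tangent_of M p c x d)"
      using jac_compose[OF M M M smooth_map_id[OF M] smooth_map_id[OF M] c d e, of x] d e
      by (simp add: tangent_of_def)
  qed (auto simp: tangent_of_def jac_euc)
qed

text \<open>\<open>tangent_map\<close> uses a chart picked by \<open>SOME\<close>. Rewriting
  \<open>v\<close> from \<open>c\<close> to that chart is a Jacobian of the identity, which the
  chain rule absorbs.\<close>

lemma tangent_map_at:
  assumes M: "premanifold M" and N: "premanifold N" and f: "smooth_map M N f" and p: "p \<in> carrier M"
    and v: "v \<in> carrier (tangent_space M p)" and c: "c \<in> charts_at M p" and d: "d \<in> charts_at N (f p)"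
  shows "tangent_map M N f p v d = jac c d f p (v c)"
proof -
  let ?c = "SOME c. c \<in> charts_at M p"
  have c0: "?c \<in> charts_at M p" by (rule some_chart_at[OF M p])
  have "v ?c = jac c ?c (\<lambda>q. q) p (v c)" using v c c0 unfolding tangent_space_iff by blast
  then have "jac ?c d f p (v ?c) = jac c d f p (v c)"
    using jac_compose[OF M M N smooth_map_id[OF M] f c c0 d] by simp
  then show ?thesis using d by (simp add: tangent_map_def jac_def o_def Let_def)
qed

lemma tangent_map_extensional: "tangent_map M N f p v \<in> extensional (charts_at N (f p))"
  by (simp add: tangent_map_def Let_def)

lemma tangent_map_closed:
  assumes M: "premanifold M" and N: "premanifold N" and f: "smooth_map M N f" and p: "p \<in> carrier M"
    and v: "v \<in> carrier (tangent_space M p)"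
  shows "tangent_map M N f p v \<in> carrier (tangent_space N (f p))"
proof -
  obtain c where c: "c \<in> charts_at M p" using some_chart_at[OF M p] by blast
  note at = tangent_map_at[OF M N f p v c]
  show ?thesis unfolding tangent_space_iff
  proof (intro conjI ballI tangent_map_extensional)
    fix d e assume d: "d \<in> charts_at N (f p)" and e: "e \<in> charts_at N (f p)"
    show "tangent_map M N f p v e = jac d e (\<lambda>q. q) (f p) (tangent_map M N f p v d)"
      using jac_compose[OF M N N f smooth_map_id[OF N] c d e, of "v c"] at[OF d] at[OF e] by simp
  qed (simp add: at jac_euc)
qed

lemma tangent_map_compose:
  assumes M: "premanifold M" and N: "premanifold N" and P: "premanifold P"
    and f: "smooth_map M N f" and g: "smooth_map N P g" and p: "p \<in> carrier M"
    and v: "v \<in> carrier (tangent_space M p)"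
  shows "tangent_map N P g (f p) (tangent_map M N f p v) = tangent_map M P (\<lambda>q. g (f q)) p v"
proof -
  have fp: "f p \<in> carrier N" and gp: "g (f p) \<in> carrier P"
    using smooth_map_carrier f g p by metis+
  obtain c where c: "c \<in> charts_at M p" using some_chart_at[OF M p] by blast
  obtain d where d: "d \<in> charts_at N (f p)" using some_chart_at[OF N fp] by blast
  obtain e where e: "e \<in> charts_at P (g (f p))" using some_chart_at[OF P gp] by blast
  note gf = smooth_map_compose[OF M N P f g]
  note Tf = tangent_map_closed[OF M N f p v]
  show ?thesis
  proof (rule tangent_vector_eqI[OF _ _ e])
    show "tangent_map N P g (f p) (tangent_map M N f p v) \<in> carrier (tangent_space P (g (f p)))"
      by (rule tangent_map_closed[OF N P g fp Tf])
    show "tangent_map M P (\<lambda>q. g (f q)) p v \<in> carrier (tangent_space P (g (f p)))"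
      by (rule tangent_map_closed[OF M P gf p v])
    show "tangent_map N P g (f p) (tangent_map M N f p v) e = tangent_map M P (\<lambda>q. g (f q)) p v e"
      using tangent_map_at[OF N P g fp Tf d e] tangent_map_at[OF M N f p v c d]
        tangent_map_at[OF M P gf p v c e] jac_compose[OF M N P f g c d e] by simp
  qed
qed

lemma tangent_map_cong:
  assumes M: "premanifold M" and p: "p \<in> carrier M" and eq: "\<And>q. q \<in> carrier M \<Longrightarrow> f q = g q"
  shows "tangent_map M N f p v = tangent_map M N g p v"
proof -
  let ?c = "SOME c. c \<in> charts_at M p"
  have "jac ?c d f p w = jac ?c d g p w" for d :: "'b chart" and w
    by (rule jac_cong[OF M some_chart_at[OF M p] eq])
  then show ?thesis unfolding tangent_map_def jac_def o_def Let_def eq[OF p] by simp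
qed

lemma tangent_map_ident:
  assumes M: "premanifold M" and p: "p \<in> carrier M" and v: "v \<in> carrier (tangent_space M p)"
  shows "tangent_map M M (\<lambda>q. q) p v = v"
proof -
  obtain c where c: "c \<in> charts_at M p" using some_chart_at[OF M p] by blast
  have "v c \<in> euc (cdim c)" using v c unfolding tangent_space_iff by blast
  then show ?thesis
    by (intro tangent_vector_eqI[OF tangent_map_closed[OF M M smooth_map_id[OF M] p v] v c])
      (simp add: tangent_map_at[OF M M smooth_map_id[OF M] p v c c] jac_id[OF M c])
qed

text \<open>\<open>jacobian\<close> multiplies a matrix of partial derivatives with the vector, so
  linearity holds for every \<open>f\<close>.\<close>

lemma tangent_map_linear:
  assumes M: "premanifold M" and p: "p \<in> carrier M"
  shows "tangent_map M N f p (u \<oplus>\<^bsub>tangent_space M p\<^esub> v) =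
      tangent_map M N f p u \<oplus>\<^bsub>tangent_space N (f p)\<^esub> tangent_map M N f p v"
    and "tangent_map M N f p (a \<odot>\<^bsub>tangent_space M p\<^esub> v) = a \<odot>\<^bsub>tangent_space N (f p)\<^esub> tangent_map M N f p v"
  unfolding tangent_map_def Let_def tangent_space_ops(1,2)[OF some_chart_at[OF M p]] jacobian_add jacobian_scale
  by (auto simp: tangent_space_def mk_module_def fun_eq_iff restrict_def)

section \<open>Complexified tangent spaces\<close>

lemma carrier_ctangent_space:
  "carrier (ctangent_space M p) = carrier (tangent_space M p) \<times> carrier (tangent_space M p)"
  by (simp add: ctangent_space_def complexification_def mk_module_def)

lemma ctangent_space_ops:
  "a \<oplus>\<^bsub>ctangent_space M p\<^esub> b =
     (fst a \<oplus>\<^bsub>tangent_space M p\<^esub> fst b, snd a \<oplus>\<^bsub>tangent_space M p\<^esub> snd b)"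
  "z \<odot>\<^bsub>ctangent_space M p\<^esub> a =
     ((Re z \<odot>\<^bsub>tangent_space M p\<^esub> fst a) \<oplus>\<^bsub>tangent_space M p\<^esub> ((- Im z) \<odot>\<^bsub>tangent_space M p\<^esub> snd a),
      (Im z \<odot>\<^bsub>tangent_space M p\<^esub> fst a) \<oplus>\<^bsub>tangent_space M p\<^esub> (Re z \<odot>\<^bsub>tangent_space M p\<^esub> snd a))"
  "\<zero>\<^bsub>ctangent_space M p\<^esub> = (\<zero>\<^bsub>tangent_space M p\<^esub>, \<zero>\<^bsub>tangent_space M p\<^esub>)"
  by (simp_all add: ctangent_space_def complexification_def mk_module_def case_prod_unfold)

lemma ctangent_space_closed:
  "a \<in> carrier (ctangent_space M p) \<Longrightarrow> b \<in> carrier (ctangent_space M p) \<Longrightarrow>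
     a \<oplus>\<^bsub>ctangent_space M p\<^esub> b \<in> carrier (ctangent_space M p)"
  "a \<in> carrier (ctangent_space M p) \<Longrightarrow> z \<odot>\<^bsub>ctangent_space M p\<^esub> a \<in> carrier (ctangent_space M p)"
  "\<zero>\<^bsub>ctangent_space M p\<^esub> \<in> carrier (ctangent_space M p)"
  unfolding ctangent_space_ops carrier_ctangent_space by (auto intro!: tangent_space_closed)

lemma ctangent_euc:
  assumes "a \<in> carrier (ctangent_space M p)" "c \<in> charts_at M p"
  shows "fst a c \<in> euc (cdim c)" "snd a c \<in> euc (cdim c)"
  using assms unfolding carrier_ctangent_space mem_Times_iff tangent_space_iff by blast+

lemma ctangent_vector_eqI:
  assumes "a \<in> carrier (ctangent_space M p)" "b \<in> carrier (ctangent_space M p)"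
    "c \<in> charts_at M p" "\<And>i. fst a c i = fst b c i" "\<And>i. snd a c i = snd b c i"
  shows "a = b"
  using assms tangent_vector_eqI[of "fst a" M p "fst b" c] tangent_vector_eqI[of "snd a" M p "snd b" c]
  unfolding carrier_ctangent_space by (auto simp: prod_eq_iff fun_eq_iff)

context
  fixes M :: "'a manifold" and p :: 'a
  assumes M: "premanifold M" and p: "p \<in> carrier M"
begin

lemma ctangent_space_assoc:
  assumes "a \<in> carrier (ctangent_space M p)" "b \<in> carrier (ctangent_space M p)" "c \<in> carrier (ctangent_space M p)"
  shows "a \<oplus>\<^bsub>ctangent_space M p\<^esub> b \<oplus>\<^bsub>ctangent_space M p\<^esub> c = a \<oplus>\<^bsub>ctangent_space M p\<^esub> (b \<oplus>\<^bsub>ctangent_space M p\<^esub> c)"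
  by (rule ctangent_vector_eqI[OF _ _ some_chart_at[OF M p]])
    (use assms some_chart_at[OF M p] in
      \<open>auto intro!: tangent_space_closed simp: carrier_ctangent_space mem_Times_iff ctangent_space_ops(1) tangent_space_ops(1)\<close>)

lemma ctangent_space_comm:
  assumes "a \<in> carrier (ctangent_space M p)" "b \<in> carrier (ctangent_space M p)"
  shows "a \<oplus>\<^bsub>ctangent_space M p\<^esub> b = b \<oplus>\<^bsub>ctangent_space M p\<^esub> a"
  by (rule ctangent_vector_eqI[OF _ _ some_chart_at[OF M p]])
    (use assms some_chart_at[OF M p] in
      \<open>auto intro!: tangent_space_closed simp: carrier_ctangent_space mem_Times_iff ctangent_space_ops(1) tangent_space_ops(1)\<close>)

lemma ctangent_space_l_zero:
  assumes "a \<in> carrier (ctangent_space M p)"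
  shows "\<zero>\<^bsub>ctangent_space M p\<^esub> \<oplus>\<^bsub>ctangent_space M p\<^esub> a = a"
  by (rule ctangent_vector_eqI[OF _ _ some_chart_at[OF M p]])
    (use assms some_chart_at[OF M p] in
      \<open>auto intro!: tangent_space_closed simp: carrier_ctangent_space mem_Times_iff ctangent_space_ops(1,3) tangent_space_ops(1,3)\<close>)

lemma ctangent_space_r_zero:
  "a \<in> carrier (ctangent_space M p) \<Longrightarrow> a \<oplus>\<^bsub>ctangent_space M p\<^esub> \<zero>\<^bsub>ctangent_space M p\<^esub> = a"
  using ctangent_space_l_zero ctangent_space_comm ctangent_space_closed(3) by metis

lemma ctangent_space_smult_zero:
  assumes "a \<in> carrier (ctangent_space M p)"
  shows "0 \<odot>\<^bsub>ctangent_space M p\<^esub> a = \<zero>\<^bsub>ctangent_space M p\<^esub>"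
  by (rule ctangent_vector_eqI[OF _ _ some_chart_at[OF M p]])
    (use assms some_chart_at[OF M p] in
      \<open>auto intro!: tangent_space_closed simp: carrier_ctangent_space mem_Times_iff ctangent_space_ops(2,3) tangent_space_ops(1,2,3)\<close>)

lemma ctangent_space_r_neg:
  assumes "a \<in> carrier (ctangent_space M p)"
  shows "a \<oplus>\<^bsub>ctangent_space M p\<^esub> ((- 1) \<odot>\<^bsub>ctangent_space M p\<^esub> a) = \<zero>\<^bsub>ctangent_space M p\<^esub>"
  by (rule ctangent_vector_eqI[OF _ _ some_chart_at[OF M p]])
    (use assms some_chart_at[OF M p] in
      \<open>auto intro!: tangent_space_closed simp: carrier_ctangent_space mem_Times_iff ctangent_space_ops tangent_space_ops(1,2,3)\<close>)

lemma ctangent_map_linear: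
  shows "ctangent_map M N f p (a \<oplus>\<^bsub>ctangent_space M p\<^esub> b) =
      ctangent_map M N f p a \<oplus>\<^bsub>ctangent_space N (f p)\<^esub> ctangent_map M N f p b"
    and "ctangent_map M N f p (z \<odot>\<^bsub>ctangent_space M p\<^esub> a) = z \<odot>\<^bsub>ctangent_space N (f p)\<^esub> ctangent_map M N f p a"
  by (simp_all add: ctangent_map_def ctangent_space_ops map_prod_def case_prod_unfold tangent_map_linear[OF M p])

lemma ctangent_map_cong:
  assumes "\<And>q. q \<in> carrier M \<Longrightarrow> f q = g q"
  shows "ctangent_map M N f p = ctangent_map M N g p"
proof -
  have "tangent_map M N f p = tangent_map M N g p"
    by (rule ext, rule tangent_map_cong[OF M p assms])
  then show ?thesis unfolding ctangent_map_def by simp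
qed

lemma ctangent_map_closed:
  assumes "premanifold N" "smooth_map M N f" "a \<in> carrier (ctangent_space M p)"
  shows "ctangent_map M N f p a \<in> carrier (ctangent_space N (f p))"
  using tangent_map_closed[OF M assms(1,2) p] assms(3) unfolding carrier_ctangent_space ctangent_map_def
  by (auto simp: map_prod_def)

lemma ctangent_map_zero:
  assumes "premanifold N" "smooth_map M N f"
  shows "ctangent_map M N f p \<zero>\<^bsub>ctangent_space M p\<^esub> = \<zero>\<^bsub>ctangent_space N (f p)\<^esub>"
proof -
  \<comment> \<open>Since zero is 0 times itself, its image \<open>w\<close> satisfies
    \<open>w = 0 \<odot> w\<close>, and the right-hand side has zero coordinates in the chart
    \<open>d\<close>.\<close>
  have z: "\<zero>\<^bsub>ctangent_space M p\<^esub> = 0 \<odot>\<^bsub>ctangent_space M p\<^esub> \<zero>\<^bsub>ctangent_space M p\<^esub>"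
    using ctangent_space_smult_zero[OF ctangent_space_closed(3)] by simp
  obtain d where d: "d \<in> charts_at N (f p)"
    using some_chart_at[OF assms(1) smooth_map_carrier[OF assms(2) p]] by blast
  have cl: "ctangent_map M N f p \<zero>\<^bsub>ctangent_space M p\<^esub> \<in> carrier (ctangent_space N (f p))"
    by (rule ctangent_map_closed[OF assms ctangent_space_closed(3)])
  define w where "w = ctangent_map M N f p \<zero>\<^bsub>ctangent_space M p\<^esub>"
  have w: "w = 0 \<odot>\<^bsub>ctangent_space N (f p)\<^esub> w"
    unfolding w_def ctangent_map_linear(2)[symmetric] using z[symmetric] by simp
  have 0: "fst (0 \<odot>\<^bsub>ctangent_space N (f p)\<^esub> w) d i = 0" "snd (0 \<odot>\<^bsub>ctangent_space N (f p)\<^esub> w) d i = 0" for i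
    by (simp_all add: ctangent_space_ops(2) tangent_space_ops(1,2)[OF d])
  have "fst w d i = 0" "snd w d i = 0" for i
    by (subst w, rule 0)+
  then show ?thesis
    by (intro ctangent_vector_eqI[OF cl ctangent_space_closed(3) d])
      (simp_all add: ctangent_space_ops(3) tangent_space_ops(3)[OF d] w_def)
qed

lemma ctangent_map_compose:
  assumes "premanifold N" "premanifold P" "smooth_map M N f" "smooth_map N P g"
    "a \<in> carrier (ctangent_space M p)"
  shows "ctangent_map N P g (f p) (ctangent_map M N f p a) = ctangent_map M P (\<lambda>q. g (f q)) p a"
  using tangent_map_compose[OF M assms(1-4) p] assms(5) unfolding carrier_ctangent_space ctangent_map_def
  by (auto simp: map_prod_def)

lemma ctangent_map_ident:
  "a \<in> carrier (ctangent_space M p) \<Longrightarrow> ctangent_map M M (\<lambda>q. q) p a = a"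
  using tangent_map_ident[OF M p] unfolding carrier_ctangent_space ctangent_map_def
  by (auto simp: map_prod_def)

end

section \<open>The complexified tangent bundle as a manifold\<close>

text \<open>The construction inside \<open>ctangent_group\<close>, for a manifold without group
  structure; \<open>lie_manifold_TG\<close> identifies the two.\<close>

definition ctangent_manifold :: "'a manifold \<Rightarrow> ('a \<times> 'a ctvec) manifold" where
  "ctangent_manifold M = (let T = (SIGMA p:carrier M. carrier (ctangent_space M p)) in
     \<lparr>carrier = T, atlas = max_atlas T (ctangent_chart M ` atlas M)\<rparr>)"

lemma carrier_ctangent_manifold [simp]:
  "carrier (ctangent_manifold M) = (SIGMA p:carrier M. carrier (ctangent_space M p))"
  by (simp add: ctangent_manifold_def Let_def)

lemma ctangent_chart_simps [simp]:
  "cdim (ctangent_chart M c) = 3 * cdim c"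
  "cdom (ctangent_chart M c) = (SIGMA p:cdom c. carrier (ctangent_space M p))"
  by (simp_all add: ctangent_chart_def Let_def)

lemma cmap_ctangent_chart:
  "p \<in> cdom c \<Longrightarrow> a \<in> carrier (ctangent_space M p) \<Longrightarrow>
    cmap (ctangent_chart M c) (p, a) = append_vec (cdim c) (cmap c p) (append_vec (cdim c) (fst a c) (snd a c))"
  by (cases a) (simp add: ctangent_chart_def Let_def)

text \<open>Each coordinate is a finite sum of products of smooth functions. One derivative of
  \<open>T\<close> is spent, which a smooth map can afford. This is the fibre part of the transition
  maps of a tangent bundle.\<close>

lemma euc_smooth_jacobian:
  assumes U: "euc_open k U" and A: "euc_open n A" and F: "euc_smooth k U n F" "F ` U \<subseteq> A"
    and T: "euc_smooth n A m T" and w: "euc_smooth k U n w"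
  shows "euc_smooth k U m (\<lambda>z. jacobian n m T (F z) (w z))"
proof -
  have "smooth_fn k U (\<lambda>z. jacobian n m T (F z) (w z) j)" if j: "j < m" for j
  proof -
    have "smooth_fn k U (\<lambda>z. \<Sum>i<n. partial_deriv i (\<lambda>y. T y j) (F z) * w z i)"
    proof (intro smooth_fn_sum smooth_fn_mult U)
      fix i assume i: "i \<in> {..<n}"
      have "smooth_fn n A (partial_deriv i (\<lambda>y. T y j))"
        using smooth_fn_partial_deriv T j i unfolding euc_smooth_iff by blast
      then show "smooth_fn k U (\<lambda>z. partial_deriv i (\<lambda>y. T y j) (F z))" by (rule smooth_fn_compose[OF U A F])
      show "smooth_fn k U (\<lambda>z. w z i)" using w i unfolding euc_smooth_iff by blast
    qed simp
    then show ?thesis using j by (simp add: jacobian_def)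
  qed
  then show ?thesis unfolding euc_smooth_iff using jacobian_euc by auto
qed

text \<open>Fibre coordinates are unconstrained because \<open>tangent_of\<close> realises every
  coordinate vector. The image is therefore a cylinder over the base, in three blocks: base point,
  real part and imaginary part.\<close>

lemma ctangent_chart_image:
  assumes M: "premanifold M" and c: "c \<in> atlas M" and A: "A \<subseteq> cdom c"
  shows "cmap (ctangent_chart M c) ` (SIGMA p:A. carrier (ctangent_space M p)) =
    {z \<in> euc (3 * cdim c). take_vec (cdim c) z \<in> cmap c ` A}" (is "?L = ?R")
proof
  note cc = atlas_chart[OF M c]
  have three: "3 * cdim c = cdim c + (cdim c + cdim c)" by simp
  show "?L \<subseteq> ?R"
  proof
    fix z assume "z \<in> ?L"
    then obtain p a where p: "p \<in> A" "a \<in> carrier (ctangent_space M p)"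
      and z: "z = append_vec (cdim c) (cmap c p) (append_vec (cdim c) (fst a c) (snd a c))"
    proof -
      obtain x where x: "x \<in> (SIGMA p:A. carrier (ctangent_space M p))" "z = cmap (ctangent_chart M c) x"
        using \<open>z \<in> ?L\<close> by blast
      obtain p a where "x = (p, a)" by (cases x)
      then show thesis using that[of p a] x A cmap_ctangent_chart[of p c a M] by auto
    qed
    have "c \<in> charts_at M p" using p A c by (auto simp: charts_at_def)
    then have "snd a c \<in> euc (cdim c)" by (rule ctangent_euc(2)[OF p(2)])
    then have "z \<in> euc (3 * cdim c)" unfolding z three by (intro append_euc)
    moreover have "take_vec (cdim c) z = cmap c p"
      unfolding z using p A by (intro take_append chart_euc[OF cc]) auto
    ultimately show "z \<in> ?R" using p by auto
  qed
  show "?R \<subseteq> ?L"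
  proof
    fix z assume z: "z \<in> ?R"
    then obtain p where p: "p \<in> A" "take_vec (cdim c) z = cmap c p" by auto
    have cp: "c \<in> charts_at M p" using p A c by (auto simp: charts_at_def)
    define w where "w = drop_vec (cdim c) z"
    have w: "w \<in> euc (cdim c + cdim c)" unfolding w_def using z drop_euc three by auto
    define a where "a = (tangent_of M p c (take_vec (cdim c) w), tangent_of M p c (drop_vec (cdim c) w))"
    note t = tangent_of[OF M cp take_euc, of w] tangent_of[OF M cp drop_euc[OF w]]
    have a: "a \<in> carrier (ctangent_space M p)" using t by (simp add: a_def carrier_ctangent_space)
    have "cmap (ctangent_chart M c) (p, a) = append_vec (cdim c) (take_vec (cdim c) z) w"
      using cmap_ctangent_chart[of p c a M] p a A t by (auto simp: a_def)
    then have "cmap (ctangent_chart M c) (p, a) = z" by (simp add: w_def)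
    then show "z \<in> ?L" using p a by (intro image_eqI[of _ _ "(p, a)"]) auto
  qed
qed

lemma ctangent_chart_image_open:
  assumes "premanifold M" "c \<in> atlas M" "A \<subseteq> cdom c" "euc_open (cdim c) (cmap c ` A)"
  shows "euc_open (3 * cdim c) (cmap (ctangent_chart M c) ` (SIGMA p:A. carrier (ctangent_space M p)))"
proof -
  have "3 * cdim c = cdim c + (cdim c + cdim c)" by simp
  then show ?thesis unfolding ctangent_chart_image[OF assms(1-3)]
    using euc_smooth_vimage_open[OF euc_open_euc euc_smooth_take[OF euc_open_euc] assms(4)] by metis
qed

lemma is_chart_ctangent:
  assumes M: "premanifold M" and c: "c \<in> atlas M"
  shows "is_chart (SIGMA p:carrier M. carrier (ctangent_space M p)) (ctangent_chart M c)"
proof -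
  note cc = atlas_chart[OF M c]
  have "inj_on (cmap (ctangent_chart M c)) (SIGMA p:cdom c. carrier (ctangent_space M p))"
  proof (rule inj_onI)
    fix x y assume x: "x \<in> (SIGMA p:cdom c. carrier (ctangent_space M p))"
      and y: "y \<in> (SIGMA p:cdom c. carrier (ctangent_space M p))"
      and eq: "cmap (ctangent_chart M c) x = cmap (ctangent_chart M c) y"
    obtain p a where "x = (p, a)" by (cases x)
    moreover obtain q b where "y = (q, b)" by (cases y)
    ultimately have xy: "x = (p, a)" "y = (q, b)" by simp_all
    have pq: "p \<in> cdom c" "q \<in> cdom c" "a \<in> carrier (ctangent_space M p)" "b \<in> carrier (ctangent_space M q)"
      using x y xy by auto
    have e: "append_vec (cdim c) (cmap c p) (append_vec (cdim c) (fst a c) (snd a c)) =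
        append_vec (cdim c) (cmap c q) (append_vec (cdim c) (fst b c) (snd b c))"
      using eq pq by (simp add: xy cmap_ctangent_chart)
    have "cmap c p = cmap c q"
      using arg_cong[OF e, of "take_vec (cdim c)"] pq by (simp add: take_append[OF chart_euc[OF cc]])
    then have p: "p = q" using pq cc by (auto simp: is_chart_def dest: inj_onD)
    have cp: "c \<in> charts_at M q" using pq c by (auto simp: charts_at_def)
    have e2: "append_vec (cdim c) (fst a c) (snd a c) = append_vec (cdim c) (fst b c) (snd b c)"
      using arg_cong[OF e, of "drop_vec (cdim c)"] by simp
    have eu: "fst a c \<in> euc (cdim c)" "fst b c \<in> euc (cdim c)"
      using ctangent_euc(1)[OF _ cp] pq p by simp_all
    have "fst a c = fst b c" using arg_cong[OF e2, of "take_vec (cdim c)"] eu by (simp add: take_append)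
    moreover have "snd a c = snd b c" using arg_cong[OF e2, of "drop_vec (cdim c)"] by simp
    ultimately have "a = b" using ctangent_vector_eqI[of a M q b c] pq p cp by simp
    then show "x = y" using p xy by simp
  qed
  moreover have "cmap (ctangent_chart M c) \<in> extensional (cdom (ctangent_chart M c))"
    by (simp add: ctangent_chart_def Let_def)
  moreover have "euc_open (3 * cdim c) (cmap (ctangent_chart M c) ` (SIGMA p:cdom c. carrier (ctangent_space M p)))"
    by (rule ctangent_chart_image_open[OF M c order_refl chart_open[OF cc]])
  ultimately show ?thesis using chart_subset[OF cc] by (auto simp: is_chart_def)
qed

text \<open>With T the transition map on the base, the transition here is (x, u, v) \<mapsto> (T x,
  DT_x u, DT_x v), by the compatibility condition in \<open>tangent_space\<close>.\<close>

lemma smooth_transition_ctangent: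
  assumes M: "premanifold M" and c: "c \<in> atlas M" and d: "d \<in> atlas M"
  shows "smooth_transition (ctangent_chart M c) (ctangent_chart M d)"
proof -
  note cc = atlas_chart[OF M c] and dd = atlas_chart[OF M d]
  let ?n = "cdim c" and ?m = "cdim d" and ?T = "\<lambda>x. cmap d (cinv c x)"
  let ?A = "cmap c ` (cdom c \<inter> cdom d)"
  let ?D = "SIGMA p:cdom c \<inter> cdom d. carrier (ctangent_space M p)"
  let ?U = "cmap (ctangent_chart M c) ` ?D"
  have A: "euc_open ?n ?A" and T: "euc_smooth ?n ?A ?m ?T"
    using atlas_transition[OF M c d] unfolding smooth_transition_iff by auto
  have D: "cdom (ctangent_chart M c) \<inter> cdom (ctangent_chart M d) = ?D" by auto
  have U: "euc_open (3 * ?n) ?U" by (rule ctangent_chart_image_open[OF M c _ A]) auto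
  have Ueq: "?U = {z \<in> euc (3 * ?n). take_vec ?n z \<in> ?A}" by (rule ctangent_chart_image[OF M c]) auto
  have three: "3 * ?n = ?n + (?n + ?n)" "3 * ?m = ?m + (?m + ?m)" by simp_all
  note U' = U[unfolded three]
  have take: "euc_smooth (3 * ?n) ?U ?n (take_vec ?n)" and drop: "euc_smooth (3 * ?n) ?U (?n + ?n) (drop_vec ?n)"
    using euc_smooth_take[OF U'] euc_smooth_drop[OF U'] unfolding three(1)[symmetric] by simp_all
  have drop_mem: "drop_vec ?n ` ?U \<subseteq> euc (?n + ?n)" using drop unfolding euc_smooth_iff by blast
  have w1: "euc_smooth (3 * ?n) ?U ?n (\<lambda>z. take_vec ?n (drop_vec ?n z))"
    by (rule euc_smooth_compose[OF U euc_open_euc drop drop_mem euc_smooth_take[OF euc_open_euc]])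
  have w2: "euc_smooth (3 * ?n) ?U ?n (\<lambda>z. drop_vec ?n (drop_vec ?n z))"
    by (rule euc_smooth_compose[OF U euc_open_euc drop drop_mem euc_smooth_drop[OF euc_open_euc]])
  have take_mem: "take_vec ?n ` ?U \<subseteq> ?A" unfolding Ueq by auto
  have "euc_smooth (3 * ?n) ?U (?m + (?m + ?m))
    (\<lambda>z. append_vec ?m (?T (take_vec ?n z))
      (append_vec ?m (jacobian ?n ?m ?T (take_vec ?n z) (take_vec ?n (drop_vec ?n z)))
        (jacobian ?n ?m ?T (take_vec ?n z) (drop_vec ?n (drop_vec ?n z)))))"
    by (intro euc_smooth_append euc_smooth_compose[OF U A take take_mem T]
        euc_smooth_jacobian[OF U A take take_mem T] w1 w2)
  then have "euc_smooth (3 * ?n) ?U (?m + (?m + ?m)) (\<lambda>z. cmap (ctangent_chart M d) (cinv (ctangent_chart M c) z))"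
  proof (rule euc_smooth_cong[OF U, rotated])
    fix z assume "z \<in> ?U"
    then obtain p a where p: "p \<in> cdom c" "p \<in> cdom d" and a: "a \<in> carrier (ctangent_space M p)"
      and z: "z = cmap (ctangent_chart M c) (p, a)" by auto
    have cp: "c \<in> charts_at M p" "d \<in> charts_at M p" using p c d by (auto simp: charts_at_def)
    have inv: "cinv (ctangent_chart M c) z = (p, a)"
      unfolding z by (rule cinv_cmap[OF is_chart_ctangent[OF M c]]) (use p a in auto)
    have z': "z = append_vec ?n (cmap c p) (append_vec ?n (fst a c) (snd a c))"
      using z cmap_ctangent_chart[OF p(1) a] by simp
    have eu: "fst a c \<in> euc ?n" by (rule ctangent_euc(1)[OF a cp(1)])
    have tr: "fst a d = jac c d (\<lambda>q. q) p (fst a c)" "snd a d = jac c d (\<lambda>q. q) p (snd a c)"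
      using a cp unfolding carrier_ctangent_space mem_Times_iff tangent_space_iff by blast+
    have 1: "take_vec ?n z = cmap c p" "drop_vec ?n z = append_vec ?n (fst a c) (snd a c)"
      using z' take_append[OF chart_euc[OF cc p(1)]] by simp_all
    have 2: "take_vec ?n (drop_vec ?n z) = fst a c" "drop_vec ?n (drop_vec ?n z) = snd a c"
      using 1 take_append[OF eu] by simp_all
    show "append_vec ?m (?T (take_vec ?n z))
      (append_vec ?m (jacobian ?n ?m ?T (take_vec ?n z) (take_vec ?n (drop_vec ?n z)))
        (jacobian ?n ?m ?T (take_vec ?n z) (drop_vec ?n (drop_vec ?n z)))) =
        cmap (ctangent_chart M d) (cinv (ctangent_chart M c) z)"
      unfolding inv cmap_ctangent_chart[OF p(2) a] 1(1) 2 tr jac_def cinv_cmap[OF cc p(1)] ..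
  qed
  then show ?thesis using U unfolding smooth_transition_iff D by (simp add: three(2))
qed

lemma premanifold_ctangent:
  assumes M: "premanifold M"
  shows "premanifold (ctangent_manifold M)"
    and "\<And>c. c \<in> atlas M \<Longrightarrow> ctangent_chart M c \<in> atlas (ctangent_manifold M)"
proof -
  let ?T = "SIGMA p:carrier M. carrier (ctangent_space M p)"
  have 1: "carrier (ctangent_manifold M) = ?T" "atlas (ctangent_manifold M) = max_atlas ?T (ctangent_chart M ` atlas M)"
    by (simp_all add: ctangent_manifold_def Let_def)
  have 2: "\<Union>(cdom ` (ctangent_chart M ` atlas M)) = ?T"
    using atlas_cover[OF M] chart_subset[OF atlas_chart[OF M]] by fastforce
  have 3: "is_chart ?T a" if "a \<in> ctangent_chart M ` atlas M" for a
    using that is_chart_ctangent[OF M] by blast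
  have 4: "smooth_transition a b" if "a \<in> ctangent_chart M ` atlas M" "b \<in> ctangent_chart M ` atlas M" for a b
    using that smooth_transition_ctangent[OF M] by blast
  show "premanifold (ctangent_manifold M)" by (rule premanifold_max_atlas(1)[OF 1 2 3 4])
  show "ctangent_chart M c \<in> atlas (ctangent_manifold M)" if "c \<in> atlas M" for c
    using premanifold_max_atlas(2)[OF 1 2 3 4] that by blast
qed

lemma smooth_on_ctangent_coord:
  assumes M: "premanifold M" and c: "c \<in> atlas M" and i: "i < cdim c"
  shows "smooth_on (ctangent_manifold M) (cdom (ctangent_chart M c)) (\<lambda>x. cmap c (fst x) i)"
    and "smooth_on (ctangent_manifold M) (cdom (ctangent_chart M c)) (\<lambda>x. fst (snd x) c i)"
    and "smooth_on (ctangent_manifold M) (cdom (ctangent_chart M c)) (\<lambda>x. snd (snd x) c i)"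
proof -
  note T = premanifold_ctangent(1)[OF M] and tc = premanifold_ctangent(2)[OF M c]
  note co = smooth_on_cong[OF T smooth_on_coord[OF T tc]]
  show "smooth_on (ctangent_manifold M) (cdom (ctangent_chart M c)) (\<lambda>x. cmap c (fst x) i)"
    by (rule co[of i]) (use i in \<open>auto simp: cmap_ctangent_chart append_vec_def\<close>)
  show "smooth_on (ctangent_manifold M) (cdom (ctangent_chart M c)) (\<lambda>x. fst (snd x) c i)"
    by (rule co[of "cdim c + i"]) (use i in \<open>auto simp: cmap_ctangent_chart append_vec_def\<close>)
  show "smooth_on (ctangent_manifold M) (cdom (ctangent_chart M c)) (\<lambda>x. snd (snd x) c i)"
    by (rule co[of "cdim c + (cdim c + i)"]) (use i in \<open>auto simp: cmap_ctangent_chart append_vec_def\<close>)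
qed

lemma smooth_map_ctangent_proj:
  assumes M: "premanifold M"
  shows "smooth_map (ctangent_manifold M) M fst"
proof (rule smooth_mapI[OF premanifold_ctangent(1)[OF M] M])
  fix x assume x: "x \<in> carrier (ctangent_manifold M)"
  then obtain c where c: "c \<in> atlas M" "fst x \<in> cdom c" using atlas_cover[OF M] by fastforce
  then show "\<exists>W. \<exists>d\<in>atlas M. x \<in> W \<and> mopen (ctangent_manifold M) W \<and> fst ` W \<subseteq> cdom d \<and>
       (\<forall>i<cdim d. smooth_on (ctangent_manifold M) W (\<lambda>p. cmap d (fst p) i))"
    using x smooth_on_ctangent_coord(1)[OF M c(1)]
      mopen_cdom[OF premanifold_ctangent(1)[OF M] premanifold_ctangent(2)[OF M c(1)]]
    by (intro exI[of _ "cdom (ctangent_chart M c)"] bexI[of _ c]) auto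
qed auto

lemma smooth_map_ctangent_zero:
  assumes M: "premanifold M"
  shows "smooth_map M (ctangent_manifold M) (\<lambda>p. (p, \<zero>\<^bsub>ctangent_space M p\<^esub>))"
proof (rule smooth_mapI[OF M premanifold_ctangent(1)[OF M]])
  fix p assume "p \<in> carrier M"
  then obtain c where c: "c \<in> atlas M" "p \<in> cdom c" using atlas_cover[OF M] by blast
  have "smooth_on M (cdom c) (\<lambda>p. cmap (ctangent_chart M c) (p, \<zero>\<^bsub>ctangent_space M p\<^esub>) i)" if "i < 3 * cdim c" for i
  proof -
    have "smooth_on M (cdom c) (\<lambda>p. if i < cdim c then cmap c p i else 0)"
      using smooth_on_coord[OF M c(1)] smooth_on_const[OF mopen_cdom[OF M c(1)]] by (cases "i < cdim c") auto
    then show ?thesis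
    proof (rule smooth_on_cong[OF M])
      fix q assume q: "q \<in> cdom c"
      then have "c \<in> charts_at M q" using c by (auto simp: charts_at_def)
      then show "(if i < cdim c then cmap c q i else 0) = cmap (ctangent_chart M c) (q, \<zero>\<^bsub>ctangent_space M q\<^esub>) i"
        using q ctangent_space_closed(3)[of M q] cmap_ctangent_chart[of q c "\<zero>\<^bsub>ctangent_space M q\<^esub>" M]
        by (simp add: append_vec_def ctangent_space_ops(3) tangent_space_ops(3))
    qed
  qed
  then show "\<exists>W. \<exists>d\<in>atlas (ctangent_manifold M). p \<in> W \<and> mopen M W \<and>
      (\<lambda>p. (p, \<zero>\<^bsub>ctangent_space M p\<^esub>)) ` W \<subseteq> cdom d \<and>
      (\<forall>i<cdim d. smooth_on M W (\<lambda>p. cmap d (p, \<zero>\<^bsub>ctangent_space M p\<^esub>) i))"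
    using c mopen_cdom[OF M c(1)] premanifold_ctangent(2)[OF M c(1)]
    by (intro exI[of _ "cdom c"] bexI[of _ "ctangent_chart M c"]) (auto intro: ctangent_space_closed)
qed (auto intro: ctangent_space_closed)

text \<open>In a product chart, differentiating in the first factor with the second as a parameter
  is the \<open>i\<close>-th partial derivative, because the coordinates of the first factor come
  first. This yields derivatives that are smooth in the parameter too.\<close>

lemma smooth_on_partial_deriv:
  assumes M: "premanifold M" and N: "premanifold N" and f: "smooth_on (prod_manifold M N) W f"
    and c: "c \<in> atlas M" and i: "i < cdim c"
  shows "smooth_on (prod_manifold M N) (W \<inter> (cdom c \<times> carrier N))
    (\<lambda>x. partial_deriv i (\<lambda>y. f (cinv c y, snd x)) (cmap c (fst x)))"
proof (rule smooth_on_chartI)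
  note cc = atlas_chart[OF M c]
  show pm: "premanifold (prod_manifold M N)" by (rule premanifold_prod(1)[OF M N])
  have "cdom c \<times> carrier N = {x \<in> carrier (prod_manifold M N). fst x \<in> cdom c}"
    using chart_subset[OF cc] by auto
  then have "mopen (prod_manifold M N) (cdom c \<times> carrier N)"
    using mopen_vimage[OF pm M smooth_map_fst[OF M N] mopen_cdom[OF M c]] by simp
  then show "mopen (prod_manifold M N) (W \<inter> (cdom c \<times> carrier N))"
    using mopen_Int[OF pm smooth_on_mopen[OF f]] by blast
  fix x assume x: "x \<in> W \<inter> (cdom c \<times> carrier N)"
  then obtain d where d: "d \<in> atlas N" "snd x \<in> cdom d" using atlas_cover[OF N] by force
  note dd = atlas_chart[OF N d(1)]
  let ?e = "prod_chart c d"
  have e: "?e \<in> atlas (prod_manifold M N)" by (rule premanifold_prod(2)[OF M N c d(1)])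
  note ee = is_chart_prod[OF cc dd]
  define V where "V = cmap ?e ` (W \<inter> cdom ?e)"
  have V: "euc_open (cdim ?e) V" using smooth_on_mopen[OF f] e unfolding V_def mopen_def by blast
  have "smooth_fn (cdim ?e) V (partial_deriv i (\<lambda>z. f (cinv ?e z)))"
    using smooth_fn_partial_deriv[OF smooth_on_smooth_fn[OF f e]] i by (simp add: V_def)
  then have "smooth_fn (cdim ?e) V (\<lambda>z. partial_deriv i (\<lambda>y. f (cinv c y, snd (cinv ?e z))) (cmap c (fst (cinv ?e z))))"
  proof (rule smooth_fn_cong[OF V, rotated])
    fix z assume "z \<in> V"
    then obtain p q where pq: "p \<in> cdom c" "q \<in> cdom d" and z: "z = cmap ?e (p, q)" by (auto simp: V_def)
    have inv: "cinv ?e z = (p, q)" unfolding z by (rule cinv_cmap[OF ee]) (use pq in auto)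
    have zi: "z i = cmap c p i" using pq i by (simp add: z append_vec_def)
    \<comment> \<open>The two functions of \<open>s\<close> are known to agree only while the point
      stays in the image of the chart \<open>c\<close>; outside, inverse charts are unspecified.
      Equality near the base point is all that \<open>deriv\<close> needs.\<close>
    have "deriv (\<lambda>s. f (cinv ?e (z(i := s)))) (z i) = deriv (\<lambda>s. f (cinv c ((cmap c p)(i := s)), q)) (cmap c p i)"
    proof (rule deriv_cong_ev[OF _ zi])
      have "\<forall>\<^sub>F s in nhds (cmap c p i). (cmap c p)(i := s) \<in> cmap c ` cdom c"
        by (rule euc_open_upd[OF chart_open[OF cc] _ i]) (use pq in auto)
      then have "\<forall>\<^sub>F s in nhds (cmap c p i). f (cinv ?e (z(i := s))) = f (cinv c ((cmap c p)(i := s)), q)"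
      proof eventually_elim
        case (elim s)
        then obtain p' where p': "p' \<in> cdom c" "(cmap c p)(i := s) = cmap c p'" by auto
        have "z(i := s) = append_vec (cdim c) ((cmap c p)(i := s)) (cmap d q)"
          using pq i by (auto simp: z append_vec_def fun_eq_iff)
        then have "z(i := s) = cmap ?e (p', q)" using p' pq by simp
        then have "cinv ?e (z(i := s)) = (p', q)" using cinv_cmap[OF ee, of "(p', q)"] p' pq by simp
        then show ?case using p' cinv_cmap[OF cc] by simp
      qed
      then show "\<forall>\<^sub>F s in nhds (z i). f (cinv ?e (z(i := s))) = f (cinv c ((cmap c p)(i := s)), q)"
        by (simp add: zi)
    qed
    then show "partial_deriv i (\<lambda>z. f (cinv ?e z)) z =
        partial_deriv i (\<lambda>y. f (cinv c y, snd (cinv ?e z))) (cmap c (fst (cinv ?e z)))"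
      by (simp add: partial_deriv_def inv)
  qed
  moreover have "x \<in> cdom ?e" "cmap ?e x \<in> V" using x d by (auto simp: V_def mem_Times_iff)
  ultimately show "\<exists>e\<in>atlas (prod_manifold M N). \<exists>V. x \<in> cdom e \<and> euc_open (cdim e) V \<and> cmap e x \<in> V \<and>
       smooth_fn (cdim e) V (\<lambda>z. partial_deriv i (\<lambda>y. f (cinv c y, snd (cinv e z))) (cmap c (fst (cinv e z))))"
    using V e by blast
qed

section \<open>The complexified tangent group\<close>

locale real_lie_group =
  fixes G :: "'g lie_group" (structure)
  assumes is_lie_group: "is_lie_group G"
begin

abbreviation "LM \<equiv> lie_manifold G"
abbreviation "CT \<equiv> ctangent_space LM"
abbreviation "TG \<equiv> ctangent_group G"
abbreviation "D \<equiv> ctangent_map LM LM"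
abbreviation "smoothG \<equiv> smooth_map LM LM"

sublocale group G
  using is_lie_group by (simp add: is_lie_group_def)

lemma carrier_LM [simp]: "carrier LM = carrier G"
  by (simp add: lie_manifold_def)

lemma premanifold_LM: "premanifold LM"
  by (rule smooth_manifold_premanifold) (use is_lie_group in \<open>simp add: is_lie_group_def\<close>)

lemma lie_manifold_TG: "lie_manifold TG = ctangent_manifold LM"
  by (simp add: lie_manifold_def[of TG] ctangent_group_def ctangent_manifold_def Let_def)
    (simp add: lie_manifold_def)

lemma carrier_TG: "carrier TG = (SIGMA g:carrier G. carrier (CT g))"
  by (simp add: ctangent_group_def Let_def)

lemma one_TG: "\<one>\<^bsub>TG\<^esub> = (\<one>, \<zero>\<^bsub>CT \<one>\<^esub>)"
  by (simp add: ctangent_group_def Let_def)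

lemma mult_TG: "(g, u) \<otimes>\<^bsub>TG\<^esub> (h, v) =
    (g \<otimes> h, D (\<lambda>k. g \<otimes> k) h v \<oplus>\<^bsub>CT (g \<otimes> h)\<^esub> D (\<lambda>k. k \<otimes> h) g u)"
  by (simp add: ctangent_group_def Let_def)

lemma smooth_mult:
  assumes P: "premanifold P" and f: "smooth_map P LM f" and h: "smooth_map P LM h"
  shows "smooth_map P LM (\<lambda>p. f p \<otimes> h p)"
proof -
  have "smooth_map (prod_manifold LM LM) LM (\<lambda>(g, h). g \<otimes> h)"
    using is_lie_group by (simp add: is_lie_group_def)
  from smooth_map_compose[OF P premanifold_prod(1)[OF premanifold_LM premanifold_LM] premanifold_LM
      smooth_map_Pair[OF P premanifold_LM premanifold_LM f h] this]
  show ?thesis by simp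
qed

lemma smooth_inv:
  assumes P: "premanifold P" and f: "smooth_map P LM f"
  shows "smooth_map P LM (\<lambda>p. inv (f p))"
  using smooth_map_compose[OF P premanifold_LM premanifold_LM f] is_lie_group by (simp add: is_lie_group_def)

lemma smooth_translations:
  assumes "a \<in> carrier G" "b \<in> carrier G"
  shows "smoothG (\<lambda>k. a \<otimes> k)" "smoothG (\<lambda>k. k \<otimes> b)" "smoothG (\<lambda>k. a \<otimes> k \<otimes> b)"
  using assms
  by (auto intro!: smooth_mult premanifold_LM smooth_map_id smooth_map_const)

lemma D_closed:
  "g \<in> carrier G \<Longrightarrow> a \<in> carrier (CT g) \<Longrightarrow> smoothG f \<Longrightarrow> f g = g' \<Longrightarrow> D f g a \<in> carrier (CT g')"
  using ctangent_map_closed[OF premanifold_LM _ premanifold_LM, of g f a] by simp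

text \<open>The composite \<open>m\<close> has to agree with \<open>h\<close> after \<open>f\<close>
  on the group only, so group identities such as associativity may be used to simplify it.\<close>

lemma D_compose:
  assumes "g \<in> carrier G" "a \<in> carrier (CT g)" "smoothG f" "smoothG h" "f g = g'"
    and "\<And>k. k \<in> carrier G \<Longrightarrow> h (f k) = m k"
  shows "D h g' (D f g a) = D m g a"
  using ctangent_map_compose[OF premanifold_LM _ premanifold_LM premanifold_LM assms(3,4), of g a] assms
    ctangent_map_cong[OF premanifold_LM, of g "\<lambda>k. h (f k)" m LM] by simp

lemma D_ident:
  assumes "g \<in> carrier G" "a \<in> carrier (CT g)" "\<And>k. k \<in> carrier G \<Longrightarrow> f k = k"
  shows "D f g a = a"
  using ctangent_map_ident[OF premanifold_LM] assms
    ctangent_map_cong[OF premanifold_LM, of g f "\<lambda>k. k" LM] by simp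

lemma D_add:
  "g \<in> carrier G \<Longrightarrow> f g = g' \<Longrightarrow> D f g (a \<oplus>\<^bsub>CT g\<^esub> b) = D f g a \<oplus>\<^bsub>CT g'\<^esub> D f g b"
  using ctangent_map_linear(1)[OF premanifold_LM, of g LM f a b] by simp

lemma D_smult:
  "g \<in> carrier G \<Longrightarrow> f g = g' \<Longrightarrow> D f g (z \<odot>\<^bsub>CT g\<^esub> a) = z \<odot>\<^bsub>CT g'\<^esub> D f g a"
  using ctangent_map_linear(2)[OF premanifold_LM, of g LM f z a] by simp

lemma D_zero:
  "g \<in> carrier G \<Longrightarrow> smoothG f \<Longrightarrow> f g = g' \<Longrightarrow> D f g \<zero>\<^bsub>CT g\<^esub> = \<zero>\<^bsub>CT g'\<^esub>"
  using ctangent_map_zero[OF premanifold_LM _ premanifold_LM] by auto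

lemmas CT_closed = ctangent_space_closed[where M = LM]

lemma CT_rules:
  assumes "g \<in> carrier G" "a \<in> carrier (CT g)"
  shows "\<zero>\<^bsub>CT g\<^esub> \<oplus>\<^bsub>CT g\<^esub> a = a" "a \<oplus>\<^bsub>CT g\<^esub> \<zero>\<^bsub>CT g\<^esub> = a"
    "a \<oplus>\<^bsub>CT g\<^esub> ((- 1) \<odot>\<^bsub>CT g\<^esub> a) = \<zero>\<^bsub>CT g\<^esub>"
  using ctangent_space_l_zero[OF premanifold_LM] ctangent_space_r_zero[OF premanifold_LM]
    ctangent_space_r_neg[OF premanifold_LM] assms by auto

lemma CT_assoc:
  "g \<in> carrier G \<Longrightarrow> a \<in> carrier (CT g) \<Longrightarrow> b \<in> carrier (CT g) \<Longrightarrow> c \<in> carrier (CT g) \<Longrightarrow>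
    a \<oplus>\<^bsub>CT g\<^esub> b \<oplus>\<^bsub>CT g\<^esub> c = a \<oplus>\<^bsub>CT g\<^esub> (b \<oplus>\<^bsub>CT g\<^esub> c)"
  using ctangent_space_assoc[OF premanifold_LM] by auto

lemma CT_comm:
  "g \<in> carrier G \<Longrightarrow> a \<in> carrier (CT g) \<Longrightarrow> b \<in> carrier (CT g) \<Longrightarrow> a \<oplus>\<^bsub>CT g\<^esub> b = b \<oplus>\<^bsub>CT g\<^esub> a"
  using ctangent_space_comm[OF premanifold_LM] by auto

section \<open>The group law of the complexified tangent group\<close>

lemma mult_TG_closed:
  assumes "g \<in> carrier G" "h \<in> carrier G" "u \<in> carrier (CT g)" "v \<in> carrier (CT h)"
  shows "D (\<lambda>k. g \<otimes> k) h v \<oplus>\<^bsub>CT (g \<otimes> h)\<^esub> D (\<lambda>k. k \<otimes> h) g u \<in> carrier (CT (g \<otimes> h))"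
  using assms by (auto intro!: CT_closed(1) D_closed smooth_translations)

text \<open>In either bracketing each of the three vectors is carried to the fibre over the triple
  product by a left and a right translation. Functoriality of \<open>D\<close> merges these into one
  map, the same on both sides by associativity of \<open>G\<close>.\<close>

lemma mult_TG_assoc:
  assumes x: "g \<in> carrier G" "u \<in> carrier (CT g)" and y: "h \<in> carrier G" "v \<in> carrier (CT h)"
    and z: "k \<in> carrier G" "w \<in> carrier (CT k)"
  shows "(g, u) \<otimes>\<^bsub>TG\<^esub> (h, v) \<otimes>\<^bsub>TG\<^esub> (k, w) = (g, u) \<otimes>\<^bsub>TG\<^esub> ((h, v) \<otimes>\<^bsub>TG\<^esub> (k, w))"
proof -
  let ?n = "g \<otimes> (h \<otimes> k)"
  let ?w = "D (\<lambda>q. g \<otimes> (h \<otimes> q)) k w" and ?v = "D (\<lambda>q. g \<otimes> (q \<otimes> k)) h v"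
    and ?u = "D (\<lambda>q. q \<otimes> (h \<otimes> k)) g u"
  note sm = smooth_translations
  have n: "g \<otimes> h \<otimes> k = ?n" using x y z by (simp add: m_assoc)
  have w1: "D (\<lambda>q. g \<otimes> h \<otimes> q) k w = ?w"
    by (subst ctangent_map_cong[OF premanifold_LM, of k _ "\<lambda>q. g \<otimes> (h \<otimes> q)"]) (use x y z in \<open>auto simp: m_assoc\<close>)
  have w2: "D (\<lambda>q. g \<otimes> q) (h \<otimes> k) (D (\<lambda>q. h \<otimes> q) k w) = ?w"
    by (rule D_compose) (use x y z sm in auto)
  have v1: "D (\<lambda>q. q \<otimes> k) (g \<otimes> h) (D (\<lambda>q. g \<otimes> q) h v) = ?v"
    by (rule D_compose) (use x y z sm in \<open>auto simp: m_assoc\<close>)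
  have v2: "D (\<lambda>q. g \<otimes> q) (h \<otimes> k) (D (\<lambda>q. q \<otimes> k) h v) = ?v"
    by (rule D_compose) (use x y z sm in auto)
  have u1: "D (\<lambda>q. q \<otimes> k) (g \<otimes> h) (D (\<lambda>q. q \<otimes> h) g u) = ?u"
    by (rule D_compose) (use x y z sm in \<open>auto simp: m_assoc\<close>)
  have cl: "?w \<in> carrier (CT ?n)" "?v \<in> carrier (CT ?n)" "?u \<in> carrier (CT ?n)"
    using D_closed[of "h \<otimes> k" "D (\<lambda>q. h \<otimes> q) k w" "\<lambda>q. g \<otimes> q" ?n]
      D_closed[of "h \<otimes> k" "D (\<lambda>q. q \<otimes> k) h v" "\<lambda>q. g \<otimes> q" ?n]
      D_closed[of k w "\<lambda>q. h \<otimes> q" "h \<otimes> k"] D_closed[of h v "\<lambda>q. q \<otimes> k" "h \<otimes> k"]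
      D_closed[of g u "\<lambda>q. q \<otimes> (h \<otimes> k)" ?n] x y z sm w2 v2 by auto
  have "(g, u) \<otimes>\<^bsub>TG\<^esub> (h, v) \<otimes>\<^bsub>TG\<^esub> (k, w) = (?n, ?w \<oplus>\<^bsub>CT ?n\<^esub> (?v \<oplus>\<^bsub>CT ?n\<^esub> ?u))"
    using x y z by (simp add: mult_TG n w1 D_add[where g' = ?n] v1 u1)
  moreover have "(g, u) \<otimes>\<^bsub>TG\<^esub> ((h, v) \<otimes>\<^bsub>TG\<^esub> (k, w)) = (?n, ?w \<oplus>\<^bsub>CT ?n\<^esub> ?v \<oplus>\<^bsub>CT ?n\<^esub> ?u)"
    using x y z by (simp add: mult_TG D_add[where g' = ?n] w2 v2)
  ultimately show ?thesis using CT_assoc[of ?n ?w ?v ?u] cl x y z by simp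
qed

lemma one_mult_TG:
  assumes "h \<in> carrier G" "v \<in> carrier (CT h)"
  shows "(\<one>, \<zero>\<^bsub>CT \<one>\<^esub>) \<otimes>\<^bsub>TG\<^esub> (h, v) = (h, v)"
  using assms D_ident[of h v "\<lambda>k. \<one> \<otimes> k"] D_zero[of \<one> "\<lambda>k. k \<otimes> h" h] smooth_translations CT_rules
  by (simp add: mult_TG)

lemma inv_mult_TG:
  assumes g: "g \<in> carrier G" and u: "u \<in> carrier (CT g)"
  shows "\<exists>w\<in>carrier (CT (inv g)). (inv g, w) \<otimes>\<^bsub>TG\<^esub> (g, u) = (\<one>, \<zero>\<^bsub>CT \<one>\<^esub>)"
proof -
  let ?u = "D (\<lambda>k. inv g \<otimes> k) g u"
  note sm = smooth_translations
  have u': "?u \<in> carrier (CT \<one>)" by (rule D_closed) (use g u sm in auto)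
  \<comment> \<open>A left inverse must solve (L_{g^-1})_* u + (R_g)_* w = 0. As (R_g)_* undoes
    (R_{g^-1})_*, the solution is (R_{g^-1})_* of minus the first term.\<close>
  let ?w = "D (\<lambda>k. k \<otimes> inv g) \<one> ((- 1) \<odot>\<^bsub>CT \<one>\<^esub> ?u)"
  have "D (\<lambda>k. k \<otimes> g) (inv g) ?w = D (\<lambda>k. k) \<one> ((- 1) \<odot>\<^bsub>CT \<one>\<^esub> ?u)"
    by (rule D_compose) (use g u' sm in \<open>auto simp: m_assoc intro: CT_closed\<close>)
  also have "\<dots> = (- 1) \<odot>\<^bsub>CT \<one>\<^esub> ?u" by (rule D_ident) (use u' in \<open>auto intro: CT_closed\<close>)
  finally have "(inv g, ?w) \<otimes>\<^bsub>TG\<^esub> (g, u) = (\<one>, \<zero>\<^bsub>CT \<one>\<^esub>)"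
    using g u' CT_rules(3) by (simp add: mult_TG)
  moreover have "?w \<in> carrier (CT (inv g))"
    by (rule D_closed) (use g u' sm in \<open>auto intro: CT_closed\<close>)
  ultimately show ?thesis by blast
qed

lemma group_TG: "group TG"
proof (rule groupI)
  show "x \<otimes>\<^bsub>TG\<^esub> y \<in> carrier TG" if "x \<in> carrier TG" "y \<in> carrier TG" for x y
    using that mult_TG_closed by (auto simp: carrier_TG mult_TG)
  show "\<one>\<^bsub>TG\<^esub> \<in> carrier TG" by (simp add: carrier_TG one_TG CT_closed)
  show "x \<otimes>\<^bsub>TG\<^esub> y \<otimes>\<^bsub>TG\<^esub> z = x \<otimes>\<^bsub>TG\<^esub> (y \<otimes>\<^bsub>TG\<^esub> z)"
    if "x \<in> carrier TG" "y \<in> carrier TG" "z \<in> carrier TG" for x y z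
    using that mult_TG_assoc by (auto simp: carrier_TG)
  show "\<one>\<^bsub>TG\<^esub> \<otimes>\<^bsub>TG\<^esub> x = x" if "x \<in> carrier TG" for x
    using that one_mult_TG by (auto simp: carrier_TG one_TG)
  show "\<exists>y\<in>carrier TG. y \<otimes>\<^bsub>TG\<^esub> x = \<one>\<^bsub>TG\<^esub>" if x: "x \<in> carrier TG" for x
  proof -
    obtain g u where gu: "x = (g, u)" "g \<in> carrier G" "u \<in> carrier (CT g)" using x by (auto simp: carrier_TG)
    then obtain w where "w \<in> carrier (CT (inv g))" "(inv g, w) \<otimes>\<^bsub>TG\<^esub> (g, u) = (\<one>, \<zero>\<^bsub>CT \<one>\<^esub>)"
      using inv_mult_TG by blast
    then show ?thesis using gu by (intro bexI[of _ "(inv g, w)"]) (auto simp: carrier_TG one_TG)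
  qed
qed

text \<open>The complexified right Maurer-Cartan form of \<open>G\<close>.\<close>

definition mc_form :: "'g \<times> 'g ctvec \<Rightarrow> 'g ctvec" where
  "mc_form x = D (\<lambda>k. k \<otimes> inv (fst x)) (fst x) (snd x)"

lemma mc_form_closed: "x \<in> carrier TG \<Longrightarrow> mc_form x \<in> carrier (CT \<one>)"
  unfolding mc_form_def carrier_TG by (intro D_closed smooth_translations) auto

lemma mc_form_one: "a \<in> carrier (CT \<one>) \<Longrightarrow> mc_form (\<one>, a) = a"
  unfolding mc_form_def by (simp add: D_ident)

lemma mc_form_zero: "g \<in> carrier G \<Longrightarrow> mc_form (g, \<zero>\<^bsub>CT g\<^esub>) = \<zero>\<^bsub>CT \<one>\<^esub>"
  unfolding mc_form_def by (simp add: D_zero smooth_translations)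

lemma mc_form_add: "g \<in> carrier G \<Longrightarrow> mc_form (g, a \<oplus>\<^bsub>CT g\<^esub> b) = mc_form (g, a) \<oplus>\<^bsub>CT \<one>\<^esub> mc_form (g, b)"
  unfolding mc_form_def by (simp add: D_add)

lemma mc_form_smult: "g \<in> carrier G \<Longrightarrow> mc_form (g, z \<odot>\<^bsub>CT g\<^esub> a) = z \<odot>\<^bsub>CT \<one>\<^esub> mc_form (g, a)"
  unfolding mc_form_def by (simp add: D_smult)

lemma Ad_C_D: "Ad_C G g = D (\<lambda>k. g \<otimes> k \<otimes> inv g) \<one>"
  by (simp add: Ad_C_def)

lemma Ad_C_closed: "g \<in> carrier G \<Longrightarrow> a \<in> carrier (CT \<one>) \<Longrightarrow> Ad_C G g a \<in> carrier (CT \<one>)"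
  unfolding Ad_C_D by (rule D_closed) (auto intro: smooth_translations)

text \<open>Right translation by (gh)^-1 after L_g equals conjugation by g after R_{h^-1}, which
  gives the adjoint term; after R_h it equals R_{g^-1}, which gives the other term.\<close>

lemma mc_form_mult:
  assumes x: "x \<in> carrier TG" and y: "y \<in> carrier TG"
  shows "mc_form (x \<otimes>\<^bsub>TG\<^esub> y) = mc_form x \<oplus>\<^bsub>CT \<one>\<^esub> Ad_C G (fst x) (mc_form y)"
proof -
  obtain g u where xx: "x = (g, u)" "g \<in> carrier G" "u \<in> carrier (CT g)" using x by (auto simp: carrier_TG)
  obtain h v where yy: "y = (h, v)" "h \<in> carrier G" "v \<in> carrier (CT h)" using y by (auto simp: carrier_TG)
  note sm = smooth_translations
  let ?R = "\<lambda>k. k \<otimes> inv (g \<otimes> h)"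
  have "D ?R (g \<otimes> h) (D (\<lambda>k. g \<otimes> k) h v) = D (\<lambda>k. g \<otimes> (k \<otimes> inv h) \<otimes> inv g) h v"
    by (rule D_compose) (use xx yy sm in \<open>auto simp: m_assoc inv_mult_group\<close>)
  also have "\<dots> = D (\<lambda>k. g \<otimes> k \<otimes> inv g) \<one> (D (\<lambda>k. k \<otimes> inv h) h v)"
    by (rule D_compose[symmetric]) (use xx yy sm in auto)
  finally have 1: "D ?R (g \<otimes> h) (D (\<lambda>k. g \<otimes> k) h v) = Ad_C G g (mc_form y)"
    by (simp add: Ad_C_D mc_form_def yy)
  have 2: "D ?R (g \<otimes> h) (D (\<lambda>k. k \<otimes> h) g u) = D (\<lambda>k. k \<otimes> inv g) g u"
  proof (rule D_compose)
    fix k assume "k \<in> carrier G"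
    then show "k \<otimes> h \<otimes> inv (g \<otimes> h) = k \<otimes> inv g"
      using xx yy by (simp add: inv_mult_group m_assoc inv_solve_left)
        (metis inv_closed m_assoc l_one r_inv)
  qed (use xx yy sm in auto)
  have "mc_form (x \<otimes>\<^bsub>TG\<^esub> y) = Ad_C G g (mc_form y) \<oplus>\<^bsub>CT \<one>\<^esub> mc_form x"
    using xx yy by (simp add: mc_form_def[of "(_, _)"] mult_TG D_add 1 2 r_inv)
  then show ?thesis using CT_comm mc_form_closed[OF x] Ad_C_closed[OF xx(2) mc_form_closed[OF y]] xx by simp
qed

text \<open>(R_g)_* undoes (R_{g^-1})_*, and the zero vector at g contributes nothing to the
  product.\<close>

lemma mc_form_decomp:
  assumes x: "x \<in> carrier TG"
  shows "x = (\<one>, mc_form x) \<otimes>\<^bsub>TG\<^esub> (fst x, \<zero>\<^bsub>CT (fst x)\<^esub>)"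
proof -
  obtain g u where xx: "x = (g, u)" "g \<in> carrier G" "u \<in> carrier (CT g)" using x by (auto simp: carrier_TG)
  note sm = smooth_translations
  have "D (\<lambda>k. k \<otimes> g) \<one> (D (\<lambda>k. k \<otimes> inv g) g u) = D (\<lambda>k. k) g u"
    by (rule D_compose) (use xx sm in \<open>auto simp: m_assoc\<close>)
  then have "D (\<lambda>k. k \<otimes> g) \<one> (mc_form x) = u" using xx D_ident[of g u "\<lambda>k. k"] by (simp add: mc_form_def)
  moreover have "D (\<lambda>k. \<one> \<otimes> k) g \<zero>\<^bsub>CT g\<^esub> = \<zero>\<^bsub>CT g\<^esub>"
    by (rule D_zero) (use xx sm in auto)
  ultimately show ?thesis using xx CT_rules by (simp add: mult_TG)
qed

lemma zero_mult_TG: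
  assumes "g \<in> carrier G" "h \<in> carrier G"
  shows "(g, \<zero>\<^bsub>CT g\<^esub>) \<otimes>\<^bsub>TG\<^esub> (h, \<zero>\<^bsub>CT h\<^esub>) = (g \<otimes> h, \<zero>\<^bsub>CT (g \<otimes> h)\<^esub>)"
  using assms CT_rules CT_closed(3) by (simp add: mult_TG D_zero[where g' = "g \<otimes> h"] smooth_translations)

text \<open>Multiplying by zero vectors on both sides is left translation by g followed by right
  translation by g^-1, that is, differentiated conjugation.\<close>

lemma Ad_C_decomp:
  assumes g: "g \<in> carrier G" and a: "a \<in> carrier (CT \<one>)"
  shows "(\<one>, Ad_C G g a) = (g, \<zero>\<^bsub>CT g\<^esub>) \<otimes>\<^bsub>TG\<^esub> (\<one>, a) \<otimes>\<^bsub>TG\<^esub> (inv g, \<zero>\<^bsub>CT (inv g)\<^esub>)"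
proof -
  note sm = smooth_translations
  have La: "D (\<lambda>k. g \<otimes> k) \<one> a \<in> carrier (CT g)" by (rule D_closed) (use g a sm in auto)
  have 1: "(g, \<zero>\<^bsub>CT g\<^esub>) \<otimes>\<^bsub>TG\<^esub> (\<one>, a) = (g, D (\<lambda>k. g \<otimes> k) \<one> a)"
    using g CT_rules[OF g La] D_zero[of g "\<lambda>k. k \<otimes> \<one>" g] sm by (simp add: mult_TG)
  have "D (\<lambda>k. k \<otimes> inv g) g (D (\<lambda>k. g \<otimes> k) \<one> a) = Ad_C G g a"
    unfolding Ad_C_D by (rule D_compose) (use g a sm in auto)
  moreover have "D (\<lambda>k. g \<otimes> k) (inv g) \<zero>\<^bsub>CT (inv g)\<^esub> = \<zero>\<^bsub>CT \<one>\<^esub>"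
    by (rule D_zero) (use g sm in auto)
  ultimately show ?thesis unfolding 1 using g a Ad_C_closed CT_rules by (simp add: mult_TG)
qed

section \<open>Smoothness of the Maurer-Cartan form\<close>

lemma smooth_fst_TG: "smooth_map (ctangent_manifold LM) LM fst"
  by (rule smooth_map_ctangent_proj[OF premanifold_LM])

text \<open>At g the form differentiates k \<mapsto> k g^-1 in k, so the differentiated map moves
  with the point. Replacing g^-1 by h^-1 with an independent variable h separates the two roles: the
  partial derivatives in k are jointly smooth in (k, h) and may then be restricted to the diagonal k
  = h = g.\<close>

lemma smooth_on_mc_form:
  assumes c1: "c1 \<in> charts_at LM \<one>" and j: "j < cdim c1"
  shows "smooth_on (ctangent_manifold LM) (carrier (ctangent_manifold LM)) (\<lambda>x. fst (mc_form x) c1 j)"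
    and "smooth_on (ctangent_manifold LM) (carrier (ctangent_manifold LM)) (\<lambda>x. snd (mc_form x) c1 j)"
proof -
  let ?T = "ctangent_manifold LM" and ?P = "prod_manifold LM LM"
  note pm = premanifold_LM and pT = premanifold_ctangent(1)[OF premanifold_LM]
    and pP = premanifold_prod(1)[OF premanifold_LM premanifold_LM]
  define F where "F p = cmap c1 (fst p \<otimes> inv (snd p)) j" for p
  let ?W = "{p \<in> carrier ?P. fst p \<otimes> inv (snd p) \<in> cdom c1}"
  have F: "smooth_on ?P ?W F"
    unfolding F_def
    by (rule smooth_on_pullback[OF pP pm _ smooth_on_coord[OF pm charts_atD(1)[OF c1] j]])
      (intro smooth_mult smooth_inv pP smooth_map_fst smooth_map_snd pm)
  define dF where "dF c i x = partial_deriv i (\<lambda>y. F (cinv c y, fst x)) (cmap c (fst x))"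
    for c i and x :: "'g \<times> 'g ctvec"
  have dF: "smooth_on ?T (cdom (ctangent_chart LM c)) (dF c i)" if c: "c \<in> atlas LM" and i: "i < cdim c" for c i
  proof -
    have diag: "smooth_map ?T ?P (\<lambda>x. (fst x, fst x))"
      by (rule smooth_map_Pair[OF pT pm pm smooth_fst_TG smooth_fst_TG])
    have "smooth_on ?T {x \<in> carrier ?T. (fst x, fst x) \<in> ?W \<inter> (cdom c \<times> carrier LM)} (dF c i)"
      using smooth_on_pullback[OF pT pP diag smooth_on_partial_deriv[OF pm pm F c i]]
      unfolding dF_def[abs_def] by simp
    then show ?thesis
    proof (rule smooth_on_subset)
      show "mopen ?T (cdom (ctangent_chart LM c))"
        by (rule mopen_cdom[OF pT premanifold_ctangent(2)[OF pm c]])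
      \<comment> \<open>Diagonal points belong to \<open>?W\<close> because g g^-1 = 1 lies in the
        domain of \<open>c1\<close>.\<close>
      show "cdom (ctangent_chart LM c) \<subseteq> {x \<in> carrier ?T. (fst x, fst x) \<in> ?W \<inter> (cdom c \<times> carrier LM)}"
        using chart_subset[OF atlas_chart[OF pm c]] charts_atD(2)[OF c1] by auto
    qed
  qed
  \<comment> \<open>The functions \<open>dF c i\<close> are the entries of one row of a real
    Jacobian, which acts separately on the real and the imaginary part. The formula is valid on the
    whole domain of the tangent chart.\<close>
  have mc_form: "fst (mc_form x) c1 j = (\<Sum>i<cdim c. dF c i x * fst (snd x) c i)"
    "snd (mc_form x) c1 j = (\<Sum>i<cdim c. dF c i x * snd (snd x) c i)"
    if c: "c \<in> atlas LM" and x: "x \<in> cdom (ctangent_chart LM c)" for c x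
  proof -
    obtain g u where gu: "x = (g, u)" "g \<in> cdom c" "u \<in> carrier (CT g)" using x by auto
    have g: "g \<in> carrier G" using gu chart_subset[OF atlas_chart[OF pm c]] by auto
    have cg: "c \<in> charts_at LM g" using c gu by (simp add: charts_at_def)
    have c1': "c1 \<in> charts_at LM (g \<otimes> inv g)" using c1 g by simp
    have at: "tangent_map LM LM (\<lambda>k. k \<otimes> inv g) g w c1 j = (\<Sum>i<cdim c. dF c i x * w c i)"
      if "w \<in> carrier (tangent_space LM g)" for w
      using tangent_map_at[OF pm pm smooth_translations(2)[of "inv g" "inv g"] _ that cg c1'] g j
      by (simp add: jac_def jacobian_def dF_def F_def gu)
    show "fst (mc_form x) c1 j = (\<Sum>i<cdim c. dF c i x * fst (snd x) c i)"
      "snd (mc_form x) c1 j = (\<Sum>i<cdim c. dF c i x * snd (snd x) c i)"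
      using at gu by (auto simp: mc_form_def ctangent_map_def carrier_ctangent_space)
  qed
  have loc: "\<exists>c\<in>atlas LM. x \<in> cdom (ctangent_chart LM c) \<and> cdom (ctangent_chart LM c) \<subseteq> carrier ?T"
    if x: "x \<in> carrier ?T" for x
  proof -
    obtain c where c: "c \<in> atlas LM" "fst x \<in> cdom c" using x atlas_cover[OF pm] by fastforce
    then have "x \<in> cdom (ctangent_chart LM c)" using x by auto
    then show ?thesis using c(1) chart_subset[OF is_chart_ctangent[OF pm c(1)]] by auto
  qed
  have sum: "smooth_on ?T (cdom (ctangent_chart LM c)) (\<lambda>x. \<Sum>i<cdim c. dF c i x * fst (snd x) c i)"
    "smooth_on ?T (cdom (ctangent_chart LM c)) (\<lambda>x. \<Sum>i<cdim c. dF c i x * snd (snd x) c i)"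
    if c: "c \<in> atlas LM" for c
    by (intro smooth_on_sum smooth_on_mult dF smooth_on_ctangent_coord mopen_cdom pT pm premanifold_ctangent(2) c; simp)+
  show "smooth_on ?T (carrier ?T) (\<lambda>x. fst (mc_form x) c1 j)"
  proof (rule smooth_on_local[OF pT])
    fix x assume "x \<in> carrier ?T"
    then obtain c where c: "c \<in> atlas LM" "x \<in> cdom (ctangent_chart LM c)" "cdom (ctangent_chart LM c) \<subseteq> carrier ?T"
      using loc by blast
    moreover have "smooth_on ?T (cdom (ctangent_chart LM c)) (\<lambda>x. fst (mc_form x) c1 j)"
      by (rule smooth_on_cong[OF pT sum(1)[OF c(1)]]) (rule mc_form(1)[OF c(1), symmetric])
    ultimately show "\<exists>W'. x \<in> W' \<and> W' \<subseteq> carrier ?T \<and> smooth_on ?T W' (\<lambda>x. fst (mc_form x) c1 j)" by blast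
  qed
  show "smooth_on ?T (carrier ?T) (\<lambda>x. snd (mc_form x) c1 j)"
  proof (rule smooth_on_local[OF pT])
    fix x assume "x \<in> carrier ?T"
    then obtain c where c: "c \<in> atlas LM" "x \<in> cdom (ctangent_chart LM c)" "cdom (ctangent_chart LM c) \<subseteq> carrier ?T"
      using loc by blast
    moreover have "smooth_on ?T (cdom (ctangent_chart LM c)) (\<lambda>x. snd (mc_form x) c1 j)"
      by (rule smooth_on_cong[OF pT sum(2)[OF c(1)]]) (rule mc_form(2)[OF c(1), symmetric])
    ultimately show "\<exists>W'. x \<in> W' \<and> W' \<subseteq> carrier ?T \<and> smooth_on ?T W' (\<lambda>x. snd (mc_form x) c1 j)" by blast
  qed
qed

end

section \<open>Finite-dimensional complex vector spaces as manifolds\<close>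

definition lin_iso :: "(complex, 'v) module \<Rightarrow> nat \<Rightarrow> ('v \<Rightarrow> nat \<Rightarrow> complex) \<Rightarrow> bool" where
  "lin_iso V r f \<longleftrightarrow> f \<in> linear_maps V (Cn r) \<and> bij_betw f (carrier V) (carrier (Cn r))"

text \<open>Closure under the operations is paired with \<open>lin_iso\<close>, whose injectivity
  transports algebraic identities from \<open>Cn r\<close> to \<open>V\<close>.\<close>

definition vec_closed :: "('k, 'v) module \<Rightarrow> bool" where
  "vec_closed V \<longleftrightarrow> (\<forall>u\<in>carrier V. \<forall>v\<in>carrier V. u \<oplus>\<^bsub>V\<^esub> v \<in> carrier V) \<and>
     (\<forall>a. \<forall>u\<in>carrier V. a \<odot>\<^bsub>V\<^esub> u \<in> carrier V)"

definition unrealify :: "nat \<Rightarrow> (nat \<Rightarrow> real) \<Rightarrow> nat \<Rightarrow> complex" where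
  "unrealify r x = (\<lambda>i. if i < r then Complex (x i) (x (r + i)) else 0)"

lemma Cn_simps [simp]:
  "v \<in> carrier (Cn r) \<longleftrightarrow> (\<forall>i\<ge>r. v i = 0)"
  "u \<oplus>\<^bsub>Cn r\<^esub> v = (\<lambda>i. u i + v i)"
  "a \<odot>\<^bsub>Cn r\<^esub> v = (\<lambda>i. a * v i)"
  by (simp_all add: Cn_def mk_module_def)

lemma realify_add: "realify r (\<lambda>i. u i + v i) = (\<lambda>i. realify r u i + realify r v i)"
  by (auto simp: realify_def append_vec_def)

lemma realify_scale: "realify r (\<lambda>i. of_real a * v i) = (\<lambda>i. a * realify r v i)"
  by (auto simp: realify_def append_vec_def)

lemma realify_zero: "realify r (\<lambda>_. 0) = (\<lambda>_. 0)"
  by (auto simp: realify_def append_vec_def)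

lemma realify_euc: "v \<in> carrier (Cn r) \<Longrightarrow> realify r v \<in> euc (2 * r)"
  by (auto simp: realify_def append_vec_def euc_def)

lemma unrealify_Cn: "unrealify r x \<in> carrier (Cn r)"
  by (simp add: unrealify_def)

lemma realify_unrealify: "x \<in> euc (2 * r) \<Longrightarrow> realify r (unrealify r x) = x"
  by (auto simp: realify_def unrealify_def append_vec_def euc_def fun_eq_iff)

lemma unrealify_realify: "v \<in> carrier (Cn r) \<Longrightarrow> unrealify r (realify r v) = v"
  by (auto simp: realify_def unrealify_def append_vec_def fun_eq_iff complex_eq_iff)

lemma unrealify_add: "unrealify r (\<lambda>i. x i + y i) = (\<lambda>i. unrealify r x i + unrealify r y i)"
  by (auto simp: unrealify_def complex_eq_iff)

lemma unrealify_scale: "unrealify r (\<lambda>i. a * x i) = (\<lambda>i. of_real a * unrealify r x i)"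
  by (auto simp: unrealify_def complex_eq_iff)

definition vs_chart :: "(complex, 'v) module \<Rightarrow> nat \<Rightarrow> ('v \<Rightarrow> nat \<Rightarrow> complex) \<Rightarrow> 'v chart" where
  "vs_chart V r f = \<lparr>cdim = 2 * r, cdom = carrier V, cmap = (\<lambda>v\<in>carrier V. realify r (f v))\<rparr>"

text \<open>The inverse of the chart \<open>vs_chart V r f\<close>.\<close>

definition vs_vec :: "(complex, 'v) module \<Rightarrow> nat \<Rightarrow> ('v \<Rightarrow> nat \<Rightarrow> complex) \<Rightarrow> (nat \<Rightarrow> real) \<Rightarrow> 'v" where
  "vs_vec V r f x = inv_into (carrier V) f (unrealify r x)"

lemma linear_mapsD:
  assumes "f \<in> linear_maps V W"
  shows "u \<in> carrier V \<Longrightarrow> f u \<in> carrier W"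
    and "u \<in> carrier V \<Longrightarrow> v \<in> carrier V \<Longrightarrow> f (u \<oplus>\<^bsub>V\<^esub> v) = f u \<oplus>\<^bsub>W\<^esub> f v"
    and "u \<in> carrier V \<Longrightarrow> f (a \<odot>\<^bsub>V\<^esub> u) = a \<odot>\<^bsub>W\<^esub> f u"
  using assms by (auto simp: linear_maps_def)

lemma lin_isoD:
  assumes "lin_iso V r f"
  shows "u \<in> carrier V \<Longrightarrow> f u \<in> carrier (Cn r)"
    and "u \<in> carrier V \<Longrightarrow> v \<in> carrier V \<Longrightarrow> f (u \<oplus>\<^bsub>V\<^esub> v) = (\<lambda>i. f u i + f v i)"
    and "u \<in> carrier V \<Longrightarrow> f (a \<odot>\<^bsub>V\<^esub> u) = (\<lambda>i. a * f u i)"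
    and "inj_on f (carrier V)"
    and "f ` carrier V = carrier (Cn r)"
  using assms linear_mapsD[of f V "Cn r"] by (auto simp: lin_iso_def bij_betw_def simp del: Cn_simps(1))

lemma vs_vec:
  assumes f: "lin_iso V r f"
  shows "vs_vec V r f x \<in> carrier V" "f (vs_vec V r f x) = unrealify r x"
    and "v \<in> carrier V \<Longrightarrow> vs_vec V r f (realify r (f v)) = v"
proof -
  have u: "unrealify r x \<in> f ` carrier V" unfolding lin_isoD(5)[OF f] by (rule unrealify_Cn)
  show "vs_vec V r f x \<in> carrier V" unfolding vs_vec_def by (rule inv_into_into[OF u])
  show "f (vs_vec V r f x) = unrealify r x" unfolding vs_vec_def by (rule f_inv_into_f[OF u])
  show "vs_vec V r f (realify r (f v)) = v" if "v \<in> carrier V"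
    unfolding vs_vec_def unrealify_realify[OF lin_isoD(1)[OF f that]]
    by (rule inv_into_f_f[OF lin_isoD(4)[OF f] that])
qed

text \<open>Here \<open>h\<close> is only real linear, because it will be a real coordinate of a
  complex linear map; hence the \<open>2 * r\<close> real coordinates. The expansion separates the
  variable \<open>v\<close> from finitely many constants, which is how linearity becomes
  smoothness.\<close>

lemma vs_real_linear_expansion:
  fixes h :: "'v \<Rightarrow> real"
  assumes V: "vec_closed V" and f: "lin_iso V r f"
    and add: "\<And>u v. u \<in> carrier V \<Longrightarrow> v \<in> carrier V \<Longrightarrow> h (u \<oplus>\<^bsub>V\<^esub> v) = h u + h v"
    and scale: "\<And>a u. u \<in> carrier V \<Longrightarrow> h (of_real a \<odot>\<^bsub>V\<^esub> u) = a * h u"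
    and v: "v \<in> carrier V"
  shows "h v = (\<Sum>i<2 * r. realify r (f v) i * h (vs_vec V r f (\<lambda>j. if j = i then 1 else 0)))"
proof -
  let ?g = "vs_vec V r f"
  note inj = inj_onD[OF lin_isoD(4)[OF f]]
  have "h (?g (\<lambda>i. x i + y i)) = h (?g x) + h (?g y)" for x y
  proof -
    have "?g (\<lambda>i. x i + y i) = ?g x \<oplus>\<^bsub>V\<^esub> ?g y"
      by (rule inj) (use V vs_vec[OF f] lin_isoD(2)[OF f] in \<open>auto simp: vec_closed_def unrealify_add\<close>)
    then show ?thesis using add vs_vec[OF f] by simp
  qed
  moreover have "h (?g (\<lambda>i. a * x i)) = a * h (?g x)" for a x
  proof -
    have "?g (\<lambda>i. a * x i) = of_real a \<odot>\<^bsub>V\<^esub> ?g x"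
      by (rule inj) (use V vs_vec[OF f] lin_isoD(3)[OF f] in \<open>auto simp: vec_closed_def unrealify_scale\<close>)
    then show ?thesis using scale vs_vec[OF f] by simp
  qed
  ultimately have "h (?g (realify r (f v))) =
      (\<Sum>i<2 * r. realify r (f v) i * h (?g (\<lambda>j. if j = i then 1 else 0)))"
    by (intro real_linear_euc[of "2 * r" "\<lambda>x. h (?g x)"] realify_euc lin_isoD(1)[OF f v])
  then show ?thesis using vs_vec(3)[OF f v] by simp
qed

lemma vs_chart_image:
  assumes "lin_iso V r f"
  shows "cmap (vs_chart V r f) ` carrier V = euc (2 * r)"
proof -
  have "cmap (vs_chart V r f) ` carrier V = realify r ` f ` carrier V"
    unfolding image_image by (rule image_cong) (auto simp: vs_chart_def)
  also have "\<dots> = euc (2 * r)"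
    unfolding lin_isoD(5)[OF assms] using realify_euc realify_unrealify unrealify_Cn
    by (auto simp del: Cn_simps(1)) (metis image_eqI)
  finally show ?thesis .
qed

lemma is_chart_vs:
  assumes f: "lin_iso V r f"
  shows "is_chart (carrier V) (vs_chart V r f)"
proof -
  have "inj_on (cmap (vs_chart V r f)) (carrier V)"
  proof (rule inj_onI)
    fix u v assume uv: "u \<in> carrier V" "v \<in> carrier V" "cmap (vs_chart V r f) u = cmap (vs_chart V r f) v"
    then have "vs_vec V r f (realify r (f u)) = vs_vec V r f (realify r (f v))" by (simp add: vs_chart_def)
    then show "u = v" using vs_vec(3)[OF f] uv by simp
  qed
  then show ?thesis using vs_chart_image[OF f] euc_open_euc by (simp add: is_chart_def vs_chart_def)
qed

text \<open>A transition between linear charts is real linear, so each of its coordinates is a fixed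
  linear form in \<open>2 * r\<close> variables.\<close>

lemma smooth_transition_vs:
  assumes V: "vec_closed V" and f: "lin_iso V r f" and g: "lin_iso V s g"
  shows "smooth_transition (vs_chart V r f) (vs_chart V s g)"
proof -
  let ?c = "vs_chart V r f" and ?d = "vs_chart V s g"
  note cc = is_chart_vs[OF f] and dd = is_chart_vs[OF g]
  have simps: "cdim ?c = 2 * r" "cdim ?d = 2 * s" "cdom ?c = carrier V" "cdom ?d = carrier V"
    by (simp_all add: vs_chart_def)
  have cin: "cinv ?c x \<in> carrier V \<and> realify r (f (cinv ?c x)) = x" if "x \<in> euc (2 * r)" for x
  proof -
    obtain v where v: "v \<in> carrier V" "x = cmap ?c v" using \<open>x \<in> _\<close> vs_chart_image[OF f] by blast
    then have "cinv ?c x = v" using cinv_cmap[OF cc] simps by simp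
    then show ?thesis using v by (simp add: vs_chart_def)
  qed
  have "euc_smooth (2 * r) (euc (2 * r)) (2 * s) (\<lambda>x. cmap ?d (cinv ?c x))"
    unfolding euc_smooth_iff
  proof (intro conjI allI impI)
    show "(\<lambda>x. cmap ?d (cinv ?c x)) ` euc (2 * r) \<subseteq> euc (2 * s)"
      using cin chart_euc[OF dd] simps by auto
    fix j assume "j < 2 * s"
    let ?b = "\<lambda>i. realify s (g (vs_vec V r f (\<lambda>j. if j = i then 1 else 0))) j"
    have *: "realify s (g v) j = (\<Sum>i<2 * r. realify r (f v) i * ?b i)" if "v \<in> carrier V" for v
      by (rule vs_real_linear_expansion[OF V f _ _ that])
        (use lin_isoD(2,3)[OF g] in \<open>auto simp: realify_add realify_scale\<close>)
    show "smooth_fn (2 * r) (euc (2 * r)) (\<lambda>x. cmap ?d (cinv ?c x) j)"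
    proof (rule smooth_fn_cong[OF euc_open_euc])
      show "smooth_fn (2 * r) (euc (2 * r)) (\<lambda>x. \<Sum>i<2 * r. x i * ?b i)"
        by (intro smooth_fn_sum smooth_fn_mult smooth_fn_const smooth_fn_coord euc_open_euc) auto
      show "(\<Sum>i<2 * r. x i * ?b i) = cmap ?d (cinv ?c x) j" if "x \<in> euc (2 * r)" for x
        using *[of "cinv ?c x"] cin[OF that] by (simp add: vs_chart_def)
    qed
  qed
  then show ?thesis unfolding smooth_transition_iff using simps vs_chart_image[OF f] euc_open_euc by simp
qed

lemma carrier_vs_manifold [simp]: "carrier (vs_manifold V) = carrier V"
  by (simp add: vs_manifold_def)

lemma premanifold_vs:
  assumes V: "vec_closed V" and f: "lin_iso V r f"
  shows "premanifold (vs_manifold V)" "vs_chart V r f \<in> atlas (vs_manifold V)"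
proof -
  let ?A = "{vs_chart V r f |r f. lin_iso V r f}"
  have 1: "carrier (vs_manifold V) = carrier V" "atlas (vs_manifold V) = max_atlas (carrier V) ?A"
    by (simp_all add: vs_manifold_def vs_chart_def lin_iso_def)
  have 2: "\<Union>(cdom ` ?A) = carrier V" using f by (auto simp: vs_chart_def cong: conj_cong) (metis chart.select_convs(2))
  have 3: "is_chart (carrier V) a" if "a \<in> ?A" for a using that is_chart_vs by blast
  have 4: "smooth_transition a b" if "a \<in> ?A" "b \<in> ?A" for a b
    using that smooth_transition_vs[OF V] by blast
  show "premanifold (vs_manifold V)" by (rule premanifold_max_atlas(1)[OF 1 2 3 4])
  show "vs_chart V r f \<in> atlas (vs_manifold V)" using premanifold_max_atlas(2)[OF 1 2 3 4] f by blast
qed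

lemma smooth_on_vs_coord:
  assumes V: "vec_closed V" and f: "lin_iso V r f" and i: "i < 2 * r"
  shows "smooth_on (vs_manifold V) (carrier V) (\<lambda>v. realify r (f v) i)"
proof -
  note p = premanifold_vs[OF V f]
  have "smooth_on (vs_manifold V) (carrier V) (\<lambda>v. cmap (vs_chart V r f) v i)"
    using smooth_on_coord[OF p] i by (simp add: vs_chart_def)
  then show ?thesis by (rule smooth_on_cong[OF p(1)]) (simp add: vs_chart_def)
qed

text \<open>A linear isomorphism with \<open>Cn r\<close> gives one global chart, so no localisation
  on \<open>P\<close> is necessary.\<close>

lemma smooth_map_vsI:
  assumes V: "vec_closed V" and f: "lin_iso V r f" and P: "premanifold P"
    and g: "\<And>p. p \<in> carrier P \<Longrightarrow> g p \<in> carrier V"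
    and sm: "\<And>i. i < 2 * r \<Longrightarrow> smooth_on P (carrier P) (\<lambda>p. realify r (f (g p)) i)"
  shows "smooth_map P (vs_manifold V) g"
proof (rule smooth_mapI[OF P premanifold_vs(1)[OF V f]])
  fix p assume p: "p \<in> carrier P"
  have "smooth_on P (carrier P) (\<lambda>p. cmap (vs_chart V r f) (g p) i)" if "i < 2 * r" for i
    by (rule smooth_on_cong[OF P sm[OF that]]) (use g in \<open>simp add: vs_chart_def\<close>)
  then show "\<exists>W. \<exists>d\<in>atlas (vs_manifold V). p \<in> W \<and> mopen P W \<and> g ` W \<subseteq> cdom d \<and>
       (\<forall>i<cdim d. smooth_on P W (\<lambda>p. cmap d (g p) i))"
    using p g mopen_carrier[OF P] premanifold_vs(2)[OF V f]
    by (intro exI[of _ "carrier P"] bexI[of _ "vs_chart V r f"]) (auto simp: vs_chart_def)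
qed (use g in simp)

lemma vec_closed_Cn: "vec_closed (Cn r)"
  by (simp add: vec_closed_def)

lemma lin_iso_Cn: "lin_iso (Cn r) r (\<lambda>v. v)"
  by (simp add: lin_iso_def linear_maps_def bij_betw_def)

lemma vec_closed_ctangent: "vec_closed (ctangent_space M p)"
  unfolding vec_closed_def by (auto intro: ctangent_space_closed)

definition ctangent_coord :: "'a chart \<Rightarrow> 'a ctvec \<Rightarrow> nat \<Rightarrow> complex" where
  "ctangent_coord c a = (\<lambda>i. if i < cdim c then Complex (fst a c i) (snd a c i) else 0)"

text \<open>The pair (u, v) stands for u + iv, so its complex coordinates are u_k + i v_k,
  compatibly with the scalar multiplication in \<open>complexification\<close>. Surjectivity comes
  from \<open>tangent_of\<close>.\<close>

lemma lin_iso_ctangent: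
  assumes M: "premanifold M" and c: "c \<in> charts_at M p"
  shows "lin_iso (ctangent_space M p) (cdim c) (ctangent_coord c)"
proof -
  have "ctangent_coord c \<in> linear_maps (ctangent_space M p) (Cn (cdim c))"
    unfolding linear_maps_def
    by (auto simp: ctangent_coord_def ctangent_space_ops tangent_space_ops(1,2)[OF c]
        fun_eq_iff complex_eq_iff algebra_simps)
  moreover have "bij_betw (ctangent_coord c) (carrier (ctangent_space M p)) (carrier (Cn (cdim c)))"
  proof (rule bij_betwI')
    fix a b assume a: "a \<in> carrier (ctangent_space M p)" and b: "b \<in> carrier (ctangent_space M p)"
    have "a = b" if eq: "ctangent_coord c a = ctangent_coord c b"
    proof -
      have "fst a c i = fst b c i \<and> snd a c i = snd b c i" for i
        using fun_cong[OF eq, of i] ctangent_euc[OF a c] ctangent_euc[OF b c]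
        by (cases "i < cdim c") (auto simp: ctangent_coord_def euc_def)
      then show ?thesis using ctangent_vector_eqI[OF a b c] by blast
    qed
    then show "(ctangent_coord c a = ctangent_coord c b) = (a = b)" by blast
  next
    fix a assume "a \<in> carrier (ctangent_space M p)"
    show "ctangent_coord c a \<in> carrier (Cn (cdim c))" by (simp add: ctangent_coord_def)
  next
    fix w assume w: "w \<in> carrier (Cn (cdim c))"
    have e: "(\<lambda>i. Re (w i)) \<in> euc (cdim c)" "(\<lambda>i. Im (w i)) \<in> euc (cdim c)"
      using w by (auto simp: euc_def)
    let ?a = "(tangent_of M p c (\<lambda>i. Re (w i)), tangent_of M p c (\<lambda>i. Im (w i)))"
    have "?a \<in> carrier (ctangent_space M p)"
      using tangent_of(1)[OF M c] e by (simp add: carrier_ctangent_space)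
    moreover have "ctangent_coord c ?a = w"
      using tangent_of(2)[OF M c] e w by (auto simp: ctangent_coord_def fun_eq_iff)
    ultimately show "\<exists>a\<in>carrier (ctangent_space M p). w = ctangent_coord c a" by metis
  qed
  ultimately show ?thesis by (simp add: lin_iso_def)
qed

lemma realify_ctangent_coord:
  assumes "i < 2 * cdim c"
  shows "realify (cdim c) (ctangent_coord c a) i = (if i < cdim c then fst a c i else snd a c (i - cdim c))"
  using assms by (auto simp: realify_def append_vec_def ctangent_coord_def)

section \<open>Complex vector bundles\<close>

lemma fibre_simps [simp]:
  "e \<in> carrier (fibre E x) \<longleftrightarrow> e \<in> pts E \<and> bproj E e = x"
  "\<zero>\<^bsub>fibre E x\<^esub> = bzero E x"
  "e \<oplus>\<^bsub>fibre E x\<^esub> f = badd E e f"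
  "a \<odot>\<^bsub>fibre E x\<^esub> e = bsmult E a e"
  by (simp_all add: fibre_def mk_module_def)

locale vector_bundle =
  fixes X :: "'x manifold" and E :: "('x, 'e) cvbundle"
  assumes X: "premanifold X" and E: "complex_vector_bundle X E"
begin

lemma premanifold_tot: "premanifold (tot E)"
  by (rule smooth_manifold_premanifold) (use E in \<open>simp add: complex_vector_bundle_def\<close>)

lemma smooth_bproj: "smooth_map (tot E) X (bproj E)"
  using E by (simp add: complex_vector_bundle_def)

lemma bproj_in: "e \<in> pts E \<Longrightarrow> bproj E e \<in> carrier X"
  by (rule smooth_map_carrier[OF smooth_bproj])

lemma module_fibre: "x \<in> carrier X \<Longrightarrow> Module.module complex_field (fibre E x)"
  using E by (simp add: complex_vector_bundle_def)

lemma abelian_group_fibre: "x \<in> carrier X \<Longrightarrow> abelian_group (fibre E x)"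
  using module_fibre Module.module.axioms(2) by blast

lemma badd_closed:
  assumes "e \<in> pts E" "f \<in> pts E" "bproj E f = bproj E e"
  shows "badd E e f \<in> pts E" "bproj E (badd E e f) = bproj E e"
proof -
  interpret abelian_group "fibre E (bproj E e)" by (rule abelian_group_fibre[OF bproj_in[OF assms(1)]])
  show "badd E e f \<in> pts E" "bproj E (badd E e f) = bproj E e"
    using a_closed[of e f] assms by simp_all
qed

lemma bzero_in:
  assumes "x \<in> carrier X"
  shows "bzero E x \<in> pts E" "bproj E (bzero E x) = x"
proof -
  interpret abelian_group "fibre E x" by (rule abelian_group_fibre[OF assms])
  show "bzero E x \<in> pts E" "bproj E (bzero E x) = x" using zero_closed by simp_all
qed

lemma badd_comm:
  assumes "e \<in> pts E" "f \<in> pts E" "bproj E f = bproj E e"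
  shows "badd E e f = badd E f e"
proof -
  interpret abelian_group "fibre E (bproj E e)" by (rule abelian_group_fibre[OF bproj_in[OF assms(1)]])
  show ?thesis using a_comm[of e f] assms by simp
qed

lemma badd_assoc:
  assumes "e \<in> pts E" "f \<in> pts E" "bproj E f = bproj E e" "g \<in> pts E" "bproj E g = bproj E e"
  shows "badd E (badd E e f) g = badd E e (badd E f g)"
proof -
  interpret abelian_group "fibre E (bproj E e)" by (rule abelian_group_fibre[OF bproj_in[OF assms(1)]])
  show ?thesis using a_assoc[of e f g] assms by simp
qed

lemma badd_zero:
  assumes "e \<in> pts E"
  shows "badd E (bzero E (bproj E e)) e = e" "badd E e (bzero E (bproj E e)) = e"
proof -
  interpret abelian_group "fibre E (bproj E e)" by (rule abelian_group_fibre[OF bproj_in[OF assms]])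
  show "badd E (bzero E (bproj E e)) e = e" "badd E e (bzero E (bproj E e)) = e"
    using l_zero[of e] r_zero[of e] assms by simp_all
qed

lemma bsmult_closed:
  assumes "e \<in> pts E"
  shows "bsmult E a e \<in> pts E" "bproj E (bsmult E a e) = bproj E e"
proof -
  interpret Module.module complex_field "fibre E (bproj E e)" by (rule module_fibre[OF bproj_in[OF assms]])
  show "bsmult E a e \<in> pts E" "bproj E (bsmult E a e) = bproj E e"
    using smult_closed[of a e] assms by (simp_all add: complex_field_def)
qed

lemma bsmult_badd:
  assumes "e \<in> pts E" "f \<in> pts E" "bproj E f = bproj E e"
  shows "bsmult E a (badd E e f) = badd E (bsmult E a e) (bsmult E a f)"
proof -
  interpret Module.module complex_field "fibre E (bproj E e)" by (rule module_fibre[OF bproj_in[OF assms(1)]])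
  show ?thesis using smult_r_distr[of a e f] assms by (simp add: complex_field_def)
qed

lemma bsmult_bzero:
  assumes "x \<in> carrier X"
  shows "bsmult E a (bzero E x) = bzero E x"
proof -
  interpret Module.module complex_field "fibre E x" by (rule module_fibre[OF assms])
  show ?thesis using smult_r_null[of a] assms by (simp add: complex_field_def)
qed

text \<open>This identity is the source of every statement that a map preserves zero, since
  \<open>linear_maps\<close> mentions sums and multiples only.\<close>

lemma bsmult_0:
  assumes "e \<in> pts E"
  shows "bsmult E 0 e = bzero E (bproj E e)"
proof -
  interpret Module.module complex_field "fibre E (bproj E e)" by (rule module_fibre[OF bproj_in[OF assms(1)]])
  show ?thesis using smult_l_null[of e] assms by (simp add: complex_field_def)
qed

section \<open>Local trivializations\<close>

lemma trivialization_exists: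
  "x \<in> carrier X \<Longrightarrow> \<exists>U r \<tau>. x \<in> U \<and> local_trivialization X E U r \<tau>"
  using E by (simp add: complex_vector_bundle_def)

abbreviation over :: "'x set \<Rightarrow> 'e set" where
  "over U \<equiv> {e \<in> pts E. bproj E e \<in> U}"

context
  fixes U r \<tau>
  assumes triv: "local_trivialization X E U r \<tau>"
begin

lemma mopen_base: "mopen X U"
  using triv openin_mtop[OF X] by (simp add: local_trivialization_def)

lemma mopen_over: "mopen (tot E) (over U)"
  by (rule mopen_vimage[OF premanifold_tot X smooth_bproj mopen_base])

lemma premanifold_trivialization:
  "premanifold (open_submanifold (tot E) (over U))" "premanifold (open_submanifold X U)"
  "premanifold (vs_manifold (Cn r))"
  "premanifold (prod_manifold (open_submanifold X U) (vs_manifold (Cn r)))"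
  by (intro premanifold_open_submanifold premanifold_tot mopen_over X mopen_base
      premanifold_prod(1) premanifold_vs[OF vec_closed_Cn lin_iso_Cn])+

lemma trivialization_smooth:
  "smooth_map (open_submanifold (tot E) (over U))
     (prod_manifold (open_submanifold X U) (vs_manifold (Cn r))) (\<lambda>e. (bproj E e, \<tau> e))"
  "smooth_map (prod_manifold (open_submanifold X U) (vs_manifold (Cn r)))
     (open_submanifold (tot E) (over U)) (the_inv_into (over U) (\<lambda>e. (bproj E e, \<tau> e)))"
  "bij_betw (\<lambda>e. (bproj E e, \<tau> e)) (over U) (U \<times> carrier (Cn r))"
  using triv unfolding local_trivialization_def diffeomorphism_def by simp_all

lemma trivialization_linear:
  "e \<in> over U \<Longrightarrow> \<tau> e \<in> carrier (Cn r)"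
  "e \<in> over U \<Longrightarrow> f \<in> over U \<Longrightarrow> bproj E f = bproj E e \<Longrightarrow> \<tau> (badd E e f) = (\<lambda>i. \<tau> e i + \<tau> f i)"
  "e \<in> over U \<Longrightarrow> \<tau> (bsmult E a e) = (\<lambda>i. a * \<tau> e i)"
  using triv linear_mapsD[of \<tau> "fibre E (bproj E e)" "Cn r"] unfolding local_trivialization_def
  by (auto simp del: Cn_simps(1))

lemma trivialization_bzero: "x \<in> U \<Longrightarrow> \<tau> (bzero E x) = (\<lambda>_. 0)"
  using trivialization_linear(3)[of "bzero E x" 0] bsmult_bzero[of x 0] bzero_in[of x]
    mopen_subset[OF mopen_base] by auto

lemma smooth_on_trivialization:
  assumes i: "i < 2 * r"
  shows "smooth_on (tot E) (over U) (\<lambda>e. realify r (\<tau> e) i)"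
proof -
  let ?T = "open_submanifold (tot E) (over U)"
  note pm = premanifold_trivialization
  have "smooth_map ?T (vs_manifold (Cn r)) (\<lambda>e. snd (bproj E e, \<tau> e))"
    by (rule smooth_map_compose[OF pm(1,4,3) trivialization_smooth(1) smooth_map_snd[OF pm(2,3)]])
  then have "smooth_map ?T (vs_manifold (Cn r)) \<tau>" by simp
  from smooth_on_pullback[OF pm(1,3) this smooth_on_vs_coord[OF vec_closed_Cn lin_iso_Cn i]]
  have "smooth_on ?T {e \<in> over U. \<tau> e \<in> carrier (Cn r)} (\<lambda>e. realify r (\<tau> e) i)" by simp
  moreover have "{e \<in> over U. \<tau> e \<in> carrier (Cn r)} = over U" using trivialization_linear(1) by blast
  ultimately show ?thesis using smooth_on_open_submanifoldD[OF premanifold_tot mopen_over] by simp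
qed

end

text \<open>Over \<open>U\<close> the map is the inverse trivialization applied to the pair of base
  point and fibre coordinates, hence a composition of smooth maps. Fibrewise formulas can thus be
  checked in coordinates, where addition is ordinary addition.\<close>

lemma smooth_map_totI:
  assumes P: "premanifold P" and h: "\<And>p. p \<in> carrier P \<Longrightarrow> h p \<in> pts E"
    and base: "smooth_map P X (\<lambda>p. bproj E (h p))"
    and coord: "\<And>U r \<tau> i. local_trivialization X E U r \<tau> \<Longrightarrow> i < 2 * r \<Longrightarrow>
      smooth_on P {p \<in> carrier P. bproj E (h p) \<in> U} (\<lambda>p. realify r (\<tau> (h p)) i)"
  shows "smooth_map P (tot E) h"
proof (rule smooth_map_local)
  fix p assume p: "p \<in> carrier P"
  obtain U r \<tau> where U: "bproj E (h p) \<in> U" and triv: "local_trivialization X E U r \<tau>"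
    using trivialization_exists[OF bproj_in[OF h[OF p]]] by blast
  note pm = premanifold_trivialization[OF triv]
  let ?W = "{p \<in> carrier P. bproj E (h p) \<in> U}"
  let ?P = "open_submanifold P ?W"
  have W: "mopen P ?W" by (rule mopen_vimage[OF P X base mopen_base[OF triv]])
  note pP = premanifold_open_submanifold[OF P W]
  have 1: "smooth_map ?P (open_submanifold X U) (\<lambda>p. bproj E (h p))"
    by (rule smooth_map_corestrict[OF pP X mopen_base[OF triv] smooth_map_restrict[OF P X W base]]) auto
  have 2: "smooth_map ?P (vs_manifold (Cn r)) (\<lambda>p. \<tau> (h p))"
  proof (rule smooth_map_vsI[OF vec_closed_Cn lin_iso_Cn pP])
    show "\<tau> (h p) \<in> carrier (Cn r)" if "p \<in> carrier ?P" for p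
      using trivialization_linear(1)[OF triv, of "h p"] that h by simp
    show "smooth_on ?P (carrier ?P) (\<lambda>p. realify r (\<tau> (h p)) i)" if "i < 2 * r" for i
      using smooth_on_open_submanifold[OF P W coord[OF triv that]] by simp
  qed
  let ?k = "the_inv_into (over U) (\<lambda>e. (bproj E e, \<tau> e))"
  have "smooth_map ?P (open_submanifold (tot E) (over U)) (\<lambda>p. ?k (bproj E (h p), \<tau> (h p)))"
    by (rule smooth_map_compose[OF pP pm(4,1) smooth_map_Pair[OF pP pm(2,3) 1 2] trivialization_smooth(2)[OF triv]])
  then have "smooth_map ?P (open_submanifold (tot E) (over U)) h"
  proof (rule smooth_map_cong[OF pP pm(1)])
    fix q assume "q \<in> carrier ?P"
    then have "h q \<in> over U" using h by simp
    then show "?k (bproj E (h q), \<tau> (h q)) = h q"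
      using the_inv_into_f_f[OF bij_betw_imp_inj_on[OF trivialization_smooth(3)[OF triv]]] by simp
  qed
  then have "smooth_map ?P (tot E) h" by (rule smooth_map_extend_codomain) auto
  then show "\<exists>W. p \<in> W \<and> smooth_map (open_submanifold P W) (tot E) h"
    using p U by (intro exI[of _ ?W]) simp
qed

text \<open>By linearity the zero vector has constant coordinates 0 in every trivialization.\<close>

lemma smooth_bzero: "smooth_map X (tot E) (bzero E)"
proof (rule smooth_map_totI[OF X bzero_in(1)])
  show "smooth_map X X (\<lambda>x. bproj E (bzero E x))"
    by (rule smooth_map_cong[OF X X smooth_map_id[OF X]]) (simp add: bzero_in)
  fix U r \<tau> i assume triv: "local_trivialization X E U r \<tau>"
  have "{p \<in> carrier X. bproj E (bzero E p) \<in> U} = U"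
    using mopen_subset[OF mopen_base[OF triv]] bzero_in by auto
  moreover have "smooth_on X U (\<lambda>p. realify r (\<tau> (bzero E p)) i)"
    by (rule smooth_on_cong[OF X smooth_on_const[OF mopen_base[OF triv], of 0]])
      (simp add: trivialization_bzero[OF triv] realify_zero)
  ultimately show "smooth_on X {p \<in> carrier X. bproj E (bzero E p) \<in> U} (\<lambda>p. realify r (\<tau> (bzero E p)) i)"
    by simp
qed

section \<open>Sections\<close>

lemma sections_iff: "s \<in> carrier (sections X E) \<longleftrightarrow>
    s \<in> extensional (carrier X) \<and> smooth_map X (tot E) s \<and> (\<forall>x\<in>carrier X. bproj E (s x) = x)"
  by (simp add: sections_def mk_module_def)

lemma sections_ops:
  "x \<in> carrier X \<Longrightarrow> (s \<oplus>\<^bsub>sections X E\<^esub> s') x = badd E (s x) (s' x)"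
  "x \<in> carrier X \<Longrightarrow> (a \<odot>\<^bsub>sections X E\<^esub> s) x = bsmult E a (s x)"
  by (simp_all add: sections_def mk_module_def)

lemma sections_ext:
  "s \<oplus>\<^bsub>sections X E\<^esub> s' \<in> extensional (carrier X)" "a \<odot>\<^bsub>sections X E\<^esub> s \<in> extensional (carrier X)"
  by (simp_all add: sections_def mk_module_def)

lemma sectionD:
  assumes "s \<in> carrier (sections X E)" "x \<in> carrier X"
  shows "s x \<in> pts E" "bproj E (s x) = x"
  using assms smooth_map_carrier[of X "tot E" s x] unfolding sections_iff by simp_all

text \<open>In a local trivialization, \<open>\<rho>\<close> is a linear combination of finitely many fixed sections
  whose coefficients are the coordinates of its argument.\<close>

lemma smooth_badd_section:
  assumes V: "vec_closed V" and f: "lin_iso V n f" and \<rho>: "\<rho> \<in> linear_maps V (sections X E)"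
    and P: "premanifold P" and y: "smooth_map P X y" and e: "smooth_map P (tot E) e"
    and ey: "\<And>p. p \<in> carrier P \<Longrightarrow> bproj E (e p) = y p"
    and a: "\<And>p. p \<in> carrier P \<Longrightarrow> a p \<in> carrier V"
    and ac: "\<And>k. k < 2 * n \<Longrightarrow> smooth_on P (carrier P) (\<lambda>p. realify n (f (a p)) k)"
  shows "smooth_map P (tot E) (\<lambda>p. badd E (e p) (\<rho> (a p) (y p)))"
proof (rule smooth_map_totI[OF P])
  have \<rho>s: "\<rho> v \<in> carrier (sections X E)" if "v \<in> carrier V" for v using linear_mapsD(1)[OF \<rho> that] .
  have yX: "y p \<in> carrier X" if "p \<in> carrier P" for p using smooth_map_carrier[OF y that] .
  have eE: "e p \<in> pts E" if "p \<in> carrier P" for p using smooth_map_carrier[OF e that] .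
  have \<rho>E: "\<rho> v (y p) \<in> pts E" "bproj E (\<rho> v (y p)) = y p" if "p \<in> carrier P" "v \<in> carrier V" for p v
    using sectionD[OF \<rho>s[OF that(2)] yX[OF that(1)]] by auto
  show "badd E (e p) (\<rho> (a p) (y p)) \<in> pts E" if "p \<in> carrier P" for p
    using badd_closed eE \<rho>E ey a that by simp
  have bp: "bproj E (badd E (e p) (\<rho> (a p) (y p))) = y p" if "p \<in> carrier P" for p
    using badd_closed eE \<rho>E ey a that by simp
  show "smooth_map P X (\<lambda>p. bproj E (badd E (e p) (\<rho> (a p) (y p))))"
    by (rule smooth_map_cong[OF P X y]) (simp add: bp)
  fix U r \<tau> i assume triv: "local_trivialization X E U r \<tau>" and i: "i < 2 * r"
  let ?W = "{p \<in> carrier P. y p \<in> U}"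
  have W: "mopen P ?W" by (rule mopen_vimage[OF P X y mopen_base[OF triv]])
  \<comment> \<open>A real basis of \<open>V\<close>; the sections \<open>\<rho> (?b k)\<close> are
    the finitely many fixed ones.\<close>
  let ?b = "\<lambda>k. vs_vec V n f (\<lambda>j. if j = k then 1 else 0)"
  have co: "smooth_on P ?W (\<lambda>p. realify r (\<tau> (h p)) i)"
    if h: "smooth_map P (tot E) h" and hy: "\<And>p. p \<in> carrier P \<Longrightarrow> bproj E (h p) = y p" for h
    by (rule smooth_on_subset[OF smooth_on_pullback[OF P premanifold_tot h smooth_on_trivialization[OF triv i]] W])
      (use hy smooth_map_carrier[OF h] in auto)
  have s: "smooth_on P ?W (\<lambda>p. realify r (\<tau> (\<rho> v (y p))) i)" if v: "v \<in> carrier V" for v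
    by (rule co) (use smooth_map_compose[OF P X premanifold_tot y] \<rho>s[OF v] \<rho>E v in \<open>auto simp: sections_iff\<close>)
  have "smooth_on P ?W (\<lambda>p. realify r (\<tau> (e p)) i + (\<Sum>k<2 * n. realify n (f (a p)) k * realify r (\<tau> (\<rho> (?b k) (y p))) i))"
    by (intro smooth_on_add smooth_on_sum smooth_on_mult co e ey W s vs_vec[OF f] smooth_on_subset[OF ac]) auto
  then have "smooth_on P ?W (\<lambda>p. realify r (\<tau> (badd E (e p) (\<rho> (a p) (y p)))) i)"
  proof (rule smooth_on_cong[OF P])
    fix p assume p: "p \<in> ?W"
    then have pP: "p \<in> carrier P" and yU: "y p \<in> U" by auto
    have inU: "\<rho> v (y p) \<in> over U" if "v \<in> carrier V" for v using \<rho>E[OF pP that] yU by simp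
    have eU: "e p \<in> over U" using eE[OF pP] ey[OF pP] yU by simp
    have "realify r (\<tau> (\<rho> (a p) (y p))) i =
        (\<Sum>k<2 * n. realify n (f (a p)) k * realify r (\<tau> (\<rho> (?b k) (y p))) i)"
    \<comment> \<open>With \<open>p\<close> frozen, a coordinate of \<open>\<rho> v (y p)\<close> is
      a real linear function of \<open>v\<close>, which is then evaluated at
      \<open>a p\<close>.\<close>
    proof (rule vs_real_linear_expansion[OF V f _ _ a[OF pP], where h = "\<lambda>v. realify r (\<tau> (\<rho> v (y p))) i"])
      fix u v assume uv: "u \<in> carrier V" "v \<in> carrier V"
      have "\<rho> (u \<oplus>\<^bsub>V\<^esub> v) (y p) = badd E (\<rho> u (y p)) (\<rho> v (y p))"
        using linear_mapsD(2)[OF \<rho> uv] sections_ops(1)[OF yX[OF pP]] by simp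
      then show "realify r (\<tau> (\<rho> (u \<oplus>\<^bsub>V\<^esub> v) (y p))) i = realify r (\<tau> (\<rho> u (y p))) i + realify r (\<tau> (\<rho> v (y p))) i"
        using trivialization_linear(2)[OF triv inU[OF uv(1)] inU[OF uv(2)]] \<rho>E[OF pP] uv
        by (simp add: realify_add)
    next
      fix b u assume u: "u \<in> carrier V"
      have "\<rho> (of_real b \<odot>\<^bsub>V\<^esub> u) (y p) = bsmult E (of_real b) (\<rho> u (y p))"
        using linear_mapsD(3)[OF \<rho> u] sections_ops(2)[OF yX[OF pP]] by simp
      then show "realify r (\<tau> (\<rho> (of_real b \<odot>\<^bsub>V\<^esub> u) (y p))) i = b * realify r (\<tau> (\<rho> u (y p))) i"
        using trivialization_linear(3)[OF triv inU[OF u]] by (simp add: realify_scale)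
    qed
    moreover have "\<tau> (badd E (e p) (\<rho> (a p) (y p))) = (\<lambda>i. \<tau> (e p) i + \<tau> (\<rho> (a p) (y p)) i)"
      by (rule trivialization_linear(2)[OF triv eU inU[OF a[OF pP]]]) (use \<rho>E[OF pP a[OF pP]] ey[OF pP] in simp)
    ultimately show "realify r (\<tau> (e p)) i + (\<Sum>k<2 * n. realify n (f (a p)) k * realify r (\<tau> (\<rho> (?b k) (y p))) i) =
        realify r (\<tau> (badd E (e p) (\<rho> (a p) (y p)))) i"
      by (simp add: realify_add)
  qed
  moreover have "{p \<in> carrier P. bproj E (badd E (e p) (\<rho> (a p) (y p))) \<in> U} = ?W" using bp by auto
  ultimately show "smooth_on P {p \<in> carrier P. bproj E (badd E (e p) (\<rho> (a p) (y p))) \<in> U}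
      (\<lambda>p. realify r (\<tau> (badd E (e p) (\<rho> (a p) (y p)))) i)" by simp
qed

end

section \<open>Categories\<close>

text \<open>Morphisms are extensional functions between the sets \<open>P a\<close>, so the unit and
  associativity laws hold as equations between functions.\<close>

lemma concrete_category:
  assumes Hom: "\<And>a b f. a \<in> Obj C \<Longrightarrow> b \<in> Obj C \<Longrightarrow> f \<in> Hom C a b \<Longrightarrow> f \<in> extensional (P a) \<and> f \<in> P a \<rightarrow> P b"
    and id: "\<And>a. a \<in> Obj C \<Longrightarrow> (\<lambda>e\<in>P a. e) \<in> Hom C a a"
    and comp: "\<And>a b c f g. a \<in> Obj C \<Longrightarrow> b \<in> Obj C \<Longrightarrow> c \<in> Obj C \<Longrightarrow> f \<in> Hom C a b \<Longrightarrow> g \<in> Hom C b c \<Longrightarrow>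
        compose (P a) g f \<in> Hom C a c"
    and Comp: "\<And>a b c f g. Comp C a b c g f = compose (P a) g f"
    and Idn: "\<And>a. Idn C a = (\<lambda>e\<in>P a. e)"
  shows "is_category C"
  unfolding is_category_def Comp Idn
proof (intro conjI ballI)
  fix a b f assume "a \<in> Obj C" "b \<in> Obj C" "f \<in> Hom C a b"
  then have "f \<in> extensional (P a)" "f \<in> P a \<rightarrow> P b" using Hom by blast+
  then show "compose (P a) f (\<lambda>e\<in>P a. e) = f" "compose (P a) (\<lambda>e\<in>P b. e) f = f"
    by (auto simp: compose_def fun_eq_iff extensional_def)
next
  fix a b c d f g h assume "a \<in> Obj C" "b \<in> Obj C" "c \<in> Obj C" "f \<in> Hom C a b"
  then have "f \<in> P a \<rightarrow> P b" using Hom by blast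
  then show "compose (P a) h (compose (P a) g f) = compose (P a) (compose (P b) h g) f"
    by (auto simp: compose_def fun_eq_iff)
qed (use id comp in auto)

text \<open>Both functors leave the underlying functions unchanged. The category axioms of
  \<open>D\<close> are pulled back along \<open>K\<close>, so they are checked in \<open>C\<close>
  only.\<close>

lemma isomorphic_categoriesI:
  assumes C: "is_category C"
    and F: "\<And>a. a \<in> Obj C \<Longrightarrow> F a \<in> Obj D \<and> K (F a) = a"
    and K: "\<And>b. b \<in> Obj D \<Longrightarrow> K b \<in> Obj C \<and> F (K b) = b"
    and Hom: "\<And>a b. a \<in> Obj C \<Longrightarrow> b \<in> Obj C \<Longrightarrow> Hom D (F a) (F b) = Hom C a b"
    and Comp: "\<And>a b c f g. a \<in> Obj C \<Longrightarrow> b \<in> Obj C \<Longrightarrow> c \<in> Obj C \<Longrightarrow>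
        Comp D (F a) (F b) (F c) g f = Comp C a b c g f"
    and Idn: "\<And>a. a \<in> Obj C \<Longrightarrow> Idn D (F a) = Idn C a"
  shows "isomorphic_categories C D"
proof -
  have Hom': "Hom D a b = Hom C (K a) (K b)" if "a \<in> Obj D" "b \<in> Obj D" for a b
    using Hom[of "K a" "K b"] K that by auto
  have Comp': "Comp D a b c g f = Comp C (K a) (K b) (K c) g f"
    if "a \<in> Obj D" "b \<in> Obj D" "c \<in> Obj D" for a b c f g
    using Comp[of "K a" "K b" "K c"] K that by auto
  have Idn': "Idn D a = Idn C (K a)" if "a \<in> Obj D" for a
    using Idn[of "K a"] K that by auto
  have KC: "K a \<in> Obj C" if "a \<in> Obj D" for a using K that by blast
  have "is_category D"
    unfolding is_category_def
  proof (intro conjI ballI)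
    show "Idn D a \<in> Hom D a a" if "a \<in> Obj D" for a
      using C KC that unfolding is_category_def by (simp add: Hom' Idn')
    show "Comp D a b c g f \<in> Hom D a c"
      if "a \<in> Obj D" "b \<in> Obj D" "c \<in> Obj D" "f \<in> Hom D a b" "g \<in> Hom D b c" for a b c f g
      using C KC that unfolding is_category_def by (simp add: Hom' Comp')
    show "Comp D a a b f (Idn D a) = f" "Comp D a b b (Idn D b) f = f"
      if "a \<in> Obj D" "b \<in> Obj D" "f \<in> Hom D a b" for a b f
      using C KC that unfolding is_category_def by (simp_all add: Hom' Comp' Idn')
    show "Comp D a c d h (Comp D a b c g f) = Comp D a b d (Comp D b c d h g) f"
      if o: "a \<in> Obj D" "b \<in> Obj D" "c \<in> Obj D" "d \<in> Obj D"
        and m: "f \<in> Hom D a b" "g \<in> Hom D b c" "h \<in> Hom D c d" for a b c d f g h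
    proof -
      have "\<forall>a\<in>Obj C. \<forall>b\<in>Obj C. \<forall>c\<in>Obj C. \<forall>d\<in>Obj C. \<forall>f\<in>Hom C a b. \<forall>g\<in>Hom C b c. \<forall>h\<in>Hom C c d.
        Comp C a c d h (Comp C a b c g f) = Comp C a b d (Comp C b c d h g) f"
        using C unfolding is_category_def by blast
      then show ?thesis using KC o m by (simp add: Hom' Comp')
    qed
  qed
  moreover have "is_functor C D F (\<lambda>_ _ f. f)"
    unfolding is_functor_def using F Hom Comp Idn by auto
  moreover have "is_functor D C K (\<lambda>_ _ f. f)"
    unfolding is_functor_def using KC Hom' Comp' Idn' by auto
  ultimately show ?thesis
    unfolding isomorphic_categories_def using C F K by blast
qed

section \<open>Group actions\<close>

text \<open>\<open>group_action\<close> means a homomorphism into the group of extensional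
  bijections \<open>BijGroup S\<close>. Bijectivity of \<open>\<phi> g\<close> follows from the
  action of the inverse of g.\<close>

lemma group_actionI:
  assumes "group H" and ext: "\<And>g. g \<in> carrier H \<Longrightarrow> \<phi> g \<in> extensional S"
    and mem: "\<And>g x. g \<in> carrier H \<Longrightarrow> x \<in> S \<Longrightarrow> \<phi> g x \<in> S"
    and one: "\<And>x. x \<in> S \<Longrightarrow> \<phi> \<one>\<^bsub>H\<^esub> x = x"
    and mult: "\<And>g h x. g \<in> carrier H \<Longrightarrow> h \<in> carrier H \<Longrightarrow> x \<in> S \<Longrightarrow> \<phi> (g \<otimes>\<^bsub>H\<^esub> h) x = \<phi> g (\<phi> h x)"
  shows "group_action H S \<phi>"
proof -
  interpret H: group H by fact
  have Bij: "\<phi> g \<in> Bij S" if g: "g \<in> carrier H" for g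
  proof -
    have "bij_betw (\<phi> g) S S"
    proof (rule bij_betwI)
      show "\<phi> g \<in> S \<rightarrow> S" "\<phi> (inv\<^bsub>H\<^esub> g) \<in> S \<rightarrow> S" using mem g by auto
      show "\<phi> (inv\<^bsub>H\<^esub> g) (\<phi> g x) = x" if "x \<in> S" for x
        using mult[of "inv\<^bsub>H\<^esub> g" g x] one[OF that] g that by simp
      show "\<phi> g (\<phi> (inv\<^bsub>H\<^esub> g) x) = x" if "x \<in> S" for x
        using mult[of g "inv\<^bsub>H\<^esub> g" x] one[OF that] g that by simp
    qed
    then show ?thesis using ext[OF g] by (simp add: Bij_def)
  qed
  have "\<phi> \<in> hom H (BijGroup S)"
  proof (rule homI)
    show "\<phi> g \<in> carrier (BijGroup S)" if "g \<in> carrier H" for g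
      using Bij[OF that] by (simp add: BijGroup_def)
    show "\<phi> (g \<otimes>\<^bsub>H\<^esub> h) = \<phi> g \<otimes>\<^bsub>BijGroup S\<^esub> \<phi> h" if "g \<in> carrier H" "h \<in> carrier H" for g h
    proof -
      have "\<phi> (g \<otimes>\<^bsub>H\<^esub> h) = compose S (\<phi> g) (\<phi> h)"
        by (rule extensionalityI[OF ext compose_extensional]) (use that mult in \<open>auto simp: compose_def\<close>)
      then show ?thesis using Bij that by (simp add: BijGroup_def)
    qed
  qed
  then show ?thesis
    by (simp add: group_action_def group_hom_def group_hom_axioms_def group_BijGroup H.is_group)
qed

lemma group_actionD:
  assumes "group_action H S \<phi>"
  shows "g \<in> carrier H \<Longrightarrow> \<phi> g \<in> extensional S"
    and "g \<in> carrier H \<Longrightarrow> x \<in> S \<Longrightarrow> \<phi> g x \<in> S"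
    and "x \<in> S \<Longrightarrow> \<phi> \<one>\<^bsub>H\<^esub> x = x"
    and "g \<in> carrier H \<Longrightarrow> h \<in> carrier H \<Longrightarrow> x \<in> S \<Longrightarrow> \<phi> (g \<otimes>\<^bsub>H\<^esub> h) x = \<phi> g (\<phi> h x)"
proof -
  interpret group_action H S \<phi> by fact
  show "\<phi> g \<in> extensional S" if "g \<in> carrier H" using bij_prop0[OF that] by (simp add: Bij_def)
  show "\<phi> g x \<in> S" if "g \<in> carrier H" "x \<in> S" using element_image that by blast
  show "\<phi> \<one>\<^bsub>H\<^esub> x = x" if "x \<in> S" using id_eq_one that by (metis restrict_apply')
  show "\<phi> (g \<otimes>\<^bsub>H\<^esub> h) x = \<phi> g (\<phi> h x)" if "g \<in> carrier H" "h \<in> carrier H" "x \<in> S"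
    using composition_rule that by blast
qed

section \<open>Morphisms of bundles\<close>

text \<open>The base point conditions replace the assumption that \<open>E\<close> is a vector
  bundle, so that the rules apply to \<open>gC\<close> as well.\<close>

lemma vect_homD:
  assumes "\<psi> \<in> vect_hom X E F"
  shows "\<psi> \<in> extensional (pts E)" "smooth_map (tot E) (tot F) \<psi>"
    and "e \<in> pts E \<Longrightarrow> \<psi> e \<in> pts F"
    and "e \<in> pts E \<Longrightarrow> bproj F (\<psi> e) = bproj E e"
    and "bproj E e \<in> carrier X \<Longrightarrow> e \<in> pts E \<Longrightarrow> f \<in> pts E \<Longrightarrow> bproj E f = bproj E e \<Longrightarrow>
      \<psi> (badd E e f) = badd F (\<psi> e) (\<psi> f)"
    and "bproj E e \<in> carrier X \<Longrightarrow> e \<in> pts E \<Longrightarrow> \<psi> (bsmult E a e) = bsmult F a (\<psi> e)"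
proof -
  have *: "\<psi> \<in> extensional (pts E)" "smooth_map (tot E) (tot F) \<psi>"
    "\<And>e. e \<in> pts E \<Longrightarrow> bproj F (\<psi> e) = bproj E e"
    "\<And>x. x \<in> carrier X \<Longrightarrow> \<psi> \<in> linear_maps (fibre E x) (fibre F x)"
    using assms by (auto simp: vect_hom_def bundle_morphism_def)
  then show "\<psi> \<in> extensional (pts E)" "smooth_map (tot E) (tot F) \<psi>"
    "e \<in> pts E \<Longrightarrow> \<psi> e \<in> pts F" "e \<in> pts E \<Longrightarrow> bproj F (\<psi> e) = bproj E e"
    by (auto dest: smooth_map_carrier)
  show "\<psi> (badd E e f) = badd F (\<psi> e) (\<psi> f)"
    if "bproj E e \<in> carrier X" "e \<in> pts E" "f \<in> pts E" "bproj E f = bproj E e"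
    using linear_mapsD(2)[OF *(4)[OF that(1)]] that by simp
  show "\<psi> (bsmult E a e) = bsmult F a (\<psi> e)" if "bproj E e \<in> carrier X" "e \<in> pts E"
    using linear_mapsD(3)[OF *(4)[OF that(1)]] that by simp
qed

lemma vect_homI:
  assumes "\<psi> \<in> extensional (pts E)" "smooth_map (tot E) (tot F) \<psi>"
    and "\<And>e. e \<in> pts E \<Longrightarrow> bproj F (\<psi> e) = bproj E e"
    and "\<And>e f. e \<in> pts E \<Longrightarrow> f \<in> pts E \<Longrightarrow> bproj E f = bproj E e \<Longrightarrow> \<psi> (badd E e f) = badd F (\<psi> e) (\<psi> f)"
    and "\<And>a e. e \<in> pts E \<Longrightarrow> \<psi> (bsmult E a e) = bsmult F a (\<psi> e)"
  shows "\<psi> \<in> vect_hom X E F"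
  using assms smooth_map_carrier[OF assms(2)]
  by (auto simp: vect_hom_def bundle_morphism_def linear_maps_def)

lemma vect_hom_id:
  assumes "vector_bundle X E"
  shows "(\<lambda>e\<in>pts E. e) \<in> vect_hom X E E"
proof -
  interpret vector_bundle X E by fact
  show ?thesis
  proof (rule vect_homI)
    show "smooth_map (tot E) (tot E) (\<lambda>e\<in>pts E. e)"
      by (rule smooth_map_cong[OF premanifold_tot premanifold_tot smooth_map_id[OF premanifold_tot]]) simp
  qed (auto simp: badd_closed bsmult_closed)
qed

lemma vect_hom_compose:
  assumes "vector_bundle X E" "vector_bundle X E'" "vector_bundle X E''" and \<psi>: "\<psi> \<in> vect_hom X E E'" and \<theta>: "\<theta> \<in> vect_hom X E' E''"
  shows "compose (pts E) \<theta> \<psi> \<in> vect_hom X E E''"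
proof -
  interpret E: vector_bundle X E by fact
  interpret E': vector_bundle X E' by fact
  interpret E'': vector_bundle X E'' by fact
  show ?thesis
  proof (rule vect_homI)
    show "smooth_map (tot E) (tot E'') (compose (pts E) \<theta> \<psi>)"
      by (rule smooth_map_cong[OF E.premanifold_tot E''.premanifold_tot
          smooth_map_compose[OF E.premanifold_tot E'.premanifold_tot E''.premanifold_tot vect_homD(2)[OF \<psi>] vect_homD(2)[OF \<theta>]]])
        (simp add: compose_def)
    show "bproj E'' (compose (pts E) \<theta> \<psi> e) = bproj E e" if "e \<in> pts E" for e
      using that vect_homD(3,4)[OF \<psi>] vect_homD(4)[OF \<theta>] by (simp add: compose_def)
    show "compose (pts E) \<theta> \<psi> (badd E e f) = badd E'' (compose (pts E) \<theta> \<psi> e) (compose (pts E) \<theta> \<psi> f)"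
      if "e \<in> pts E" "f \<in> pts E" "bproj E f = bproj E e" for e f
      using that E.badd_closed E.bproj_in vect_homD(3-5)[OF \<psi>] vect_homD(5)[OF \<theta>] by (simp add: compose_def)
    show "compose (pts E) \<theta> \<psi> (bsmult E a e) = bsmult E'' a (compose (pts E) \<theta> \<psi> e)" if "e \<in> pts E" for a e
      using that E.bsmult_closed E.bproj_in vect_homD(3,4,6)[OF \<psi>] vect_homD(6)[OF \<theta>] by (simp add: compose_def)
  qed (simp add: compose_extensional)
qed

section \<open>Affine actions and pairs\<close>

locale lie_action = real_lie_group G for G :: "'g lie_group" (structure) +
  fixes X :: "'x manifold" and t :: "'g \<Rightarrow> 'x \<Rightarrow> 'x"
  assumes smooth_manifold_X: "smooth_manifold X" and action_X: "smooth_action G X t"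
begin

lemma premanifold_X: "premanifold X"
  by (rule smooth_manifold_premanifold[OF smooth_manifold_X])

lemma group_action_X: "group_action G (carrier X) t"
  using action_X by (simp add: smooth_action_def)

lemmas t_closed = group_actionD(2)[OF group_action_X]
lemmas t_one = group_actionD(3)[OF group_action_X]
lemmas t_mult = group_actionD(4)[OF group_action_X]

lemma t_inv:
  assumes "g \<in> carrier G" "x \<in> carrier X"
  shows "t (inv g) (t g x) = x" "t g (t (inv g) x) = x"
  using t_mult[of "inv g" g x] t_mult[of g "inv g" x] t_one[OF assms(2)] assms by simp_all

lemma smooth_act:
  assumes P: "premanifold P" and f: "smooth_map P LM f" and M: "premanifold M" and y: "smooth_map P M y"
    and \<sigma>: "smooth_map (prod_manifold LM M) M (\<lambda>(g, x). \<sigma> g x)"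
  shows "smooth_map P M (\<lambda>p. \<sigma> (f p) (y p))"
  using smooth_map_compose[OF P premanifold_prod(1)[OF premanifold_LM M] M
      smooth_map_Pair[OF P premanifold_LM M f y] \<sigma>] by simp

lemma smooth_t: "smooth_map (prod_manifold LM X) X (\<lambda>(g, x). t g x)"
  using action_X by (simp add: smooth_action_def)

lemma lie_algebra_C_CT: "lie_algebra_C G = CT \<one>"
  by (simp add: lie_algebra_C_def)

lemma smult_zero_CT: "g \<in> carrier G \<Longrightarrow> z \<odot>\<^bsub>CT g\<^esub> \<zero>\<^bsub>CT g\<^esub> = \<zero>\<^bsub>CT g\<^esub>"
  by (simp add: ctangent_space_ops) (auto simp: tangent_space_def mk_module_def fun_eq_iff restrict_def)

end

locale lie_action_bundle = lie_action G X t + vector_bundle X E for G :: "'g lie_group" (structure) and X :: "'x manifold" and t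
  and E :: "('x, 'e) cvbundle"
begin

lemma linear_actI:
  assumes "\<And>e. e \<in> pts E \<Longrightarrow> \<sigma> e \<in> pts E" "\<And>e. e \<in> pts E \<Longrightarrow> bproj E (\<sigma> e) = t g (bproj E e)"
    "\<And>e f. e \<in> pts E \<Longrightarrow> f \<in> pts E \<Longrightarrow> bproj E f = bproj E e \<Longrightarrow> \<sigma> (badd E e f) = badd E (\<sigma> e) (\<sigma> f)"
    "\<And>a e. e \<in> pts E \<Longrightarrow> \<sigma> (bsmult E a e) = bsmult E a (\<sigma> e)"
  shows "\<sigma> \<in> linear_maps (fibre E x) (fibre E (t g x))"
  using assms by (auto simp: linear_maps_def)

text \<open>Addition in a commutative group is itself additive in the pair of its arguments; this is
  what makes the sum of a \<sigma>-term and a \<rho>-term additive.\<close>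

lemma badd_medial:
  assumes "a \<in> pts E" "b \<in> pts E" "c \<in> pts E" "d \<in> pts E"
    "bproj E b = bproj E a" "bproj E c = bproj E a" "bproj E d = bproj E a"
  shows "badd E (badd E a b) (badd E c d) = badd E (badd E a c) (badd E b d)"
proof -
  interpret abelian_group "fibre E (bproj E a)" by (rule abelian_group_fibre[OF bproj_in[OF assms(1)]])
  show ?thesis
    using a_assoc[of a b "badd E c d"] a_assoc[of a c "badd E b d"] a_lcomm[of b c d] assms badd_closed
    by simp
qed

lemma zero_in_TG: "g \<in> carrier G \<Longrightarrow> (g, \<zero>\<^bsub>CT g\<^esub>) \<in> carrier TG"
  by (simp add: carrier_TG CT_closed(3))

lemma one_in_TG: "a \<in> carrier (CT \<one>) \<Longrightarrow> (\<one>, a) \<in> carrier TG"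
  by (simp add: carrier_TG)

lemma pts_ext_sum: "pts (ext_sum (ctangent_bundle G) E) = carrier TG \<times> pts E"
  by (simp add: ext_sum_def ctangent_bundle_def Let_def lie_manifold_TG carrier_TG)

text \<open>The fibre of the external sum over (g, x) consists of pairs, so additivity is joint in
  the tangent vector and the point, not separate in each. This is why a single tangent vector acts
  on the fibres affinely.\<close>

lemma bundle_morphism_affine: "bundle_morphism (prod_manifold LM X) (ext_sum (ctangent_bundle G) E) E
       (\<lambda>(g, x). t g x) (\<lambda>(v, e). \<phi> v e) \<longleftrightarrow>
    smooth_map (prod_manifold (ctangent_manifold LM) (tot E)) (tot E) (\<lambda>(v, e). \<phi> v e) \<and>
    (\<forall>v\<in>carrier TG. \<forall>e\<in>pts E. bproj E (\<phi> v e) = t (fst v) (bproj E e)) \<and>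
    (\<forall>g\<in>carrier G. \<forall>u\<in>carrier (CT g). \<forall>w\<in>carrier (CT g). \<forall>e\<in>pts E. \<forall>f\<in>pts E. bproj E f = bproj E e \<longrightarrow>
       \<phi> (g, u \<oplus>\<^bsub>CT g\<^esub> w) (badd E e f) = badd E (\<phi> (g, u) e) (\<phi> (g, w) f)) \<and>
    (\<forall>a. \<forall>g\<in>carrier G. \<forall>u\<in>carrier (CT g). \<forall>e\<in>pts E.
       \<phi> (g, a \<odot>\<^bsub>CT g\<^esub> u) (bsmult E a e) = bsmult E a (\<phi> (g, u) e))"
  (is "?B \<longleftrightarrow> ?S \<and> ?P \<and> ?A \<and> ?M")
proof -
  let ?F = "ext_sum (ctangent_bundle G) E"
  have tot: "tot ?F = prod_manifold (ctangent_manifold LM) (tot E)"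
    by (simp add: ext_sum_def ctangent_bundle_def Let_def lie_manifold_TG)
  have proj: "bproj ?F (v, e) = (fst v, bproj E e)" for v e
    by (simp add: ext_sum_def ctangent_bundle_def Let_def)
  have add: "badd ?F ((g, u), e) ((g, w), f) = ((g, u \<oplus>\<^bsub>CT g\<^esub> w), badd E e f)" for g u w e f
    by (simp add: ext_sum_def ctangent_bundle_def Let_def)
  have smult: "bsmult ?F a ((g, u), e) = ((g, a \<odot>\<^bsub>CT g\<^esub> u), bsmult E a e)" for a g u e
    by (simp add: ext_sum_def ctangent_bundle_def Let_def)
  show ?thesis
  proof
    assume B: ?B
    then have S: ?S and P: ?P
      unfolding bundle_morphism_def tot by (auto simp: pts_ext_sum[unfolded tot] proj carrier_TG split: prod.splits)
    have lin: "(\<lambda>(v, e). \<phi> v e) \<in> linear_maps (fibre ?F (g, x)) (fibre E (t g x))"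
      if "g \<in> carrier G" "x \<in> carrier X" for g x
      using B that unfolding bundle_morphism_def by force
    have ?A
    proof (intro ballI impI)
      fix g u w e f assume *: "g \<in> carrier G" "u \<in> carrier (CT g)" "w \<in> carrier (CT g)" "e \<in> pts E" "f \<in> pts E"
        "bproj E f = bproj E e"
      show "\<phi> (g, u \<oplus>\<^bsub>CT g\<^esub> w) (badd E e f) = badd E (\<phi> (g, u) e) (\<phi> (g, w) f)"
        using linear_mapsD(2)[OF lin[OF *(1) bproj_in[OF *(4)]], of "((g, u), e)" "((g, w), f)"] *
        by (simp add: pts_ext_sum carrier_TG proj add)
    qed
    moreover have ?M
    proof (intro allI ballI)
      fix a g u e assume *: "g \<in> carrier G" "u \<in> carrier (CT g)" "e \<in> pts E"
      show "\<phi> (g, a \<odot>\<^bsub>CT g\<^esub> u) (bsmult E a e) = bsmult E a (\<phi> (g, u) e)"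
        using linear_mapsD(3)[OF lin[OF *(1) bproj_in[OF *(3)]], of "((g, u), e)" a] *
        by (simp add: pts_ext_sum carrier_TG proj smult)
    qed
    ultimately show "?S \<and> ?P \<and> ?A \<and> ?M" using S P by blast
  next
    assume H: "?S \<and> ?P \<and> ?A \<and> ?M"
    then have S: ?S and P: ?P and A: ?A and M: ?M by blast+
    have mem: "\<phi> v e \<in> pts E" if "v \<in> carrier TG" "e \<in> pts E" for v e
      using smooth_map_carrier[OF S, of "(v, e)"] that by (simp add: carrier_TG)
    show ?B
      unfolding bundle_morphism_def tot
    proof (intro conjI ballI S)
      fix x assume "x \<in> carrier (prod_manifold (ctangent_manifold LM) (tot E))"
      then obtain v e where "x = (v, e)" "v \<in> carrier TG" "e \<in> pts E" by (auto simp: carrier_TG)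
      then show "bproj E (case x of (v, e) \<Rightarrow> \<phi> v e) = (case bproj ?F x of (g, x) \<Rightarrow> t g x)"
        using P by (simp add: proj)
    next
      fix b assume "b \<in> carrier (prod_manifold LM X)"
      then obtain g x where b: "b = (g, x)" "g \<in> carrier G" "x \<in> carrier X" by auto
      have fib: "y \<in> carrier (fibre ?F b) \<longleftrightarrow> (\<exists>u e. y = ((g, u), e) \<and> u \<in> carrier (CT g) \<and> e \<in> pts E \<and> bproj E e = x)" for y
        using b by (cases y) (auto simp: pts_ext_sum carrier_TG proj)
      show "(\<lambda>(v, e). \<phi> v e) \<in> linear_maps (fibre ?F b) (fibre E (case b of (g, x) \<Rightarrow> t g x))"
        unfolding linear_maps_def
      proof (intro CollectI conjI ballI allI)
        show "(\<lambda>(v, e). \<phi> v e) \<in> carrier (fibre ?F b) \<rightarrow> carrier (fibre E (case b of (g, x) \<Rightarrow> t g x))"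
        proof
          fix y assume "y \<in> carrier (fibre ?F b)"
          then obtain u e where "y = ((g, u), e)" "u \<in> carrier (CT g)" "e \<in> pts E" "bproj E e = x" unfolding fib by blast
          then show "(case y of (v, e) \<Rightarrow> \<phi> v e) \<in> carrier (fibre E (case b of (g, x) \<Rightarrow> t g x))"
            using mem P b by (simp add: carrier_TG)
        qed
      next
        fix y z assume "y \<in> carrier (fibre ?F b)" "z \<in> carrier (fibre ?F b)"
        then obtain u e w f where "y = ((g, u), e)" "u \<in> carrier (CT g)" "e \<in> pts E" "bproj E e = x"
          "z = ((g, w), f)" "w \<in> carrier (CT g)" "f \<in> pts E" "bproj E f = x" unfolding fib by blast
        then show "(case y \<oplus>\<^bsub>fibre ?F b\<^esub> z of (v, e) \<Rightarrow> \<phi> v e) =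
          (case y of (v, e) \<Rightarrow> \<phi> v e) \<oplus>\<^bsub>fibre E (case b of (g, x) \<Rightarrow> t g x)\<^esub> (case z of (v, e) \<Rightarrow> \<phi> v e)"
          using A b by (simp add: add)
      next
        fix a y assume "y \<in> carrier (fibre ?F b)"
        then obtain u e where "y = ((g, u), e)" "u \<in> carrier (CT g)" "e \<in> pts E" "bproj E e = x" unfolding fib by blast
        then show "(case a \<odot>\<^bsub>fibre ?F b\<^esub> y of (v, e) \<Rightarrow> \<phi> v e) =
          a \<odot>\<^bsub>fibre E (case b of (g, x) \<Rightarrow> t g x)\<^esub> (case y of (v, e) \<Rightarrow> \<phi> v e)"
          using M b by (simp add: smult)
      qed
    qed
  qed
qed

definition to_sigma :: "('g \<times> 'g ctvec \<Rightarrow> 'e \<Rightarrow> 'e) \<Rightarrow> 'g \<Rightarrow> 'e \<Rightarrow> 'e" where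
  "to_sigma \<phi> = (\<lambda>g\<in>carrier G. \<phi> (g, \<zero>\<^bsub>CT g\<^esub>))"

definition to_rho :: "('g \<times> 'g ctvec \<Rightarrow> 'e \<Rightarrow> 'e) \<Rightarrow> 'g ctvec \<Rightarrow> 'x \<Rightarrow> 'e" where
  "to_rho \<phi> = (\<lambda>\<alpha>\<in>carrier (CT \<one>). \<lambda>x\<in>carrier X. \<phi> (\<one>, \<alpha>) (bzero E x))"

definition to_phi :: "('g \<Rightarrow> 'e \<Rightarrow> 'e) \<Rightarrow> ('g ctvec \<Rightarrow> 'x \<Rightarrow> 'e) \<Rightarrow> 'g \<times> 'g ctvec \<Rightarrow> 'e \<Rightarrow> 'e" where
  "to_phi \<sigma> \<rho> = (\<lambda>v\<in>carrier TG. \<lambda>e\<in>pts E. badd E (\<sigma> (fst v) e) (\<rho> (mc_form v) (t (fst v) (bproj E e))))"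

section \<open>From an affine action to a pair\<close>

context
  fixes \<phi> assumes aff: "complex_affine_action G X t E \<phi>"
begin

lemma aff_action: "group_action TG (pts E) \<phi>"
  using aff by (simp add: complex_affine_action_def smooth_action_def)

lemmas aff_closed = group_actionD(2)[OF aff_action]

lemma aff_morphism: "bundle_morphism (prod_manifold LM X) (ext_sum (ctangent_bundle G) E) E
       (\<lambda>(g, x). t g x) (\<lambda>(v, e). \<phi> v e)"
  using aff by (simp add: complex_affine_action_def)

lemma aff_smooth: "smooth_map (prod_manifold (ctangent_manifold LM) (tot E)) (tot E) (\<lambda>(v, e). \<phi> v e)"
  and aff_proj: "v \<in> carrier TG \<Longrightarrow> e \<in> pts E \<Longrightarrow> bproj E (\<phi> v e) = t (fst v) (bproj E e)"
  and aff_add: "g \<in> carrier G \<Longrightarrow> u \<in> carrier (CT g) \<Longrightarrow> w \<in> carrier (CT g) \<Longrightarrow> e \<in> pts E \<Longrightarrow> f \<in> pts E \<Longrightarrow>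
    bproj E f = bproj E e \<Longrightarrow> \<phi> (g, u \<oplus>\<^bsub>CT g\<^esub> w) (badd E e f) = badd E (\<phi> (g, u) e) (\<phi> (g, w) f)"
  and aff_smult: "g \<in> carrier G \<Longrightarrow> u \<in> carrier (CT g) \<Longrightarrow> e \<in> pts E \<Longrightarrow>
    \<phi> (g, a \<odot>\<^bsub>CT g\<^esub> u) (bsmult E a e) = bsmult E a (\<phi> (g, u) e)"
  using aff_morphism unfolding bundle_morphism_affine by blast+

text \<open>Scale the pair of zero vectors over (g, x) by 0: it does not change, while its image
  becomes the zero vector over g x.\<close>

lemma aff_zero:
  assumes "g \<in> carrier G" "x \<in> carrier X"
  shows "\<phi> (g, \<zero>\<^bsub>CT g\<^esub>) (bzero E x) = bzero E (t g x)"
proof -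
  note z = bzero_in[OF assms(2)]
  have "\<phi> (g, 0 \<odot>\<^bsub>CT g\<^esub> \<zero>\<^bsub>CT g\<^esub>) (bsmult E 0 (bzero E x)) = bsmult E 0 (\<phi> (g, \<zero>\<^bsub>CT g\<^esub>) (bzero E x))"
    using aff_smult[OF assms(1) CT_closed(3) z(1)] .
  then show ?thesis
    using bsmult_0[OF aff_closed[OF zero_in_TG[OF assms(1)] z(1)]] aff_proj[OF zero_in_TG[OF assms(1)] z(1)] z
      bsmult_bzero[OF assms(2)] smult_zero_CT[OF assms(1)] by simp
qed

lemma smooth_aff:
  assumes P: "premanifold P" and "smooth_map P (ctangent_manifold LM) v" "smooth_map P (tot E) e"
  shows "smooth_map P (tot E) (\<lambda>p. \<phi> (v p) (e p))"
proof -
  note pT = premanifold_ctangent(1)[OF premanifold_LM]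
  show ?thesis
    using smooth_map_compose[OF P premanifold_prod(1)[OF pT premanifold_tot] premanifold_tot
        smooth_map_Pair[OF P pT premanifold_tot assms(2,3)] aff_smooth] by simp
qed

text \<open>The zero section g \<mapsto> 0_g is a smooth homomorphism into the tangent group. Zero
  vectors are closed under sums and multiples, so joint linearity of the action turns into linearity
  in \<open>e\<close>.\<close>

lemma to_sigma_equivariant: "equivariant_bundle G X t E (to_sigma \<phi>)"
  unfolding equivariant_bundle_def smooth_action_def
proof (intro conjI ballI)
  let ?\<sigma> = "to_sigma \<phi>"
  note A = group_actionD[OF aff_action]
  have s: "?\<sigma> g = \<phi> (g, \<zero>\<^bsub>CT g\<^esub>)" if "g \<in> carrier G" for g using that by (simp add: to_sigma_def)
  show "complex_vector_bundle X E" by (rule E)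
  show "?\<sigma> \<in> extensional (carrier G)" by (simp add: to_sigma_def)
  show "group_action G (pts E) ?\<sigma>"
  proof (rule group_actionI)
    show "?\<sigma> \<one> e = e" if "e \<in> pts E" for e using A(3)[OF that] by (simp add: s one_TG)
    show "?\<sigma> (g \<otimes> h) e = ?\<sigma> g (?\<sigma> h e)" if "g \<in> carrier G" "h \<in> carrier G" "e \<in> pts E" for g h e
      using A(4)[OF zero_in_TG zero_in_TG that(3), of g h] that by (simp add: s zero_mult_TG)
  qed (use A zero_in_TG in \<open>auto simp: s\<close>)
  note pP = premanifold_prod(1)[OF premanifold_LM premanifold_tot]
  have "smooth_map (prod_manifold LM (tot E)) (tot E) (\<lambda>p. \<phi> (fst p, \<zero>\<^bsub>CT (fst p)\<^esub>) (snd p))"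
    by (rule smooth_aff[OF pP smooth_map_compose[OF pP premanifold_LM premanifold_ctangent(1)[OF premanifold_LM]
            smooth_map_fst[OF premanifold_LM premanifold_tot] smooth_map_ctangent_zero[OF premanifold_LM]]
          smooth_map_snd[OF premanifold_LM premanifold_tot]])
  then show "smooth_map (prod_manifold LM (tot E)) (tot E) (\<lambda>(g, e). ?\<sigma> g e)"
    by (rule smooth_map_cong[OF pP premanifold_tot]) (auto simp: s)
  show pr: "bproj E (?\<sigma> g e) = t g (bproj E e)" if "g \<in> carrier G" "e \<in> pts E" for g e
    using aff_proj[OF zero_in_TG[OF that(1)] that(2)] that by (simp add: s)
  show "?\<sigma> g \<in> linear_maps (fibre E x) (fibre E (t g x))" if g: "g \<in> carrier G" and "x \<in> carrier X" for g x
  proof (rule linear_actI)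
    show "?\<sigma> g (badd E e f) = badd E (?\<sigma> g e) (?\<sigma> g f)"
      if "e \<in> pts E" "f \<in> pts E" "bproj E f = bproj E e" for e f
      using aff_add[OF g CT_closed(3) CT_closed(3) that] CT_rules(1)[OF g CT_closed(3)] g by (simp add: s)
    show "?\<sigma> g (bsmult E a e) = bsmult E a (?\<sigma> g e)" if "e \<in> pts E" for a e
      using aff_smult[OF g CT_closed(3) that] smult_zero_CT[OF g] g by (simp add: s)
  qed (use pr aff_closed zero_in_TG g in \<open>auto simp: s\<close>)
qed

lemma to_rho_equivariant: "equivariant_linear_map G X t E (to_sigma \<phi>) (to_rho \<phi>)"
  unfolding equivariant_linear_map_def lie_algebra_C_CT
proof (intro conjI ballI)
  let ?\<sigma> = "to_sigma \<phi>" and ?\<rho> = "to_rho \<phi>"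
  have r: "?\<rho> \<alpha> x = \<phi> (\<one>, \<alpha>) (bzero E x)" if "\<alpha> \<in> carrier (CT \<one>)" "x \<in> carrier X" for \<alpha> x
    using that by (simp add: to_rho_def)
  have rext: "?\<rho> \<alpha> \<in> extensional (carrier X)" if "\<alpha> \<in> carrier (CT \<one>)" for \<alpha>
    using that by (simp add: to_rho_def)
  note pT = premanifold_ctangent(1)[OF premanifold_LM]
  show "?\<rho> \<in> linear_maps (CT \<one>) (sections X E)"
    unfolding linear_maps_def
  proof (intro CollectI conjI ballI allI)
    show "?\<rho> \<in> carrier (CT \<one>) \<rightarrow> carrier (sections X E)"
    proof
      fix \<alpha> assume \<alpha>: "\<alpha> \<in> carrier (CT \<one>)"
      have "smooth_map X (ctangent_manifold LM) (\<lambda>x. (\<one>, \<alpha>))"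
        by (rule smooth_map_const[OF X pT]) (use \<alpha> in simp)
      then have "smooth_map X (tot E) (\<lambda>x. \<phi> (\<one>, \<alpha>) (bzero E x))"
        by (rule smooth_aff[OF X _ smooth_bzero])
      then have "smooth_map X (tot E) (?\<rho> \<alpha>)"
        by (rule smooth_map_cong[OF X premanifold_tot]) (simp add: r \<alpha>)
      moreover have "bproj E (?\<rho> \<alpha> x) = x" if "x \<in> carrier X" for x
        using aff_proj[OF one_in_TG[OF \<alpha>]] bzero_in[OF that] t_one[OF that] by (simp add: r \<alpha> that)
      ultimately show "?\<rho> \<alpha> \<in> carrier (sections X E)" using rext[OF \<alpha>] by (simp add: sections_iff)
    qed
    show "?\<rho> (\<alpha> \<oplus>\<^bsub>CT \<one>\<^esub> \<beta>) = ?\<rho> \<alpha> \<oplus>\<^bsub>sections X E\<^esub> ?\<rho> \<beta>"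
      if \<alpha>: "\<alpha> \<in> carrier (CT \<one>)" and \<beta>: "\<beta> \<in> carrier (CT \<one>)" for \<alpha> \<beta>
    proof (rule extensionalityI[OF rext[OF CT_closed(1)[OF \<alpha> \<beta>]] sections_ext(1)])
      fix x assume x: "x \<in> carrier X"
      note z = bzero_in[OF x]
      have "badd E (bzero E x) (bzero E x) = bzero E x" using badd_zero[OF z(1)] z by simp
      then show "?\<rho> (\<alpha> \<oplus>\<^bsub>CT \<one>\<^esub> \<beta>) x = (?\<rho> \<alpha> \<oplus>\<^bsub>sections X E\<^esub> ?\<rho> \<beta>) x"
        using aff_add[OF one_closed \<alpha> \<beta> z(1) z(1)] CT_closed(1)[OF \<alpha> \<beta>] by (simp add: sections_ops x r \<alpha> \<beta>)
    qed
    show "?\<rho> (a \<odot>\<^bsub>CT \<one>\<^esub> \<alpha>) = a \<odot>\<^bsub>sections X E\<^esub> ?\<rho> \<alpha>" if \<alpha>: "\<alpha> \<in> carrier (CT \<one>)" for a \<alpha>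
    proof (rule extensionalityI[OF rext[OF CT_closed(2)[OF \<alpha>]] sections_ext(2)])
      fix x assume x: "x \<in> carrier X"
      then show "?\<rho> (a \<odot>\<^bsub>CT \<one>\<^esub> \<alpha>) x = (a \<odot>\<^bsub>sections X E\<^esub> ?\<rho> \<alpha>) x"
        using aff_smult[OF one_closed \<alpha> bzero_in(1)[OF x], of a] bsmult_bzero[OF x] CT_closed(2)[OF \<alpha>]
        by (simp add: sections_ops x r \<alpha>)
    qed
  qed
  show "?\<rho> \<in> extensional (carrier (CT \<one>))" by (simp add: to_rho_def)
  show "?\<rho> (Ad_C G g \<alpha>) = section_action G X t ?\<sigma> g (?\<rho> \<alpha>)"
    if g: "g \<in> carrier G" and \<alpha>: "\<alpha> \<in> carrier (CT \<one>)" for g \<alpha>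
  proof (rule extensionalityI[OF rext[OF Ad_C_closed[OF g \<alpha>]]])
    show "section_action G X t ?\<sigma> g (?\<rho> \<alpha>) \<in> extensional (carrier X)" by (simp add: section_action_def)
    fix x assume x: "x \<in> carrier X"
    have ig: "inv g \<in> carrier G" using g by simp
    note z = bzero_in(1)[OF x] and tx = t_closed[OF ig x]
    note m = group_actionD(4)[OF aff_action] and mc = monoid.m_closed[OF group.is_monoid[OF group_TG]]
    \<comment> \<open>The right factor moves the zero vector at x to the zero vector at g^-1 x, so
      the triple product becomes g applied to the section of \<alpha> at g^-1 x.\<close>
    have "\<phi> (\<one>, Ad_C G g \<alpha>) (bzero E x) = \<phi> (g, \<zero>\<^bsub>CT g\<^esub>) (\<phi> (\<one>, \<alpha>) (\<phi> (inv g, \<zero>\<^bsub>CT (inv g)\<^esub>) (bzero E x)))"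
      unfolding Ad_C_decomp[OF g \<alpha>]
      using m[OF mc[OF zero_in_TG[OF g] one_in_TG[OF \<alpha>]] zero_in_TG[OF ig] z]
        m[OF zero_in_TG[OF g] one_in_TG[OF \<alpha>] aff_closed[OF zero_in_TG[OF ig] z]] by simp
    then show "?\<rho> (Ad_C G g \<alpha>) x = section_action G X t ?\<sigma> g (?\<rho> \<alpha>) x"
      using Ad_C_closed[OF g \<alpha>] tx g by (simp add: r x \<alpha> section_action_def aff_zero[OF ig x] to_sigma_def)
  qed
qed

lemma to_phi_inverse: "to_phi (to_sigma \<phi>) (to_rho \<phi>) = \<phi>"
proof (rule extensionalityI[of _ "carrier TG"])
  show "to_phi (to_sigma \<phi>) (to_rho \<phi>) \<in> extensional (carrier TG)" by (simp add: to_phi_def)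
  show "\<phi> \<in> extensional (carrier TG)" using aff by (simp add: complex_affine_action_def)
  fix v assume v: "v \<in> carrier TG"
  then have g: "fst v \<in> carrier G" by (auto simp: carrier_TG)
  show "to_phi (to_sigma \<phi>) (to_rho \<phi>) v = \<phi> v"
  proof (rule extensionalityI[of _ "pts E"])
    show "to_phi (to_sigma \<phi>) (to_rho \<phi>) v \<in> extensional (pts E)" using v by (simp add: to_phi_def)
    show "\<phi> v \<in> extensional (pts E)" by (rule group_actionD(1)[OF aff_action v])
    fix e assume e: "e \<in> pts E"
    let ?x = "t (fst v) (bproj E e)" and ?e = "\<phi> (fst v, \<zero>\<^bsub>CT (fst v)\<^esub>) e"
    have x: "?x \<in> carrier X" by (rule t_closed[OF g bproj_in[OF e]])
    note z = bzero_in[OF x] and rv = mc_form_closed[OF v]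
    have e': "?e \<in> pts E" "bproj E ?e = ?x"
      using aff_closed[OF zero_in_TG[OF g] e] aff_proj[OF zero_in_TG[OF g] e] by auto
    have "\<phi> v e = \<phi> (\<one>, mc_form v) ?e"
      using group_actionD(4)[OF aff_action one_in_TG[OF rv] zero_in_TG[OF g] e] mc_form_decomp[OF v] by simp
    \<comment> \<open>Write the pair over (1, g x) as (\<open>mc_form v\<close>, 0) + (0,
      \<open>?e\<close>), to which joint additivity applies.\<close>
    also have "\<dots> = \<phi> (\<one>, mc_form v \<oplus>\<^bsub>CT \<one>\<^esub> \<zero>\<^bsub>CT \<one>\<^esub>) (badd E (bzero E ?x) ?e)"
      using badd_zero(1)[OF e'(1)] e'(2) CT_rules(2)[OF one_closed rv] by simp
    also have "\<dots> = badd E (\<phi> (\<one>, mc_form v) (bzero E ?x)) (\<phi> (\<one>, \<zero>\<^bsub>CT \<one>\<^esub>) ?e)"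
      by (rule aff_add[OF one_closed rv CT_closed(3) z(1) e'(1)]) (use z e' in simp)
    also have "\<phi> (\<one>, \<zero>\<^bsub>CT \<one>\<^esub>) ?e = ?e"
      using group_actionD(3)[OF aff_action e'(1)] by (simp add: one_TG)
    also have "badd E (\<phi> (\<one>, mc_form v) (bzero E ?x)) ?e = badd E ?e (\<phi> (\<one>, mc_form v) (bzero E ?x))"
      by (rule badd_comm) (use aff_closed[OF one_in_TG[OF rv] z(1)] aff_proj[OF one_in_TG[OF rv] z(1)] z e' t_one[OF x] in auto)
    finally show "to_phi (to_sigma \<phi>) (to_rho \<phi>) v e = \<phi> v e"
      using v e g x rv by (simp add: to_phi_def to_sigma_def to_rho_def)
  qed
qed

end

end

section \<open>From a pair to an affine action\<close>

context lie_action_bundle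
begin

context
  fixes \<sigma> \<rho>
  assumes equiv: "equivariant_bundle G X t E \<sigma>" and elm: "equivariant_linear_map G X t E \<sigma> \<rho>"
begin

lemma sigma_action: "group_action G (pts E) \<sigma>"
  using equiv by (simp add: equivariant_bundle_def smooth_action_def)

lemmas sigma_closed = group_actionD(2)[OF sigma_action]

lemma sigma_smooth: "smooth_map (prod_manifold LM (tot E)) (tot E) (\<lambda>(g, e). \<sigma> g e)"
  and sigma_proj: "g \<in> carrier G \<Longrightarrow> e \<in> pts E \<Longrightarrow> bproj E (\<sigma> g e) = t g (bproj E e)"
  using equiv by (simp_all add: equivariant_bundle_def smooth_action_def)

lemma sigma_linear:
  assumes "g \<in> carrier G" "e \<in> pts E"
  shows "f \<in> pts E \<Longrightarrow> bproj E f = bproj E e \<Longrightarrow> \<sigma> g (badd E e f) = badd E (\<sigma> g e) (\<sigma> g f)"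
    and "\<sigma> g (bsmult E a e) = bsmult E a (\<sigma> g e)"
proof -
  have l: "\<sigma> g \<in> linear_maps (fibre E (bproj E e)) (fibre E (t g (bproj E e)))"
    using equiv assms bproj_in by (simp add: equivariant_bundle_def)
  show "\<sigma> g (badd E e f) = badd E (\<sigma> g e) (\<sigma> g f)" if "f \<in> pts E" "bproj E f = bproj E e"
    using linear_mapsD(2)[OF l, of e f] assms that by simp
  show "\<sigma> g (bsmult E a e) = bsmult E a (\<sigma> g e)"
    using linear_mapsD(3)[OF l, of e a] assms by simp
qed

lemma rho_linear_maps: "\<rho> \<in> linear_maps (CT \<one>) (sections X E)"
  and rho_extensional: "\<rho> \<in> extensional (carrier (CT \<one>))"
  and rho_Ad: "g \<in> carrier G \<Longrightarrow> \<alpha> \<in> carrier (CT \<one>) \<Longrightarrow> \<rho> (Ad_C G g \<alpha>) = section_action G X t \<sigma> g (\<rho> \<alpha>)"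
  using elm by (simp_all add: equivariant_linear_map_def lie_algebra_C_CT)

lemma rho_section: "\<alpha> \<in> carrier (CT \<one>) \<Longrightarrow> \<rho> \<alpha> \<in> carrier (sections X E)"
  by (rule linear_mapsD(1)[OF rho_linear_maps])

lemmas rho_in = sectionD[OF rho_section]

lemma rho_add: "\<alpha> \<in> carrier (CT \<one>) \<Longrightarrow> \<beta> \<in> carrier (CT \<one>) \<Longrightarrow> x \<in> carrier X \<Longrightarrow>
    \<rho> (\<alpha> \<oplus>\<^bsub>CT \<one>\<^esub> \<beta>) x = badd E (\<rho> \<alpha> x) (\<rho> \<beta> x)"
  using linear_mapsD(2)[OF rho_linear_maps] sections_ops(1) by simp

lemma rho_smult: "\<alpha> \<in> carrier (CT \<one>) \<Longrightarrow> x \<in> carrier X \<Longrightarrow> \<rho> (a \<odot>\<^bsub>CT \<one>\<^esub> \<alpha>) x = bsmult E a (\<rho> \<alpha> x)"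
  using linear_mapsD(3)[OF rho_linear_maps] sections_ops(2) by simp

lemma rho_zero:
  assumes "x \<in> carrier X"
  shows "\<rho> \<zero>\<^bsub>CT \<one>\<^esub> x = bzero E x"
  using rho_smult[OF CT_closed(3) assms, of 0] smult_zero_CT[OF one_closed]
    bsmult_0[OF rho_in(1)[OF CT_closed(3) assms]] rho_in(2)[OF CT_closed(3) assms] by simp

text \<open>Evaluating the equivariance equation at the translated point \<open>t g x\<close>
  removes the inverse from the action on sections.\<close>

lemma rho_Ad_apply:
  assumes "g \<in> carrier G" "\<alpha> \<in> carrier (CT \<one>)" "x \<in> carrier X"
  shows "\<rho> (Ad_C G g \<alpha>) (t g x) = \<sigma> g (\<rho> \<alpha> x)"
  using rho_Ad[OF assms(1,2)] t_inv(1)[OF assms(1,3)] t_closed[OF assms(1,3)]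
  by (simp add: section_action_def)

lemma to_phi_apply: "v \<in> carrier TG \<Longrightarrow> e \<in> pts E \<Longrightarrow>
    to_phi \<sigma> \<rho> v e = badd E (\<sigma> (fst v) e) (\<rho> (mc_form v) (t (fst v) (bproj E e)))"
  by (simp add: to_phi_def)

lemma fst_TG: "v \<in> carrier TG \<Longrightarrow> fst v \<in> carrier G"
  by (auto simp: carrier_TG)

lemma phi_parts:
  assumes v: "v \<in> carrier TG" and e: "e \<in> pts E"
  shows "\<sigma> (fst v) e \<in> pts E" "bproj E (\<sigma> (fst v) e) = t (fst v) (bproj E e)"
    "\<rho> (mc_form v) (t (fst v) (bproj E e)) \<in> pts E"
    "bproj E (\<rho> (mc_form v) (t (fst v) (bproj E e))) = t (fst v) (bproj E e)"
    "t (fst v) (bproj E e) \<in> carrier X"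
proof -
  show x: "t (fst v) (bproj E e) \<in> carrier X" by (rule t_closed[OF fst_TG[OF v] bproj_in[OF e]])
  show "\<sigma> (fst v) e \<in> pts E" "bproj E (\<sigma> (fst v) e) = t (fst v) (bproj E e)"
    using sigma_closed[OF fst_TG[OF v] e] sigma_proj[OF fst_TG[OF v] e] by auto
  show "\<rho> (mc_form v) (t (fst v) (bproj E e)) \<in> pts E"
    "bproj E (\<rho> (mc_form v) (t (fst v) (bproj E e))) = t (fst v) (bproj E e)"
    using rho_in[OF mc_form_closed[OF v] x] by auto
qed

lemma to_phi_closed:
  assumes "v \<in> carrier TG" "e \<in> pts E"
  shows "to_phi \<sigma> \<rho> v e \<in> pts E" "bproj E (to_phi \<sigma> \<rho> v e) = t (fst v) (bproj E e)"
  using phi_parts[OF assms] badd_closed by (simp_all add: to_phi_apply assms)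

text \<open>The cocycle identity splits the \<rho>-term of the product into the one of v and the
  g-translate of the one of w; linearity of \<open>\<sigma> g\<close> splits the iterated action in
  the same way. The two sums differ in order and bracketing only.\<close>

lemma to_phi_mult:
  assumes v: "v \<in> carrier TG" and w: "w \<in> carrier TG" and e: "e \<in> pts E"
  shows "to_phi \<sigma> \<rho> (v \<otimes>\<^bsub>TG\<^esub> w) e = to_phi \<sigma> \<rho> v (to_phi \<sigma> \<rho> w e)"
proof -
  let ?g = "fst v" and ?h = "fst w"
  let ?y = "t ?h (bproj E e)" and ?x = "t ?g (t ?h (bproj E e))"
  note g = fst_TG[OF v] and h = fst_TG[OF w] and b = bproj_in[OF e]
  note pw = phi_parts[OF w e] and pv = phi_parts[OF v phi_parts(1)[OF w e]]
  have fst: "fst (v \<otimes>\<^bsub>TG\<^esub> w) = ?g \<otimes> ?h" by (cases v, cases w) (simp add: mult_TG)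
  have x: "t (?g \<otimes> ?h) (bproj E e) = ?x" by (rule t_mult[OF g h b])
  have vw: "v \<otimes>\<^bsub>TG\<^esub> w \<in> carrier TG" by (rule monoid.m_closed[OF group.is_monoid[OF group_TG] v w])
  let ?a = "\<sigma> ?g (\<sigma> ?h e)" and ?b = "\<rho> (mc_form v) ?x" and ?c = "\<sigma> ?g (\<rho> (mc_form w) ?y)"
  have xX: "?x \<in> carrier X" by (rule t_closed[OF g pw(5)])
  have a: "?a \<in> pts E" "bproj E ?a = ?x" using pv pw by auto
  have bb: "?b \<in> pts E" "bproj E ?b = ?x" using rho_in[OF mc_form_closed[OF v] xX] by auto
  have c: "?c \<in> pts E" "bproj E ?c = ?x" using sigma_closed[OF g pw(3)] sigma_proj[OF g pw(3)] pw(4) by auto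
  have "\<rho> (mc_form (v \<otimes>\<^bsub>TG\<^esub> w)) ?x = badd E ?b ?c"
    using rho_add[OF mc_form_closed[OF v] Ad_C_closed[OF g mc_form_closed[OF w]] xX] rho_Ad_apply[OF g mc_form_closed[OF w] pw(5)]
    by (simp add: mc_form_mult[OF v w])
  then have "to_phi \<sigma> \<rho> (v \<otimes>\<^bsub>TG\<^esub> w) e = badd E ?a (badd E ?b ?c)"
    using group_actionD(4)[OF sigma_action g h e] by (simp add: to_phi_apply[OF vw e] fst x)
  moreover have "to_phi \<sigma> \<rho> v (to_phi \<sigma> \<rho> w e) = badd E (badd E ?a ?c) ?b"
    using to_phi_closed[OF w e] sigma_linear(1)[OF g pw(1) pw(3)] pw
    by (simp add: to_phi_apply[OF v] to_phi_apply[OF w e])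
  ultimately show ?thesis using badd_comm[of ?b ?c] badd_assoc[of ?a ?c ?b] a bb c by simp
qed

lemma to_phi_one:
  assumes "e \<in> pts E"
  shows "to_phi \<sigma> \<rho> \<one>\<^bsub>TG\<^esub> e = e"
  using group_actionD(3)[OF sigma_action assms] t_one[OF bproj_in[OF assms]] rho_zero[OF bproj_in[OF assms]]
    badd_zero[OF assms] zero_in_TG[OF one_closed] assms
  by (simp add: to_phi_def one_TG mc_form_zero)

text \<open>This is \<open>smooth_badd_section\<close> with base point g \<cdot> x, point g \<cdot>
  e and argument \<open>mc_form v\<close>, whose coordinates are smooth by
  \<open>smooth_on_mc_form\<close>.\<close>

lemma to_phi_smooth: "smooth_map (prod_manifold (ctangent_manifold LM) (tot E)) (tot E) (\<lambda>(v, e). to_phi \<sigma> \<rho> v e)"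
proof -
  note pT = premanifold_ctangent(1)[OF premanifold_LM]
  note pP = premanifold_prod(1)[OF pT premanifold_tot]
  let ?P = "prod_manifold (ctangent_manifold LM) (tot E)"
  note s1 = smooth_map_fst[OF pT premanifold_tot] and s2 = smooth_map_snd[OF pT premanifold_tot]
  have sg: "smooth_map ?P LM (\<lambda>p. fst (fst p))"
    by (rule smooth_map_compose[OF pP pT premanifold_LM s1 smooth_fst_TG])
  have sy: "smooth_map ?P X (\<lambda>p. t (fst (fst p)) (bproj E (snd p)))"
    by (rule smooth_act[OF pP sg X _ smooth_t])
      (rule smooth_map_compose[OF pP premanifold_tot X s2 smooth_bproj])
  have se: "smooth_map ?P (tot E) (\<lambda>p. \<sigma> (fst (fst p)) (snd p))"
    by (rule smooth_act[OF pP sg premanifold_tot s2 sigma_smooth])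
  obtain c where c: "c \<in> charts_at LM \<one>" using some_chart_at[OF premanifold_LM] by auto
  have P: "fst p \<in> carrier TG \<and> snd p \<in> pts E" if "p \<in> carrier ?P" for p
    using that by (auto simp: carrier_TG)
  have "smooth_map ?P (tot E) (\<lambda>p. badd E (\<sigma> (fst (fst p)) (snd p))
      (\<rho> (mc_form (fst p)) (t (fst (fst p)) (bproj E (snd p)))))"
  proof (rule smooth_badd_section[OF vec_closed_ctangent lin_iso_ctangent[OF premanifold_LM c] rho_linear_maps pP sy se])
    fix k assume k: "k < 2 * cdim c"
    have co: "smooth_on ?P (carrier ?P) (\<lambda>p. f (fst p))" if "smooth_on (ctangent_manifold LM) (carrier (ctangent_manifold LM)) f" for f
    proof -
      have "{p \<in> carrier ?P. fst p \<in> carrier (ctangent_manifold LM)} = carrier ?P" by auto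
      then show ?thesis using smooth_on_pullback[OF pP pT s1 that] by simp
    qed
    show "smooth_on ?P (carrier ?P) (\<lambda>p. realify (cdim c) (ctangent_coord c (mc_form (fst p))) k)"
    \<comment> \<open>The first half of the real coordinates consists of real parts, the second half
      of imaginary parts.\<close>
    proof (cases "k < cdim c")
      case True
      then show ?thesis unfolding realify_ctangent_coord[OF k] using co[OF smooth_on_mc_form(1)[OF c True]] by simp
    next
      case False
      then have "k - cdim c < cdim c" using k by simp
      then show ?thesis unfolding realify_ctangent_coord[OF k] using co[OF smooth_on_mc_form(2)[OF c]] False by simp
    qed
  qed (use P phi_parts mc_form_closed in auto)
  then show ?thesis
    by (rule smooth_map_cong[OF pP premanifold_tot]) (use P in \<open>auto simp: to_phi_apply\<close>)
qed

lemma to_phi_affine: "complex_affine_action G X t E (to_phi \<sigma> \<rho>)"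
  unfolding complex_affine_action_def smooth_action_def lie_manifold_TG bundle_morphism_affine
proof (intro conjI ballI allI impI to_phi_smooth E)
  show "to_phi \<sigma> \<rho> \<in> extensional (carrier TG)" by (simp add: to_phi_def)
  show "group_action TG (pts E) (to_phi \<sigma> \<rho>)"
    by (rule group_actionI[OF group_TG])
      (auto simp: to_phi_closed to_phi_one to_phi_mult, simp add: to_phi_def)
  show "bproj E (to_phi \<sigma> \<rho> v e) = t (fst v) (bproj E e)" if "v \<in> carrier TG" "e \<in> pts E" for v e
    by (rule to_phi_closed(2)[OF that])
next
  fix g u w e f assume g: "g \<in> carrier G" and u: "u \<in> carrier (CT g)" and w: "w \<in> carrier (CT g)"
    and e: "e \<in> pts E" and f: "f \<in> pts E" and ef: "bproj E f = bproj E e"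
  have TG: "(g, u) \<in> carrier TG" "(g, w) \<in> carrier TG" "(g, u \<oplus>\<^bsub>CT g\<^esub> w) \<in> carrier TG"
    using g u w CT_closed(1) by (auto simp: carrier_TG)
  note pu = phi_parts[OF TG(1) e, simplified] and pw = phi_parts[OF TG(2) f, simplified]
  \<comment> \<open>Linearity yields the two \<sigma>-terms together and the two \<rho>-terms
    together; \<open>badd_medial\<close> regroups them by the pairs (u, e) and (w, f).\<close>
  have "to_phi \<sigma> \<rho> (g, u \<oplus>\<^bsub>CT g\<^esub> w) (badd E e f) = badd E (badd E (\<sigma> g e) (\<sigma> g f))
      (badd E (\<rho> (mc_form (g, u)) (t g (bproj E e))) (\<rho> (mc_form (g, w)) (t g (bproj E e))))"
    using to_phi_apply[OF TG(3) badd_closed(1)[OF e f ef]] badd_closed(2)[OF e f ef]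
      rho_add[OF mc_form_closed[OF TG(1)] mc_form_closed[OF TG(2)] pu(5)] sigma_linear(1)[OF g e f ef]
    by (simp add: mc_form_add[OF g])
  also have "\<dots> = badd E (badd E (\<sigma> g e) (\<rho> (mc_form (g, u)) (t g (bproj E e))))
      (badd E (\<sigma> g f) (\<rho> (mc_form (g, w)) (t g (bproj E e))))"
    by (rule badd_medial) (use pu pw ef in auto)
  finally show "to_phi \<sigma> \<rho> (g, u \<oplus>\<^bsub>CT g\<^esub> w) (badd E e f) =
      badd E (to_phi \<sigma> \<rho> (g, u) e) (to_phi \<sigma> \<rho> (g, w) f)"
    by (simp add: to_phi_apply TG e f ef)
next
  fix a g u e assume g: "g \<in> carrier G" and u: "u \<in> carrier (CT g)" and e: "e \<in> pts E"
  have TG: "(g, u) \<in> carrier TG" "(g, a \<odot>\<^bsub>CT g\<^esub> u) \<in> carrier TG"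
    using g u CT_closed(2) by (auto simp: carrier_TG)
  note pu = phi_parts[OF TG(1) e, simplified]
  show "to_phi \<sigma> \<rho> (g, a \<odot>\<^bsub>CT g\<^esub> u) (bsmult E a e) = bsmult E a (to_phi \<sigma> \<rho> (g, u) e)"
    using to_phi_apply[OF TG(2) bsmult_closed(1)[OF e]] bsmult_closed(2)[OF e]
      rho_smult[OF mc_form_closed[OF TG(1)] pu(5)] sigma_linear(2)[OF g e] bsmult_badd[OF pu(1) pu(3)] pu
    by (simp add: mc_form_smult[OF g] to_phi_apply[OF TG(1) e])
qed

text \<open>The Maurer-Cartan form of a zero vector is zero, so the \<rho>-term is the zero of the
  fibre.\<close>

lemma to_sigma_to_phi: "to_sigma (to_phi \<sigma> \<rho>) = \<sigma>"
proof (rule extensionalityI[of _ "carrier G"])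
  show "to_sigma (to_phi \<sigma> \<rho>) \<in> extensional (carrier G)" by (simp add: to_sigma_def)
  show "\<sigma> \<in> extensional (carrier G)" using equiv by (simp add: equivariant_bundle_def)
  fix g assume g: "g \<in> carrier G"
  show "to_sigma (to_phi \<sigma> \<rho>) g = \<sigma> g"
  proof (rule extensionalityI[of _ "pts E"])
    show "to_sigma (to_phi \<sigma> \<rho>) g \<in> extensional (pts E)"
      using g zero_in_TG by (simp add: to_sigma_def to_phi_def)
    show "\<sigma> g \<in> extensional (pts E)" by (rule group_actionD(1)[OF sigma_action g])
    fix e assume e: "e \<in> pts E"
    note p = phi_parts[OF zero_in_TG[OF g] e, simplified]
    show "to_sigma (to_phi \<sigma> \<rho>) g e = \<sigma> g e"
      using badd_zero(2)[OF p(1)] p g e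
      by (simp add: to_sigma_def to_phi_apply zero_in_TG mc_form_zero rho_zero)
  qed
qed

text \<open>Over the identity of G the Maurer-Cartan form returns \<alpha> itself, and the
  \<sigma>-term is the zero vector acted on by the identity.\<close>

lemma to_rho_to_phi: "to_rho (to_phi \<sigma> \<rho>) = \<rho>"
proof (rule extensionalityI[of _ "carrier (CT \<one>)"])
  show "to_rho (to_phi \<sigma> \<rho>) \<in> extensional (carrier (CT \<one>))" by (simp add: to_rho_def)
  show "\<rho> \<in> extensional (carrier (CT \<one>))" by (rule rho_extensional)
  fix \<alpha> assume \<alpha>: "\<alpha> \<in> carrier (CT \<one>)"
  show "to_rho (to_phi \<sigma> \<rho>) \<alpha> = \<rho> \<alpha>"
  proof (rule extensionalityI[of _ "carrier X"])
    show "to_rho (to_phi \<sigma> \<rho>) \<alpha> \<in> extensional (carrier X)" using \<alpha> by (simp add: to_rho_def)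
    show "\<rho> \<alpha> \<in> extensional (carrier X)" using rho_section[OF \<alpha>] by (simp add: sections_iff)
    fix x assume x: "x \<in> carrier X"
    note z = bzero_in[OF x]
    show "to_rho (to_phi \<sigma> \<rho>) \<alpha> x = \<rho> \<alpha> x"
      using \<alpha> x z group_actionD(3)[OF sigma_action z(1)] t_one[OF x] badd_zero(1)[OF rho_in(1)[OF \<alpha> x]] rho_in(2)[OF \<alpha> x]
      by (simp add: to_rho_def to_phi_apply one_in_TG mc_form_one)
  qed
qed

end

end

section \<open>The isomorphism between affine actions and pairs\<close>

context lie_action
begin

lemma lie_action_bundleI: "complex_vector_bundle X E \<Longrightarrow> lie_action_bundle G X t E"
  by (intro lie_action_bundle.intro vector_bundle.intro lie_action_axioms premanifold_X)

text \<open>Forwards, specialise to zero vectors and to vectors over the identity acting on the zero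
  section. Backwards, rewrite both actions by \<open>to_phi_inverse\<close>, so that
  \<open>\<psi>\<close> only has to respect the sum and its two terms. With two bundles in play, the
  locale constants appear in exported form.\<close>

lemma affine_hom_iff:
  assumes E: "complex_affine_action G X t E \<phi>" and E': "complex_affine_action G X t E' \<phi>'"
    and \<psi>: "\<psi> \<in> vect_hom X E E'"
  shows "(\<forall>v\<in>carrier TG. \<forall>e\<in>pts E. \<psi> (\<phi> v e) = \<phi>' v (\<psi> e)) \<longleftrightarrow>
    (\<forall>g\<in>carrier G. \<forall>e\<in>pts E. \<psi> (lie_action_bundle.to_sigma G \<phi> g e) = lie_action_bundle.to_sigma G \<phi>' g (\<psi> e)) \<and>
    compose (carrier (CT \<one>)) (sections_map X \<psi>) (lie_action_bundle.to_rho G X E \<phi>) = lie_action_bundle.to_rho G X E' \<phi>'"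
    (is "?L \<longleftrightarrow> ?R1 \<and> ?R2")
proof -
  interpret E: lie_action_bundle G X t E
    by (rule lie_action_bundleI) (use E in \<open>simp add: complex_affine_action_def\<close>)
  interpret E': lie_action_bundle G X t E'
    by (rule lie_action_bundleI) (use E' in \<open>simp add: complex_affine_action_def\<close>)
  note \<psi>D = vect_homD[OF \<psi>]
  have \<psi>0: "\<psi> (bzero E x) = bzero E' x" if "x \<in> carrier X" for x
  proof -
    note z = E.bzero_in[OF that]
    have "\<psi> (bsmult E 0 (bzero E x)) = bsmult E' 0 (\<psi> (bzero E x))" using \<psi>D(6)[of "bzero E x" 0] z that by simp
    then show ?thesis using E.bsmult_0[OF z(1)] E'.bsmult_0[OF \<psi>D(3)[OF z(1)]] \<psi>D(4)[OF z(1)] z by simp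
  qed
  have R2: "?R2 \<longleftrightarrow> (\<forall>\<alpha>\<in>carrier (CT \<one>). \<forall>x\<in>carrier X. \<psi> (\<phi> (\<one>, \<alpha>) (bzero E x)) = \<phi>' (\<one>, \<alpha>) (bzero E' x))"
    by (auto simp: compose_def sections_map_def E.to_rho_def E'.to_rho_def fun_eq_iff restrict_def split: if_splits)
  show ?thesis
  proof
    assume L: ?L
    then show "?R1 \<and> ?R2"
      unfolding R2 using E.zero_in_TG E.one_in_TG E.bzero_in \<psi>0
      by (auto simp: E.to_sigma_def E'.to_sigma_def)
  next
    assume R: "?R1 \<and> ?R2"
    show ?L
    proof (intro ballI)
      fix v e assume v: "v \<in> carrier TG" and e: "e \<in> pts E"
      have g: "fst v \<in> carrier G" using v by (auto simp: carrier_TG)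
      let ?x = "t (fst v) (bproj E e)"
      have x: "?x \<in> carrier X" by (rule t_closed[OF g E.bproj_in[OF e]])
      note equiv = E.to_sigma_equivariant[OF E] E.to_rho_equivariant[OF E]
      note p = E.phi_parts[OF equiv v e]
      note \<psi>e = \<psi>D(3)[OF e] \<psi>D(4)[OF e]
      have "\<psi> (\<phi> v e) = \<psi> (E.to_phi (E.to_sigma \<phi>) (E.to_rho \<phi>) v e)"
        using E.to_phi_inverse[OF E] by simp
      also have "\<dots> = badd E' (\<psi> (E.to_sigma \<phi> (fst v) e)) (\<psi> (E.to_rho \<phi> (mc_form v) ?x))"
        unfolding E.to_phi_apply[OF equiv v e] by (rule \<psi>D(5)) (use p in auto)
      also have "\<psi> (E.to_sigma \<phi> (fst v) e) = E'.to_sigma \<phi>' (fst v) (\<psi> e)" using R g e by blast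
      also have "\<psi> (E.to_rho \<phi> (mc_form v) ?x) = E'.to_rho \<phi>' (mc_form v) ?x"
        using R[unfolded R2] mc_form_closed[OF v] x by (simp add: E.to_rho_def E'.to_rho_def)
      also have "badd E' (E'.to_sigma \<phi>' (fst v) (\<psi> e)) (E'.to_rho \<phi>' (mc_form v) ?x) =
          E'.to_phi (E'.to_sigma \<phi>') (E'.to_rho \<phi>') v (\<psi> e)"
        using v \<psi>e by (simp add: E'.to_phi_def)
      also have "\<dots> = \<phi>' v (\<psi> e)" using E'.to_phi_inverse[OF E'] by simp
      finally show "\<psi> (\<phi> v e) = \<phi>' v (\<psi> e)" .
    qed
  qed
qed

lemma is_category_Vect_aff: "is_category (Vect_aff G X t :: (('x, 'e) cvbundle \<times> _, 'e \<Rightarrow> 'e) category)"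
proof (rule concrete_category[where P = "\<lambda>a. pts (fst a)"])
  let ?C = "Vect_aff G X t :: (('x, 'e) cvbundle \<times> _, 'e \<Rightarrow> 'e) category"
  have vector_bundle: "vector_bundle X (fst a)" if "a \<in> Obj ?C" for a
    using that premanifold_X by (auto simp: Vect_aff_def complex_affine_action_def vector_bundle_def)
  have Hom: "f \<in> Hom ?C a b \<longleftrightarrow> f \<in> vect_hom X (fst a) (fst b) \<and>
      (\<forall>v\<in>carrier TG. \<forall>e\<in>pts (fst a). f (snd a v e) = snd b v (f e))" for f a b
    by (cases a; cases b) (simp add: Vect_aff_def)
  have closed: "snd a v e \<in> pts (fst a)" if "a \<in> Obj ?C" "v \<in> carrier TG" "e \<in> pts (fst a)" for a v e
    using that by (auto simp: Vect_aff_def complex_affine_action_def smooth_action_def dest!: group_actionD(2))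
  show "f \<in> extensional (pts (fst a)) \<and> f \<in> pts (fst a) \<rightarrow> pts (fst b)" if "f \<in> Hom ?C a b" for a b f
    using that vect_homD(1,3)[of f X "fst a" "fst b"] unfolding Hom by auto
  show "(\<lambda>e\<in>pts (fst a). e) \<in> Hom ?C a a" if "a \<in> Obj ?C" for a
    unfolding Hom using vect_hom_id[OF vector_bundle[OF that]] closed[OF that] by simp
  show "compose (pts (fst a)) g f \<in> Hom ?C a c"
    if "a \<in> Obj ?C" "b \<in> Obj ?C" "c \<in> Obj ?C" "f \<in> Hom ?C a b" "g \<in> Hom ?C b c" for a b c f g
    using that(4,5) vect_hom_compose[OF vector_bundle[OF that(1)] vector_bundle[OF that(2)] vector_bundle[OF that(3)], of f g]
      vect_homD(3)[of f X "fst a" "fst b"] closed[OF that(1)]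
    unfolding Hom by (auto simp: compose_def)
  show "Comp ?C a b c g f = compose (pts (fst a)) g f" for a b c f g
    by (cases a) (simp add: Vect_aff_def)
  show "Idn ?C a = (\<lambda>e\<in>pts (fst a). e)" for a
    by (cases a) (simp add: Vect_aff_def)
qed

lemma isomorphic_Vect_aff_Pairs:
  "isomorphic_categories (Vect_aff G X t :: (('x, 'e) cvbundle \<times> _, 'e \<Rightarrow> 'e) category)
    (Pairs G X t :: (_, 'e \<Rightarrow> 'e) category)"
proof (rule isomorphic_categoriesI[OF is_category_Vect_aff, where
      F = "\<lambda>(E, \<phi>). ((E, lie_action_bundle.to_sigma G \<phi>), lie_action_bundle.to_rho G X E \<phi>)" and
      K = "\<lambda>((E, \<sigma>), \<rho>). (E, lie_action_bundle.to_phi G t E \<sigma> \<rho>)"])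
  let ?C = "Vect_aff G X t :: (('x, 'e) cvbundle \<times> _, 'e \<Rightarrow> 'e) category"
  let ?F = "\<lambda>(E :: ('x, 'e) cvbundle, \<phi>). ((E, lie_action_bundle.to_sigma G \<phi>), lie_action_bundle.to_rho G X E \<phi>)"
  let ?K = "\<lambda>((E :: ('x, 'e) cvbundle, \<sigma>), \<rho>). (E, lie_action_bundle.to_phi G t E \<sigma> \<rho>)"
  show "?F a \<in> Obj (Pairs G X t) \<and> ?K (?F a) = a" if a: "a \<in> Obj ?C" for a
  proof -
    obtain E \<phi> where a': "a = (E, \<phi>)" "complex_affine_action G X t E \<phi>" using a by (auto simp: Vect_aff_def)
    interpret lie_action_bundle G X t E by (rule lie_action_bundleI) (use a'(2) in \<open>simp add: complex_affine_action_def\<close>)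
    show ?thesis using to_sigma_equivariant[OF a'(2)] to_rho_equivariant[OF a'(2)] to_phi_inverse[OF a'(2)]
      by (simp add: a' Pairs_def Vect_def)
  qed
  show "?K b \<in> Obj ?C \<and> ?F (?K b) = b" if b: "b \<in> Obj (Pairs G X t)" for b
  proof -
    obtain E \<sigma> \<rho> where b': "b = ((E, \<sigma>), \<rho>)" and e: "equivariant_bundle G X t E \<sigma>" "equivariant_linear_map G X t E \<sigma> \<rho>"
      using b by (auto simp: Pairs_def Vect_def)
    interpret lie_action_bundle G X t E by (rule lie_action_bundleI) (use e(1) in \<open>simp add: equivariant_bundle_def\<close>)
    show ?thesis using to_phi_affine[OF e] to_sigma_to_phi[OF e] to_rho_to_phi[OF e]
      by (simp add: b' Vect_aff_def)
  qed
  show "Hom (Pairs G X t) (?F a) (?F b) = Hom ?C a b" if a: "a \<in> Obj ?C" and b: "b \<in> Obj ?C" for a b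
  proof -
    obtain E \<phi> where a': "a = (E, \<phi>)" "complex_affine_action G X t E \<phi>" using a by (auto simp: Vect_aff_def)
    obtain E' \<phi>' where b': "b = (E', \<phi>')" "complex_affine_action G X t E' \<phi>'" using b by (auto simp: Vect_aff_def)
    show ?thesis
    proof (rule Set.set_eqI)
      fix \<psi>
      show "\<psi> \<in> Hom (Pairs G X t) (?F a) (?F b) \<longleftrightarrow> \<psi> \<in> Hom ?C a b"
        using affine_hom_iff[OF a'(2) b'(2), of \<psi>]
        by (cases "\<psi> \<in> vect_hom X E E'")
          (simp_all add: a'(1) b'(1) Pairs_def Vect_def Vect_aff_def lie_algebra_C_CT conj_ac)
    qed
  qed
  show "Comp (Pairs G X t) (?F a) (?F b) (?F c) g f = Comp ?C a b c g f" for a b c f g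
    by (cases a; cases b; cases c) (simp add: Pairs_def Vect_def Vect_aff_def)
  show "Idn (Pairs G X t) (?F a) = Idn ?C a" for a
    by (cases a) (simp add: Pairs_def Vect_def Vect_aff_def)
qed

end

section \<open>Pairs and the slice category\<close>

text \<open>A point of type \<open>'e\<close> does not display a base point or a vector; injectivity
  of \<open>j\<close> lets \<open>jinv\<close> read both off.\<close>

locale lie_action_embedding = lie_action G X t for G :: "'g lie_group" (structure) and X :: "'x manifold" and t +
  fixes j :: "'x \<times> 'g ctvec \<Rightarrow> 'e"
  assumes inj: "inj_on j (carrier X \<times> carrier (lie_algebra_C G))"
begin

abbreviation "B \<equiv> carrier X \<times> carrier (CT \<one>)"
abbreviation "jinv \<equiv> the_inv_into B j"
abbreviation "gC \<equiv> fst (gC_bundle G X t j)"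

lemma jinv: "x \<in> carrier X \<Longrightarrow> \<alpha> \<in> carrier (CT \<one>) \<Longrightarrow> jinv (j (x, \<alpha>)) = (x, \<alpha>)"
  using inj by (intro the_inv_into_f_f) (auto simp: lie_algebra_C_CT)

lemma gC_simps:
  "pts gC = j ` B"
  "x \<in> carrier X \<Longrightarrow> \<alpha> \<in> carrier (CT \<one>) \<Longrightarrow> bproj gC (j (x, \<alpha>)) = x"
  "x \<in> carrier X \<Longrightarrow> \<alpha> \<in> carrier (CT \<one>) \<Longrightarrow> \<beta> \<in> carrier (CT \<one>) \<Longrightarrow>
     badd gC (j (x, \<alpha>)) (j (x, \<beta>)) = j (x, \<alpha> \<oplus>\<^bsub>CT \<one>\<^esub> \<beta>)"
  "x \<in> carrier X \<Longrightarrow> \<alpha> \<in> carrier (CT \<one>) \<Longrightarrow> bsmult gC a (j (x, \<alpha>)) = j (x, a \<odot>\<^bsub>CT \<one>\<^esub> \<alpha>)"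
  "g \<in> carrier G \<Longrightarrow> x \<in> carrier X \<Longrightarrow> \<alpha> \<in> carrier (CT \<one>) \<Longrightarrow>
     snd (gC_bundle G X t j) g (j (x, \<alpha>)) = j (t g x, Ad_C G g \<alpha>)"
  by (simp_all add: gC_bundle_def image_bundle_def trivial_bundle_def image_manifold_def Let_def
      lie_algebra_C_CT jinv)

lemma tot_gC: "tot gC = image_manifold j (prod_manifold X (vs_manifold (CT \<one>)))"
  by (simp add: gC_bundle_def image_bundle_def trivial_bundle_def Let_def lie_algebra_C_CT)

definition to_Psi :: "('g ctvec \<Rightarrow> 'x \<Rightarrow> 'e) \<Rightarrow> 'e \<Rightarrow> 'e" where
  "to_Psi \<rho> = (\<lambda>q\<in>j ` B. \<rho> (snd (jinv q)) (fst (jinv q)))"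

definition from_Psi :: "('e \<Rightarrow> 'e) \<Rightarrow> 'g ctvec \<Rightarrow> 'x \<Rightarrow> 'e" where
  "from_Psi \<Psi> = (\<lambda>\<alpha>\<in>carrier (CT \<one>). \<lambda>x\<in>carrier X. \<Psi> (j (x, \<alpha>)))"

lemma to_Psi_apply: "x \<in> carrier X \<Longrightarrow> \<alpha> \<in> carrier (CT \<one>) \<Longrightarrow> to_Psi \<rho> (j (x, \<alpha>)) = \<rho> \<alpha> x"
  by (simp add: to_Psi_def jinv)

lemma premanifold_vs_CT: "premanifold (vs_manifold (CT \<one>))"
  and premanifold_B: "premanifold (prod_manifold X (vs_manifold (CT \<one>)))"
proof -
  have "(SOME c. c \<in> charts_at LM \<one>) \<in> charts_at LM \<one>" by (rule some_chart_at[OF premanifold_LM]) simp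
  then show "premanifold (vs_manifold (CT \<one>))"
    by (rule premanifold_vs(1)[OF vec_closed_ctangent lin_iso_ctangent[OF premanifold_LM]])
  then show "premanifold (prod_manifold X (vs_manifold (CT \<one>)))"
    by (rule premanifold_prod(1)[OF premanifold_X])
qed

lemma inj_B: "inj_on j (carrier (prod_manifold X (vs_manifold (CT \<one>))))"
  using inj by (simp add: lie_algebra_C_CT)

section \<open>Linear maps into sections and bundle maps out of the trivial bundle\<close>

context
  fixes E :: "('x, 'e) cvbundle" and \<sigma>
  assumes equiv: "equivariant_bundle G X t E \<sigma>"
begin

interpretation lie_action_bundle G X t E
  by (rule lie_action_bundleI) (use equiv in \<open>simp add: equivariant_bundle_def\<close>)

lemma to_Psi_hom:
  assumes elm: "equivariant_linear_map G X t E \<sigma> \<rho>"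
  shows "to_Psi \<rho> \<in> Hom (Vect G X t) (gC_bundle G X t j) (E, \<sigma>)"
proof -
  note rin = rho_in[OF equiv elm]
  let ?V = "CT \<one>"
  let ?P = "prod_manifold X (vs_manifold ?V)"
  obtain c where c: "c \<in> charts_at LM \<one>" using some_chart_at[OF premanifold_LM] by auto
  have s1: "smooth_map ?P X fst" by (rule smooth_map_fst[OF X premanifold_vs_CT])
  have s2: "smooth_map ?P (vs_manifold ?V) snd" by (rule smooth_map_snd[OF X premanifold_vs_CT])
  \<comment> \<open>Adding the zero vector brings \<rho> \<alpha> (x) into the form treated by
    \<open>smooth_badd_section\<close>; it is removed again by \<open>badd_zero\<close>.\<close>
  have "smooth_map ?P (tot E) (\<lambda>p. badd E (bzero E (fst p)) (\<rho> (snd p) (fst p)))"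
  proof (rule smooth_badd_section[OF vec_closed_ctangent lin_iso_ctangent[OF premanifold_LM c]
        rho_linear_maps[OF equiv elm] premanifold_B s1])
    show "smooth_map ?P (tot E) (\<lambda>p. bzero E (fst p))"
      by (rule smooth_map_compose[OF premanifold_B X premanifold_tot s1 smooth_bzero])
    show "smooth_on ?P (carrier ?P) (\<lambda>p. realify (cdim c) (ctangent_coord c (snd p)) k)" if "k < 2 * cdim c" for k
    proof -
      have "{p \<in> carrier ?P. snd p \<in> carrier ?V} = carrier ?P" by auto
      then show ?thesis
        using smooth_on_pullback[OF premanifold_B premanifold_vs_CT s2
            smooth_on_vs_coord[OF vec_closed_ctangent lin_iso_ctangent[OF premanifold_LM c] that]] by simp
    qed
  qed (auto simp: bzero_in)
  then have "smooth_map ?P (tot E) (\<lambda>p. to_Psi \<rho> (j p))"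
  proof (rule smooth_map_cong[OF premanifold_B premanifold_tot])
    fix p assume "p \<in> carrier ?P"
    then obtain x \<alpha> where p: "p = (x, \<alpha>)" "x \<in> carrier X" "\<alpha> \<in> carrier ?V" by auto
    show "badd E (bzero E (fst p)) (\<rho> (snd p) (fst p)) = to_Psi \<rho> (j p)"
      using badd_zero(1)[OF rin(1)[OF p(3,2)]] rin(2)[OF p(3,2)] p by (simp add: to_Psi_apply)
  qed
  then have sm: "smooth_map (tot gC) (tot E) (to_Psi \<rho>)"
    unfolding tot_gC by (rule smooth_map_image_manifold[OF inj_B premanifold_B])
  have "to_Psi \<rho> \<in> vect_hom X gC E"
  proof (rule vect_homI[OF _ sm])
    show "to_Psi \<rho> \<in> extensional (pts gC)" by (simp add: to_Psi_def gC_simps)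
    show "bproj E (to_Psi \<rho> q) = bproj gC q" if "q \<in> pts gC" for q
      using that rin by (auto simp: gC_simps to_Psi_apply)
    show "to_Psi \<rho> (badd gC q q') = badd E (to_Psi \<rho> q) (to_Psi \<rho> q')"
      if "q \<in> pts gC" "q' \<in> pts gC" "bproj gC q' = bproj gC q" for q q'
      using that rho_add[OF equiv elm] CT_closed(1) by (auto simp: gC_simps to_Psi_apply)
    show "to_Psi \<rho> (bsmult gC a q) = bsmult E a (to_Psi \<rho> q)" if "q \<in> pts gC" for a q
      using that rho_smult[OF equiv elm] CT_closed(2) by (auto simp: gC_simps to_Psi_apply)
  qed
  moreover have "to_Psi \<rho> (snd (gC_bundle G X t j) g q) = \<sigma> g (to_Psi \<rho> q)"
    if "g \<in> carrier G" "q \<in> pts gC" for g q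
    using that rho_Ad_apply[OF equiv elm] t_closed Ad_C_closed by (auto simp: gC_simps to_Psi_apply)
  ultimately show ?thesis by (cases "gC_bundle G X t j") (simp add: Vect_def)
qed

lemma from_Psi_elm:
  assumes \<Psi>: "\<Psi> \<in> Hom (Vect G X t) (gC_bundle G X t j) (E, \<sigma>)"
  shows "equivariant_linear_map G X t E \<sigma> (from_Psi \<Psi>)"
  unfolding equivariant_linear_map_def lie_algebra_C_CT
proof (intro conjI ballI)
  let ?\<rho> = "from_Psi \<Psi>" and ?V = "CT \<one>"
  have hom: "\<Psi> \<in> vect_hom X gC E"
    and eq: "\<And>g q. g \<in> carrier G \<Longrightarrow> q \<in> pts gC \<Longrightarrow> \<Psi> (snd (gC_bundle G X t j) g q) = \<sigma> g (\<Psi> q)"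
    using \<Psi> by (cases "gC_bundle G X t j", simp add: Vect_def)+
  note \<Psi>D = vect_homD[OF hom]
  have r: "?\<rho> \<alpha> x = \<Psi> (j (x, \<alpha>))" if "\<alpha> \<in> carrier ?V" "x \<in> carrier X" for \<alpha> x
    using that by (simp add: from_Psi_def)
  have rext: "?\<rho> \<alpha> \<in> extensional (carrier X)" if "\<alpha> \<in> carrier ?V" for \<alpha>
    using that by (simp add: from_Psi_def)
  have inB: "j (x, \<alpha>) \<in> pts gC" if "\<alpha> \<in> carrier ?V" "x \<in> carrier X" for \<alpha> x
    using that by (simp add: gC_simps)
  have sm: "smooth_map (prod_manifold X (vs_manifold ?V)) (tot E) (\<lambda>p. \<Psi> (j p))"
    using smooth_map_from_image_manifold[OF inj_B premanifold_B premanifold_tot] \<Psi>D(2) unfolding tot_gC by simp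
  show "?\<rho> \<in> linear_maps ?V (sections X E)"
    unfolding linear_maps_def
  proof (intro CollectI conjI ballI allI)
    show "?\<rho> \<in> carrier ?V \<rightarrow> carrier (sections X E)"
    proof
      fix \<alpha> assume \<alpha>: "\<alpha> \<in> carrier ?V"
      \<comment> \<open>Restricting the bundle map to the slice at a fixed \<alpha> gives the
        section \<open>?\<rho> \<alpha>\<close>.\<close>
      have "smooth_map X (prod_manifold X (vs_manifold ?V)) (\<lambda>x. (x, \<alpha>))"
        by (rule smooth_map_Pair[OF X X premanifold_vs_CT smooth_map_id[OF X] smooth_map_const[OF X premanifold_vs_CT]])
          (use \<alpha> in simp)
      from smooth_map_compose[OF X premanifold_B premanifold_tot this sm]
      have "smooth_map X (tot E) (?\<rho> \<alpha>)"
        by (rule smooth_map_cong[OF X premanifold_tot]) (simp add: r \<alpha>)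
      moreover have "bproj E (?\<rho> \<alpha> x) = x" if "x \<in> carrier X" for x
        using \<Psi>D(4)[OF inB[OF \<alpha> that]] \<alpha> that by (simp add: r gC_simps)
      ultimately show "?\<rho> \<alpha> \<in> carrier (sections X E)" using rext[OF \<alpha>] by (simp add: sections_iff)
    qed
    show "?\<rho> (\<alpha> \<oplus>\<^bsub>?V\<^esub> \<beta>) = ?\<rho> \<alpha> \<oplus>\<^bsub>sections X E\<^esub> ?\<rho> \<beta>" if \<alpha>: "\<alpha> \<in> carrier ?V" and \<beta>: "\<beta> \<in> carrier ?V" for \<alpha> \<beta>
    proof (rule extensionalityI[OF rext[OF CT_closed(1)[OF \<alpha> \<beta>]] sections_ext(1)])
      fix x assume x: "x \<in> carrier X"
      show "?\<rho> (\<alpha> \<oplus>\<^bsub>?V\<^esub> \<beta>) x = (?\<rho> \<alpha> \<oplus>\<^bsub>sections X E\<^esub> ?\<rho> \<beta>) x"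
        using \<Psi>D(5)[OF _ inB[OF \<alpha> x] inB[OF \<beta> x]] \<alpha> \<beta> x CT_closed(1)[OF \<alpha> \<beta>]
        by (simp add: sections_ops r gC_simps)
    qed
    show "?\<rho> (a \<odot>\<^bsub>?V\<^esub> \<alpha>) = a \<odot>\<^bsub>sections X E\<^esub> ?\<rho> \<alpha>" if \<alpha>: "\<alpha> \<in> carrier ?V" for a \<alpha>
    proof (rule extensionalityI[OF rext[OF CT_closed(2)[OF \<alpha>]] sections_ext(2)])
      fix x assume x: "x \<in> carrier X"
      show "?\<rho> (a \<odot>\<^bsub>?V\<^esub> \<alpha>) x = (a \<odot>\<^bsub>sections X E\<^esub> ?\<rho> \<alpha>) x"
        using \<Psi>D(6)[OF _ inB[OF \<alpha> x], of a] \<alpha> x CT_closed(2)[OF \<alpha>] by (simp add: sections_ops r gC_simps)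
    qed
  qed
  show "?\<rho> \<in> extensional (carrier ?V)" by (simp add: from_Psi_def)
  show "?\<rho> (Ad_C G g \<alpha>) = section_action G X t \<sigma> g (?\<rho> \<alpha>)" if g: "g \<in> carrier G" and \<alpha>: "\<alpha> \<in> carrier ?V" for g \<alpha>
  proof (rule extensionalityI[OF rext[OF Ad_C_closed[OF g \<alpha>]]])
    show "section_action G X t \<sigma> g (?\<rho> \<alpha>) \<in> extensional (carrier X)" by (simp add: section_action_def)
    fix x assume x: "x \<in> carrier X"
    have tx: "t (inv g) x \<in> carrier X" using t_closed[of "inv g" x] g x by simp
    \<comment> \<open>Equivariance of \<open>\<Psi>\<close> is used over the point g^-1 x, which
      \<open>t g\<close> brings back to x.\<close>
    show "?\<rho> (Ad_C G g \<alpha>) x = section_action G X t \<sigma> g (?\<rho> \<alpha>) x"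
      using eq[OF g inB[OF \<alpha> tx]] t_inv(2)[OF g x] g \<alpha> x tx Ad_C_closed[OF g \<alpha>]
      by (simp add: section_action_def r gC_simps)
  qed
qed

lemma to_from_Psi:
  assumes \<Psi>: "\<Psi> \<in> Hom (Vect G X t) (gC_bundle G X t j) (E, \<sigma>)"
  shows "to_Psi (from_Psi \<Psi>) = \<Psi>"
proof (rule extensionalityI[of _ "j ` B"])
  show "to_Psi (from_Psi \<Psi>) \<in> extensional (j ` B)" by (simp add: to_Psi_def)
  have "\<Psi> \<in> vect_hom X gC E" using \<Psi> by (cases "gC_bundle G X t j") (simp add: Vect_def)
  then show "\<Psi> \<in> extensional (j ` B)" using vect_homD(1) gC_simps(1) by metis
  show "to_Psi (from_Psi \<Psi>) q = \<Psi> q" if "q \<in> j ` B" for q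
    using that by (auto simp: to_Psi_apply from_Psi_def)
qed

lemma from_to_Psi:
  assumes elm: "equivariant_linear_map G X t E \<sigma> \<rho>"
  shows "from_Psi (to_Psi \<rho>) = \<rho>"
proof (rule extensionalityI[of _ "carrier (CT \<one>)"])
  show "from_Psi (to_Psi \<rho>) \<in> extensional (carrier (CT \<one>))" by (simp add: from_Psi_def)
  show "\<rho> \<in> extensional (carrier (CT \<one>))" by (rule rho_extensional[OF equiv elm])
  fix \<alpha> assume \<alpha>: "\<alpha> \<in> carrier (CT \<one>)"
  show "from_Psi (to_Psi \<rho>) \<alpha> = \<rho> \<alpha>"
    by (rule extensionalityI[of _ "carrier X"])
      (use \<alpha> rho_section[OF equiv elm \<alpha>] in \<open>auto simp: from_Psi_def to_Psi_apply sections_iff\<close>)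
qed

end

lemma isomorphic_Pairs_slice:
  "isomorphic_categories (Pairs G X t :: (_, 'e \<Rightarrow> 'e) category) (slice_category (gC_bundle G X t j) (Vect G X t))"
proof (rule isomorphic_categoriesI[where F = "\<lambda>(a, \<rho>). (a, to_Psi \<rho>)" and K = "\<lambda>(a, \<Psi>). (a, from_Psi \<Psi>)"])
  let ?C = "Pairs G X t :: (_, 'e \<Rightarrow> 'e) category" and ?D = "slice_category (gC_bundle G X t j) (Vect G X t)"
  let ?F = "\<lambda>(a :: ('x, 'e) cvbundle \<times> ('g \<Rightarrow> 'e \<Rightarrow> 'e), \<rho>). (a, to_Psi \<rho>)"
  let ?K = "\<lambda>(a :: ('x, 'e) cvbundle \<times> ('g \<Rightarrow> 'e \<Rightarrow> 'e), \<Psi>). (a, from_Psi \<Psi>)"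
  \<comment> \<open>\<open>isomorphic_categories\<close> includes that both sides are categories, so
    the axioms for \<open>Pairs\<close> come from the first isomorphism.\<close>
  have "isomorphic_categories (Vect_aff G X t :: (_, 'e \<Rightarrow> 'e) category) ?C"
    by (rule isomorphic_Vect_aff_Pairs)
  then show "is_category ?C" by (simp only: isomorphic_categories_def)
  show "?F a \<in> Obj ?D \<and> ?K (?F a) = a" if a: "a \<in> Obj ?C" for a
  proof -
    obtain E \<sigma> \<rho> where a': "a = ((E, \<sigma>), \<rho>)" and e: "equivariant_bundle G X t E \<sigma>" "equivariant_linear_map G X t E \<sigma> \<rho>"
      using a by (auto simp: Pairs_def Vect_def)
    have "(E, \<sigma>) \<in> Obj (Vect G X t)" using e by (simp add: Vect_def)
    then show ?thesis using to_Psi_hom[OF e] from_to_Psi[OF e] by (simp add: a' slice_category_def)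
  qed
  show "?K b \<in> Obj ?C \<and> ?F (?K b) = b" if b: "b \<in> Obj ?D" for b
  proof -
    obtain E \<sigma> \<Psi> where b': "b = ((E, \<sigma>), \<Psi>)" and o: "(E, \<sigma>) \<in> Obj (Vect G X t)"
      and \<Psi>: "\<Psi> \<in> Hom (Vect G X t) (gC_bundle G X t j) (E, \<sigma>)"
      using b by (auto simp: slice_category_def)
    have e: "equivariant_bundle G X t E \<sigma>" using o by (simp add: Vect_def)
    show ?thesis using o from_Psi_elm[OF e \<Psi>] to_from_Psi[OF e \<Psi>] by (simp add: b' Pairs_def)
  qed
  have comp: "Comp (Vect G X t) (gC_bundle G X t j) a b \<theta> \<psi> = compose (j ` B) \<theta> \<psi>"
    for a b :: "('x, 'e) cvbundle \<times> ('g \<Rightarrow> 'e \<Rightarrow> 'e)" and \<theta> \<psi>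
    using gC_simps(1) by (cases "gC_bundle G X t j") (simp add: Vect_def)
  show "Hom ?D (?F a) (?F b) = Hom ?C a b" if a: "a \<in> Obj ?C" and b: "b \<in> Obj ?C" for a b
  proof -
    obtain E \<sigma> \<rho> where a': "a = ((E, \<sigma>), \<rho>)" and e: "equivariant_bundle G X t E \<sigma>" "equivariant_linear_map G X t E \<sigma> \<rho>"
      using a by (auto simp: Pairs_def Vect_def)
    obtain E' \<sigma>' \<rho>' where b': "b = ((E', \<sigma>'), \<rho>')" and e': "equivariant_bundle G X t E' \<sigma>'" "equivariant_linear_map G X t E' \<sigma>' \<rho>'"
      using b by (auto simp: Pairs_def Vect_def)
    interpret E: lie_action_bundle G X t E by (rule lie_action_bundleI) (use e(1) in \<open>simp add: equivariant_bundle_def\<close>)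
    interpret E': lie_action_bundle G X t E' by (rule lie_action_bundleI) (use e'(1) in \<open>simp add: equivariant_bundle_def\<close>)
    \<comment> \<open>The points j (x, \<alpha>) run through exactly the arguments of \<rho>, so
      both conditions say that \<open>\<psi> (\<rho> \<alpha> x) = \<rho>' \<alpha> x\<close> for
      all \<alpha> and x.\<close>
    have "compose (j ` B) \<psi> (to_Psi \<rho>) = to_Psi \<rho>' \<longleftrightarrow>
        compose (carrier (CT \<one>)) (sections_map X \<psi>) \<rho> = \<rho>'" for \<psi>
    proof
      assume L: "compose (j ` B) \<psi> (to_Psi \<rho>) = to_Psi \<rho>'"
      show "compose (carrier (CT \<one>)) (sections_map X \<psi>) \<rho> = \<rho>'"
      proof (rule extensionalityI[OF compose_extensional E'.rho_extensional[OF e']])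
        fix \<alpha> assume \<alpha>: "\<alpha> \<in> carrier (CT \<one>)"
        have "compose (carrier X) \<psi> (\<rho> \<alpha>) = \<rho>' \<alpha>"
        proof (rule extensionalityI[OF compose_extensional])
          show "\<rho>' \<alpha> \<in> extensional (carrier X)" using E'.rho_section[OF e' \<alpha>] by (simp add: E'.sections_iff)
          fix x assume x: "x \<in> carrier X"
          show "compose (carrier X) \<psi> (\<rho> \<alpha>) x = \<rho>' \<alpha> x"
            using fun_cong[OF L, of "j (x, \<alpha>)"] x \<alpha> by (simp add: compose_def to_Psi_apply)
        qed
        then show "compose (carrier (CT \<one>)) (sections_map X \<psi>) \<rho> \<alpha> = \<rho>' \<alpha>"
          using \<alpha> by (simp add: compose_eq sections_map_def)
      qed
    next
      assume R: "compose (carrier (CT \<one>)) (sections_map X \<psi>) \<rho> = \<rho>'"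
      show "compose (j ` B) \<psi> (to_Psi \<rho>) = to_Psi \<rho>'"
      proof (rule extensionalityI[OF compose_extensional])
        show "to_Psi \<rho>' \<in> extensional (j ` B)" by (simp add: to_Psi_def)
        fix q assume "q \<in> j ` B"
        then obtain x \<alpha> where q: "q = j (x, \<alpha>)" "x \<in> carrier X" "\<alpha> \<in> carrier (CT \<one>)" by auto
        show "compose (j ` B) \<psi> (to_Psi \<rho>) q = to_Psi \<rho>' q"
          using fun_cong[OF fun_cong[OF R, of \<alpha>], of x] q by (simp add: compose_def to_Psi_apply sections_map_def)
      qed
    qed
    then show ?thesis
      by (simp add: a' b' slice_category_def Pairs_def comp lie_algebra_C_CT)
  qed
  show "Comp ?D (?F a) (?F b) (?F c) g f = Comp ?C a b c g f" for a b c f g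
    by (cases a; cases b; cases c) (simp add: slice_category_def Pairs_def)
  show "Idn ?D (?F a) = Idn ?C a" for a
    by (cases a) (simp add: slice_category_def Pairs_def)
qed

end

theorem mainTheorem4:
  fixes G :: "'g lie_group" and X :: "'x manifold" and t :: "'g \<Rightarrow> 'x \<Rightarrow> 'x"
    and j :: "'x \<times> 'g ctvec \<Rightarrow> 'e"
  assumes "is_lie_group G"
    and "smooth_manifold X"
    and "smooth_action G X t"
    and "inj_on j (carrier X \<times> carrier (lie_algebra_C G))"
  shows "isomorphic_categories
           (Vect_aff G X t :: (_, 'e \<Rightarrow> 'e) category)
           (Pairs G X t :: (_, 'e \<Rightarrow> 'e) category) \<and>
         isomorphic_categories
           (Pairs G X t :: (_, 'e \<Rightarrow> 'e) category)
           (slice_category (gC_bundle G X t j) (Vect G X t))"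
proof -
  interpret lie_action_embedding G X t j
    by (intro lie_action_embedding.intro lie_action.intro real_lie_group.intro lie_action_axioms.intro lie_action_embedding_axioms.intro assms)
  show ?thesis using isomorphic_Vect_aff_Pairs isomorphic_Pairs_slice by blast
qed

end
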